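(* Let $T>0$, let $V:\mathcal P(\mathbb R^d)\to\mathcal P(T\mathbb R^d)$ be a probability vector field, and let $\boldsymbol\mu:[0,T]\to\mathcal P(\mathbb R^d)$, $t\mapsto\mu_t$, be such that $$\int_0^T\int_{T\mathbb R^d}|v|\,dV[\mu_t](x,v)\,dt<+\infty .$$ Then $\boldsymbol\mu$ is a solution of the measure differential equation $\dot\mu_t=V[\mu_t]$ if and only if $\boldsymbol\mu$ is a solution of the nonlocal continuity equation $$\partial_t\mu_t+\mathrm{div}(w[\mu_t]\,\mu_t)=0$$ for the Borel vector field $w:\mathbb R^d\times\mathcal P(\mathbb R^d)\to\mathbb R^d$, $(x,\mu)\mapsto w[\mu](x)$, defined by $$w[\mu](x):=\int_{\pi_1^{-1}(x)}v\,d\nu_x[\mu](v)\qquad\text{for }\mu\text{-a.e. }x\in\mathbb R^d,$$ where $\nu_x[\mu]$ denotes the disintegration of $V[\mu]$ with respect to $\pi_1$.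
   Context: Notation: $\mathcal P(X)$ is the set of Borel probability measures on $X$; $T\mathbb R^d=\mathbb R^d\times\mathbb R^d$ with elements $(x,v)$ ($x$ a position, $v$ a velocity); $\pi_1(x,v)=x$; $\sharp$ denotes push-forward; $\langle\mu,f\rangle=\int f\,d\mu$. A probability vector field (PVF) is a map $V:\mathcal P(\mathbb R^d)\to\mathcal P(T\mathbb R^d)$ with $\pi_1\sharp V[\mu]=\mu$ for all $\mu$. By disintegration, $V[\mu]=\mu\otimes\nu_x[\mu]$ for a $\mu$-a.e. uniquely determined Borel family $\{\nu_x[\mu]\}_{x}$ of probability measures on the fibers $\pi_1^{-1}(x)$, identified with $\mathbb R^d$; that is, $\int g\,dV[\mu]=\int_{\mathbb R^d}\int_{\pi_1^{-1}(x)}g(x,v)\,d\nu_x[\mu](v)\,d\mu(x)$ for bounded Borel $g$. Solution of the MDE $\dot\mu_t=V[\mu_t]$ on $[0,T]$: a map $t\mapsto\mu_t\in\mathcal P(\mathbb R^d)$ such that for every $f\in C_c^\infty(\mathbb R^d)$ the quantity $\int_{T\mathbb R^d}\nabla f(x)\cdot v\,dV[\mu_t](x,v)$ is defined for a.e. $t$ and belongs to $L^1([0,T])$ as a function of $t$, the map $t\mapsto\langle\mu_t,f\rangle$ is absolutely continuous, and $$\frac{d}{dt}\langle\mu_t,f\rangle=\int_{T\mathbb R^d}\nabla f(x)\cdot v\,dV[\mu_t](x,v)\quad\text{for a.e. }t\in[0,T].$$ Solution of the continuity equation $\partial_t\mu_t+\mathrm{div}(w_t\mu_t)=0$: a Borel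 family $\{\mu_t\}_{t\in[0,T]}\subseteq\mathcal P(\mathbb R^d)$, with $w:[0,T]\times\mathbb R^d\to\mathbb R^d$ a Borel map, $w_t(x)=w(t,x)$, such that $t\mapsto\int_{\mathbb R^d}|w_t(x)|\,d\mu_t(x)$ belongs to $L^1([0,T])$, and such that for every $f\in C_c^\infty(\mathbb R^d)$, $\frac{d}{dt}\langle\mu_t,f\rangle=\int_{\mathbb R^d}\nabla f(x)\cdot w_t(x)\,d\mu_t(x)$ in the sense of distributions on $(0,T)$. The nonlocal equation is understood in the same distributional sense, with $w_t(x)=w[\mu_t](x)$.
   Formalization: Since the continuity equation ignores null sets of times, the equivalence is for narrowly continuous solutions of it; any other solution agrees for a.e. t with an MDE solution. Joint Borel measurability of w, and measurability in t of the speed integral, are assumed. *)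

theory Defs
  imports "HOL-Probability.Probability"
begin

(* The sigma-algebra of prob_algebra borel is generated by the evaluations m |-> m(B);
   on a Euclidean space it is the Borel sigma-algebra of the narrow topology. *)
abbreviation borel_probs :: "'a::topological_space measure set"
  where "borel_probs \<equiv> space (prob_algebra borel)"

primrec cont_diff :: "nat \<Rightarrow> ('a::euclidean_space \<Rightarrow> real) \<Rightarrow> bool" where
  "cont_diff 0 f \<longleftrightarrow> continuous_on UNIV f"
| "cont_diff (Suc k) f \<longleftrightarrow> f differentiable_on UNIV \<and>
     (\<forall>i\<in>Basis. cont_diff k (\<lambda>x. frechet_derivative f (at x) i))"

definition fun_support :: "('a::topological_space \<Rightarrow> real) \<Rightarrow> 'a set"
  where "fun_support f = closure {x. f x \<noteq> 0}"

definition test_functions :: "('a::euclidean_space \<Rightarrow> real) set"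
  where "test_functions = {f. (\<forall>k. cont_diff k f) \<and> compact (fun_support f)}"

definition gradient :: "('a::euclidean_space \<Rightarrow> real) \<Rightarrow> 'a \<Rightarrow> 'a"
  where "gradient f x = (THE D. GDERIV f x :> D)"

definition probability_vector_field ::
  "('a::euclidean_space measure \<Rightarrow> ('a \<times> 'a) measure) \<Rightarrow> bool" where
  "probability_vector_field V \<longleftrightarrow>
     (\<forall>m\<in>borel_probs. V m \<in> borel_probs \<and> distr (V m) borel fst = m)"

definition disintegration ::
  "('a::euclidean_space \<times> 'a) measure \<Rightarrow> 'a measure \<Rightarrow> ('a \<Rightarrow> 'a measure) \<Rightarrow> bool" where
  "disintegration M m \<nu> \<longleftrightarrow> \<nu> \<in> borel \<rightarrow>\<^sub>M prob_algebra borel \<and>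
     (\<forall>g \<in> borel_measurable borel. bounded (range g) \<longrightarrow>
        (\<integral>z. g z \<partial>M) = (\<integral>x. (\<integral>v. (g (x, v) :: real) \<partial>\<nu> x) \<partial>m))"

definition absolutely_continuous_fun :: "real \<Rightarrow> (real \<Rightarrow> real) \<Rightarrow> bool" where
  "absolutely_continuous_fun T F \<longleftrightarrow>
     (\<forall>\<epsilon>>0. \<exists>\<delta>>0. \<forall>(n::nat) a b.
        (\<forall>i<n. 0 \<le> a i \<and> a i \<le> b i \<and> b i \<le> T) \<and>
        disjoint_family_on (\<lambda>i. {a i<..<b i}) {..<n} \<and>
        (\<Sum>i<n. b i - a i) < \<delta>
        \<longrightarrow> (\<Sum>i<n. \<bar>F (b i) - F (a i)\<bar>) < \<epsilon>)"

definition mde_solution ::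
  "real \<Rightarrow> ('a::euclidean_space measure \<Rightarrow> ('a \<times> 'a) measure) \<Rightarrow> (real \<Rightarrow> 'a measure) \<Rightarrow> bool" where
  "mde_solution T V \<mu> \<longleftrightarrow> (\<forall>t\<in>{0..T}. \<mu> t \<in> borel_probs) \<and>
     (\<forall>f\<in>test_functions.
        (AE t in lebesgue_on {0..T}. integrable (V (\<mu> t)) (\<lambda>(x, v). gradient f x \<bullet> v)) \<and>
        integrable (lebesgue_on {0..T}) (\<lambda>t. \<integral>(x, v). gradient f x \<bullet> v \<partial>V (\<mu> t)) \<and>
        absolutely_continuous_fun T (\<lambda>t. \<integral>x. f x \<partial>\<mu> t) \<and>
        (AE t in lebesgue_on {0..T}.
           ((\<lambda>s. \<integral>x. f x \<partial>\<mu> s) has_real_derivative (\<integral>(x, v). gradient f x \<bullet> v \<partial>V (\<mu> t)))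
             (at t within {0..T})))"

definition distributional_derivative :: "real \<Rightarrow> (real \<Rightarrow> real) \<Rightarrow> (real \<Rightarrow> real) \<Rightarrow> bool" where
  "distributional_derivative T u g \<longleftrightarrow>
     (\<forall>a b. 0 < a \<and> b < T \<longrightarrow>
        integrable (lebesgue_on {a..b}) u \<and> integrable (lebesgue_on {a..b}) g) \<and>
     (\<forall>\<phi>\<in>test_functions. fun_support \<phi> \<subseteq> {0<..<T} \<longrightarrow>
        (\<integral>t. deriv \<phi> t * u t \<partial>lebesgue_on {0<..<T}) = - (\<integral>t. \<phi> t * g t \<partial>lebesgue_on {0<..<T}))"

(* No continuity in time is required here: changing \<mu> on a Lebesgue-null Borel set of times
   does not affect this notion. The L^1 condition is an extended integral, so that no
   convention about non-integrable functions enters. *)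
definition ce_solution ::
  "real \<Rightarrow> (real \<Rightarrow> 'a::euclidean_space \<Rightarrow> 'a) \<Rightarrow> (real \<Rightarrow> 'a measure) \<Rightarrow> bool" where
  "ce_solution T w \<mu> \<longleftrightarrow>
     \<mu> \<in> restrict_space borel {0..T} \<rightarrow>\<^sub>M prob_algebra borel \<and>
     (\<lambda>(t, x). w t x) \<in> borel_measurable (restrict_space borel {0..T} \<Otimes>\<^sub>M borel) \<and>
     (\<integral>\<^sup>+t. (\<integral>\<^sup>+x. ennreal (norm (w t x)) \<partial>\<mu> t) \<partial>lebesgue_on {0..T}) < \<infinity> \<and>
     (\<forall>f\<in>test_functions.
        distributional_derivative T (\<lambda>t. \<integral>x. f x \<partial>\<mu> t) (\<lambda>t. \<integral>x. gradient f x \<bullet> w t x \<partial>\<mu> t))"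

definition nonlocal_ce_solution ::
  "real \<Rightarrow> ('a::euclidean_space measure \<Rightarrow> 'a \<Rightarrow> 'a) \<Rightarrow> (real \<Rightarrow> 'a measure) \<Rightarrow> bool" where
  "nonlocal_ce_solution T w \<mu> \<longleftrightarrow> ce_solution T (\<lambda>t x. w (\<mu> t) x) \<mu>"

(* The value of w m at x is prescribed only where the barycentre of the fibre measure exists. *)
definition barycentric_field ::
  "('a::euclidean_space measure \<Rightarrow> 'a \<Rightarrow> 'a measure) \<Rightarrow> ('a measure \<Rightarrow> 'a \<Rightarrow> 'a) \<Rightarrow> bool" where
  "barycentric_field \<nu> w \<longleftrightarrow>
     (\<lambda>(x, m). w m x) \<in> borel_measurable (borel \<Otimes>\<^sub>M prob_algebra borel) \<and>
     (\<forall>m\<in>borel_probs. AE x in m. integrable (\<nu> m x) (\<lambda>v. v) \<longrightarrow> w m x = (\<integral>v. v \<partial>\<nu> m x))"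

definition narrowly_continuous :: "real \<Rightarrow> (real \<Rightarrow> 'a::euclidean_space measure) \<Rightarrow> bool" where
  "narrowly_continuous T \<mu> \<longleftrightarrow>
     (\<forall>f :: 'a \<Rightarrow> real. continuous_on UNIV f \<and> bounded (range f) \<longrightarrow>
        continuous_on {0..T} (\<lambda>t. \<integral>x. f x \<partial>\<mu> t))"

end

(* By disintegration the flux of V[mu] against a gradient equals that of w[mu] mu, so both equations
   prescribe the same integrable function g_f of time for each test function f, and they differ only in
   the sense in which <mu_t, f> has derivative g_f.  Absolute continuity with derivative g_f a.e. yields
   the distributional identity by integration by parts; conversely, by du Bois-Reymond, the distributional
   identity says that <mu_t, f> = c_f + (integral of g_f over [0,t]) for a.e. t.  If mu is narrowly
   continuous this holds for every t.  In general one has to produce at every t a probability measure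
   whose pairing with every f is the right-hand side: it is a vague limit of averages of mu over shrinking
   time intervals around t, and it has mass 1 because cutoffs at scale R have gradient O(1/R).  It agrees
   with mu_t for a.e. t since countably many test functions determine a measure. *)

theory Submission
  imports Defs
begin


section \<open>Test functions\<close>

text \<open>The distributional equation is blind to null sets of times, while the other equation
  constrains <mu_t, f> at every t; to close this gap without continuity an actual measure is needed
  at each time, not only a linear functional on test functions. The finite first moment of V enters
  twice: |g_f| <= sup |grad f| times the integral of |v| against V[mu_t] makes g_f integrable, and
  the same bound limits the change in time of the pairing with a cutoff at scale R to a constant
  over R, so that no mass escapes to infinity. \<open>V\<close> is an arbitrary map without
  regularity in its argument. Apart from its first moment, measurability in time is therefore read
  off from \<open>w\<close> and \<open>\<mu>\<close> and passed to integrals against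
  \<open>V\<close> by equality almost everywhere. Test functions are defined through iterated
  Frechet derivatives, so every bump below is built from exp (- 1 / x). Absolute continuity is the
  epsilon-delta notion, so both halves of Lebesgue's fundamental theorem are proved for it.\<close>

lemma gderiv_gradient:
  fixes f :: "'a::euclidean_space \<Rightarrow> real"
  assumes "f differentiable (at x)"
  shows "GDERIV f x :> gradient f x"
proof -
  obtain f' where f': "(f has_derivative f') (at x)"
    using assms by (auto simp: differentiable_def)
  then interpret bounded_linear f' by (rule has_derivative_bounded_linear)
  have "f' h = h \<bullet> (\<Sum>i\<in>Basis. f' i *\<^sub>R i)" for h
  proof -
    have "f' h = f' (\<Sum>i\<in>Basis. (h \<bullet> i) *\<^sub>R i)"
      by (simp add: euclidean_representation)
    also have "\<dots> = (\<Sum>i\<in>Basis. (h \<bullet> i) * f' i)"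
      by (simp add: sum scale)
    finally show ?thesis
      by (simp add: inner_sum_right mult.commute)
  qed
  with f' have ex: "GDERIV f x :> (\<Sum>i\<in>Basis. f' i *\<^sub>R i)"
    unfolding gderiv_def by (metis (no_types, lifting) ext)
  \<comment> \<open>\<open>gradient\<close> is a definite description, so the Riesz vector found
    above must also be unique before \<open>gradient\<close> can be identified with it.\<close>
  have "D = D'" if "GDERIV f x :> D" "GDERIV f x :> D'" for D D'
  proof -
    have "(\<lambda>h. h \<bullet> D) = (\<lambda>h. h \<bullet> D')"
      using that unfolding gderiv_def by (rule has_derivative_unique)
    then show ?thesis
      by (metis inner_commute vector_eq_ldot)
  qed
  then have "\<exists>!D. GDERIV f x :> D"
    using ex by blast
  then show ?thesis
    unfolding gradient_def by (rule theI')
qed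

lemma gradient_unique:
  fixes f :: "'a::euclidean_space \<Rightarrow> real"
  assumes "GDERIV f x :> D"
  shows "gradient f x = D"
proof -
  have "GDERIV f x :> gradient f x"
    using assms by (intro gderiv_gradient) (auto simp: gderiv_def differentiable_def)
  then have "(\<lambda>h. h \<bullet> gradient f x) = (\<lambda>h. h \<bullet> D)"
    using assms unfolding gderiv_def by (rule has_derivative_unique)
  then show ?thesis
    by (metis inner_commute vector_eq_ldot)
qed

lemma gradient_frechet:
  fixes f :: "'a::euclidean_space \<Rightarrow> real"
  assumes "f differentiable (at x)"
  shows "gradient f x = (\<Sum>i\<in>Basis. frechet_derivative f (at x) i *\<^sub>R i)"
proof -
  have "frechet_derivative f (at x) = (\<lambda>h. h \<bullet> gradient f x)"
    using gderiv_gradient[OF assms] frechet_derivative_at unfolding gderiv_def by metis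
  then show ?thesis
    by (simp add: euclidean_representation inner_commute[of _ "gradient f x"])
qed

section \<open>Calculus of finitely often differentiable functions\<close>

text \<open>\<open>cont_diff (Suc k)\<close> asks for differentiability and conditions on the
  partial derivatives only; going down one order rests, at the bottom, on the continuity of
  differentiable functions.\<close>

lemma cont_diff_Suc_imp: "cont_diff (Suc k) f \<Longrightarrow> cont_diff k f"
proof (induction k arbitrary: f)
  case 0
  then show ?case
    by (auto intro: differentiable_imp_continuous_on)
next
  case (Suc k)
  then show ?case by (metis cont_diff.simps(2))
qed

lemma cont_diff_const: "cont_diff k (\<lambda>x::'a::euclidean_space. c)"
  by (induction k arbitrary: c) auto

text \<open>\<open>frechet_derivative\<close> is a chosen function. By uniqueness it coincides with
  any derivative at hand, so smoothness can be shown from explicit formulas; closure under sums,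
  products and dilations goes through this rule.\<close>

lemma cont_diff_SucI:
  assumes "\<And>x. (f has_derivative f' x) (at x)" "\<And>i. i \<in> Basis \<Longrightarrow> cont_diff k (\<lambda>x. f' x i)"
  shows "cont_diff (Suc k) f"
proof -
  have "frechet_derivative f (at x) = f' x" for x
    using assms(1) frechet_derivative_at by metis
  then show ?thesis
    using assms by (auto simp: differentiable_on_def differentiable_def)
qed

lemma cont_diff_has_derivative:
  assumes "cont_diff (Suc k) f"
  shows "(f has_derivative frechet_derivative f (at x)) (at x)"
  using assms by (auto simp: differentiable_on_def frechet_derivative_works[symmetric])

lemma cont_diff_add:
  assumes "cont_diff k f" "cont_diff k g"
  shows "cont_diff k (\<lambda>x. f x + g x)"
  using assms
proof (induction k arbitrary: f g)
  case 0
  then show ?case by (auto intro: continuous_intros)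
next
  case (Suc k)
  show ?case
    by (rule cont_diff_SucI[OF has_derivative_add])
       (use Suc in \<open>auto intro!: cont_diff_has_derivative simp del: cont_diff.simps\<close>, auto)
qed

lemma cont_diff_mult:
  assumes "cont_diff k f" "cont_diff k g"
  shows "cont_diff k (\<lambda>x. f x * g x)"
  using assms
proof (induction k arbitrary: f g)
  case 0
  then show ?case by (auto intro: continuous_intros)
next
  case (Suc k)
  show ?case
  proof (rule cont_diff_SucI)
    show "((\<lambda>x. f x * g x) has_derivative (\<lambda>h. f x * frechet_derivative g (at x) h
        + frechet_derivative f (at x) h * g x)) (at x)" for x
      using Suc.prems cont_diff_has_derivative by (intro has_derivative_mult) auto
    show "cont_diff k (\<lambda>x. f x * frechet_derivative g (at x) i + frechet_derivative f (at x) i * g x)"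
      if "i \<in> Basis" for i
      using Suc.prems that cont_diff_Suc_imp[OF Suc.prems(1)] cont_diff_Suc_imp[OF Suc.prems(2)]
      by (intro cont_diff_add Suc.IH) auto
  qed
qed

lemma cont_diff_prod: "(\<And>i. i \<in> I \<Longrightarrow> cont_diff k (f i)) \<Longrightarrow> cont_diff k (\<lambda>x. \<Prod>i\<in>I. f i x)"
  by (induction I rule: infinite_finite_induct) (auto intro: cont_diff_mult cont_diff_const)

lemma cont_diff_power: "cont_diff k f \<Longrightarrow> cont_diff k (\<lambda>x. f x ^ n)"
  by (induction n) (auto intro: cont_diff_mult cont_diff_const)

lemma cont_diff_one_minus: "cont_diff k f \<Longrightarrow> cont_diff k (\<lambda>x. 1 - f x)"
  using cont_diff_add[OF cont_diff_const[of k 1] cont_diff_mult[OF cont_diff_const[of k "-1"]], of f] by simp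

section \<open>Smooth bumps on boxes\<close>

text \<open>The index 0 gives the classical smooth function that is flat at the origin. The powers
  of 1/x are carried along because differentiation produces them: the family is closed under
  differentiation up to linear combinations.\<close>

definition flat :: "nat \<Rightarrow> real \<Rightarrow> real"
  where "flat n x = (if x \<le> 0 then 0 else (1 / x) ^ n * exp (- (1 / x)))"

lemma flat_tendsto_0: "(flat n \<longlongrightarrow> 0) (at 0)"
proof -
  \<comment> \<open>With y = 1/x this is y^n / exp y as y tends to infinity.\<close>
  have "((\<lambda>x::real. inverse x ^ n / exp (inverse x)) \<longlongrightarrow> 0) (at_right 0)"
    by (rule filterlim_compose[OF tendsto_power_div_exp_0 filterlim_inverse_at_top_right])
  then have "(flat n \<longlongrightarrow> 0) (at_right 0)"
    by (rule Lim_transform_eventually)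
       (auto simp: eventually_at_filter flat_def exp_minus field_simps)
  moreover have "(flat n \<longlongrightarrow> 0) (at_left 0)"
    by (rule Lim_transform_eventually[OF tendsto_const]) (auto simp: eventually_at_filter flat_def)
  ultimately show ?thesis
    by (simp add: filterlim_split_at)
qed

lemma flat_has_derivative:
  "(flat n has_real_derivative flat (n + 2) x - real n * flat (n + 1) x) (at x)"
proof (cases x "0::real" rule: linorder_cases)
  case less
  have "((\<lambda>x. 0) has_real_derivative 0) (at x)" by simp
  moreover have "eventually (\<lambda>y. 0 = flat n y) (nhds x)"
    using eventually_nhds_in_open[of "{..<0}" x] less
    by (auto elim!: eventually_mono simp: flat_def)
  ultimately have "(flat n has_real_derivative 0) (at x)"
    using less by (subst DERIV_cong_ev[OF refl _ refl]) (auto elim: eventually_mono)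
  then show ?thesis using less by (simp add: flat_def)
next
  case equal
  \<comment> \<open>Dividing by y adds one factor 1/y: the difference quotient at 0 is
    \<open>flat (n + 1)\<close>, which tends to 0.\<close>
  have "((\<lambda>y. (flat n (0 + y) - flat n 0) / y) \<longlongrightarrow> 0) (at 0)"
    by (rule Lim_transform_eventually[OF flat_tendsto_0[of "n + 1"]])
       (auto simp: eventually_at_filter flat_def field_simps)
  then show ?thesis
    using equal by (simp add: DERIV_def flat_def)
next
  case greater
  have d: "((\<lambda>x. 1 / x) has_real_derivative - ((1 / x)\<^sup>2)) (at x)"
    using greater by (auto intro!: derivative_eq_intros simp: power2_eq_square)
  have "((\<lambda>x. (1 / x) ^ n) has_real_derivative real n * (- ((1 / x)\<^sup>2) * (1 / x) ^ (n - 1))) (at x)"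
    using DERIV_power[OF d, of n] by simp
  moreover have "((\<lambda>x. exp (- (1 / x))) has_real_derivative exp (- (1 / x)) * (1 / x)\<^sup>2) (at x)"
    using DERIV_chain2[OF DERIV_exp DERIV_minus[OF d]] by simp
  ultimately have "((\<lambda>x. (1 / x) ^ n * exp (- (1 / x))) has_real_derivative
      real n * (- ((1 / x)\<^sup>2) * (1 / x) ^ (n - 1)) * exp (- (1 / x)) +
      exp (- (1 / x)) * (1 / x)\<^sup>2 * (1 / x) ^ n) (at x)"
    by (rule DERIV_mult)
  \<comment> \<open>For n = 0 the truncated \<open>n - 1\<close> is harmless, since the factor n
    vanishes.\<close>
  moreover have "real n * ((1 / x)\<^sup>2 * (1 / x) ^ (n - 1)) = real n * (1 / x) ^ (n + 1)"
    by (cases n) (auto simp: power2_eq_square)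
  then have "real n * (- ((1 / x)\<^sup>2) * (1 / x) ^ (n - 1)) * exp (- (1 / x)) +
      exp (- (1 / x)) * (1 / x)\<^sup>2 * (1 / x) ^ n = flat (n + 2) x - real n * flat (n + 1) x"
    using greater by (cases n) (simp_all add: flat_def power2_eq_square algebra_simps)
  ultimately have "((\<lambda>x. (1 / x) ^ n * exp (- (1 / x))) has_real_derivative flat (n + 2) x - real n * flat (n + 1) x) (at x)"
    by (rule DERIV_cong)
  moreover have "eventually (\<lambda>y. flat n y = (1 / y) ^ n * exp (- (1 / y))) (nhds x)"
    using eventually_nhds_in_open[of "{0<..}" x] greater
    by (auto elim!: eventually_mono simp: flat_def)
  ultimately show ?thesis
    by (subst DERIV_cong_ev[OF refl _ refl]) auto
qed

text \<open>The induction generalises \<open>n\<close> because each derivative raises the index by 1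
  and by 2. Slopes s = 1 and s = -1 give the distances to two opposite faces of a box.\<close>

lemma cont_diff_flat_affine:
  "cont_diff k (\<lambda>x::'a::euclidean_space. flat n (c + s * (x \<bullet> i)))"
proof (induction k arbitrary: n)
  case 0
  have "continuous_on UNIV (flat n)" for n
    using flat_has_derivative DERIV_isCont continuous_at_imp_continuous_on by blast
  then have "continuous_on UNIV (flat n \<circ> (\<lambda>x::'a. c + s * (x \<bullet> i)))"
    by (intro continuous_on_compose continuous_intros) (auto intro: continuous_on_subset)
  then show ?case by (simp add: o_def)
next
  case (Suc k)
  let ?A = "\<lambda>x::'a. c + s * (x \<bullet> i)"
  show ?case
  proof (rule cont_diff_SucI)
    show "((\<lambda>x. flat n (?A x)) has_derivative
        (\<lambda>h. (s * (h \<bullet> i)) * (flat (n + 2) (?A x) - real n * flat (n + 1) (?A x)))) (at x)" for x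
      by (rule DERIV_compose_FDERIV[OF flat_has_derivative]) (auto intro!: derivative_eq_intros)
    have "cont_diff k (\<lambda>x. (s * (j \<bullet> i)) * (flat (n + 2) (?A x) + (- real n) * flat (n + 1) (?A x)))" for j
      by (intro cont_diff_mult cont_diff_add cont_diff_const Suc)
    then show "cont_diff k (\<lambda>x. (s * (j \<bullet> i)) * (flat (n + 2) (?A x) - real n * flat (n + 1) (?A x)))" for j
      by simp
  qed
qed

section \<open>Continuity and boundedness of test functions and their gradients\<close>

lemma test_function_has_gradient:
  assumes "f \<in> test_functions"
  shows "GDERIV f x :> gradient f x"
proof (rule gderiv_gradient)
  have "cont_diff (Suc 0) f" using assms by (auto simp: test_functions_def simp del: cont_diff.simps)
  then show "f differentiable (at x)" by (auto simp: differentiable_on_def)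
qed

lemma test_function_continuous: "f \<in> test_functions \<Longrightarrow> continuous_on UNIV f"
  unfolding test_functions_def using cont_diff.simps(1) by blast

lemma continuous_compact_support_bounded:
  fixes f :: "'a::euclidean_space \<Rightarrow> 'b::real_normed_vector"
  assumes "continuous_on UNIV f" "compact K" "\<And>x. x \<notin> K \<Longrightarrow> f x = 0"
  shows "\<exists>B. \<forall>x. norm (f x) \<le> B"
proof -
  have "bounded (f ` K)"
    using assms by (meson compact_continuous_image compact_imp_bounded continuous_on_subset subset_UNIV)
  then obtain B where "\<forall>y\<in>f ` K. norm y \<le> B"
    by (auto simp: bounded_iff)
  then have "norm (f x) \<le> max B 0" for x
    using assms(3) by (cases "x \<in> K") (force simp: le_max_iff_disj)+
  then show ?thesis by blast
qed

lemma eq_0_outside_fun_support: "x \<notin> fun_support f \<Longrightarrow> f x = 0"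
  unfolding fun_support_def using closure_subset by force

lemma test_function_bounded:
  assumes "f \<in> test_functions" shows "\<exists>B. \<forall>x. \<bar>f x\<bar> \<le> B"
  using continuous_compact_support_bounded[of f "fun_support f"] test_function_continuous[OF assms]
    assms eq_0_outside_fun_support by (auto simp: test_functions_def)

lemma gradient_outside_fun_support:
  fixes f :: "'a::euclidean_space \<Rightarrow> real"
  assumes "x \<notin> fun_support f" shows "gradient f x = 0"
proof (rule gradient_unique)
  have "((\<lambda>x. 0) has_derivative (\<lambda>h. h \<bullet> 0)) (at x)" by simp
  then show "GDERIV f x :> 0"
    unfolding gderiv_def
  proof (rule has_derivative_transform_within_open)
    show "open (- fun_support f)" by (simp add: fun_support_def open_Compl)
    show "x \<in> - fun_support f" using assms by simp
    show "0 = f x" if "x \<in> - fun_support f" for x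
      using that eq_0_outside_fun_support by force
  qed
qed

lemma gradient_test_function_continuous:
  fixes f :: "'a::euclidean_space \<Rightarrow> real"
  assumes "f \<in> test_functions"
  shows "continuous_on UNIV (gradient f)"
proof -
  have c: "cont_diff (Suc 0) f" using assms by (auto simp: test_functions_def simp del: cont_diff.simps)
  then have "gradient f = (\<lambda>x. \<Sum>i\<in>Basis. frechet_derivative f (at x) i *\<^sub>R i)"
    by (auto simp: fun_eq_iff differentiable_on_def gradient_frechet)
  moreover have "continuous_on UNIV (\<lambda>x. \<Sum>i\<in>Basis. frechet_derivative f (at x) i *\<^sub>R i)"
    using c by (intro continuous_intros) auto
  ultimately show ?thesis by simp
qed

lemma gradient_test_function_bounded:
  fixes f :: "'a::euclidean_space \<Rightarrow> real"
  assumes "f \<in> test_functions"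
  shows "\<exists>B. \<forall>x. norm (gradient f x) \<le> B"
  using continuous_compact_support_bounded[of "gradient f" "fun_support f"]
    gradient_test_function_continuous[OF assms] assms gradient_outside_fun_support
  by (auto simp: test_functions_def)

lemma test_functionI:
  assumes "\<And>k. cont_diff k f" "compact K" "\<And>x. x \<notin> K \<Longrightarrow> f x = 0"
  shows "f \<in> test_functions"
proof -
  have "{x. f x \<noteq> 0} \<subseteq> K" using assms by auto
  then have "fun_support f \<subseteq> K"
    unfolding fun_support_def using assms(2) by (simp add: closure_minimal compact_imp_closed)
  then have "compact (fun_support f)"
    using assms(2) by (metis closed_closure closed_Int_compact fun_support_def inf.absorb_iff1)
  then show ?thesis using assms by (simp add: test_functions_def)
qed

text \<open>Each factor is positive exactly when x lies strictly on the inner side of one face, so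
  the function is nonzero exactly on the open box. It is not normalised; its values merely lie in
  [0, 1].\<close>

definition box_bump :: "'a::euclidean_space \<Rightarrow> 'a \<Rightarrow> 'a \<Rightarrow> real" where
  "box_bump a b x = (\<Prod>i\<in>Basis. flat 0 (x \<bullet> i - a \<bullet> i) * flat 0 (b \<bullet> i - x \<bullet> i))"

lemma flat_0_nonneg: "0 \<le> flat 0 x" and flat_0_less_1: "flat 0 x < 1"
  and flat_0_pos_iff: "0 < flat 0 x \<longleftrightarrow> 0 < x" and flat_0_eq_0_iff: "flat 0 x = 0 \<longleftrightarrow> x \<le> 0"
  by (auto simp: flat_def)

lemma box_bump_nonneg: "0 \<le> box_bump a b x"
  by (auto simp: box_bump_def intro!: prod_nonneg mult_nonneg_nonneg flat_0_nonneg)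

lemma box_bump_le_1: "box_bump a b x \<le> 1"
  unfolding box_bump_def
  by (intro prod_le_1 conjI mult_nonneg_nonneg mult_le_one flat_0_nonneg less_imp_le[OF flat_0_less_1])

lemma box_bump_eq_0_iff: "box_bump a b x = 0 \<longleftrightarrow> x \<notin> box a b"
  by (auto simp: box_bump_def flat_0_eq_0_iff mem_box) force+

lemma cont_diff_box_bump: "cont_diff k (box_bump a b)"
proof -
  have "cont_diff k (\<lambda>x. \<Prod>i\<in>Basis. flat 0 (- (a \<bullet> i) + 1 * (x \<bullet> i)) * flat 0 (b \<bullet> i + (-1) * (x \<bullet> i)))"
    by (intro cont_diff_prod cont_diff_mult cont_diff_flat_affine)
  also have "(\<lambda>x. \<Prod>i\<in>Basis. flat 0 (- (a \<bullet> i) + 1 * (x \<bullet> i)) * flat 0 (b \<bullet> i + (-1) * (x \<bullet> i))) = box_bump a b"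
    by (auto simp: box_bump_def fun_eq_iff intro!: prod.cong arg_cong2[where f="(*)"] arg_cong[where f="flat 0"])
  finally show ?thesis .
qed

text \<open>At a point of one of the boxes the product is eventually bounded by a constant below 1,
  so its powers tend to 0 and the values tend to 1.\<close>

definition boxes_bump :: "(nat \<Rightarrow> 'a::euclidean_space \<times> 'a) \<Rightarrow> nat \<Rightarrow> 'a \<Rightarrow> real" where
  "boxes_bump c n x = 1 - (\<Prod>j<n. 1 - box_bump (fst (c j)) (snd (c j)) x) ^ n"

text \<open>The index \<open>n\<close> has two roles: it cuts the union down to finitely many boxes,
  which keeps the support compact, and it is the exponent that drives the values to 1. One sequence
  of test functions thus exhausts a whole open set.\<close>

lemma boxes_bump_test_function: "boxes_bump c n \<in> test_functions"
proof (rule test_functionI)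
  show "cont_diff k (boxes_bump c n)" for k
    unfolding boxes_bump_def[abs_def]
    by (intro cont_diff_one_minus cont_diff_power cont_diff_prod cont_diff_box_bump)
  show "compact (\<Union>j<n. cbox (fst (c j)) (snd (c j)))"
    by (intro compact_UN compact_cbox) auto
  show "boxes_bump c n x = 0" if "x \<notin> (\<Union>j<n. cbox (fst (c j)) (snd (c j)))" for x
  proof -
    have "box_bump (fst (c j)) (snd (c j)) x = 0" if "j < n" for j
      using that \<open>x \<notin> _\<close> box_subset_cbox[of "fst (c j)" "snd (c j)"]
      by (auto simp: box_bump_eq_0_iff)
    then show ?thesis by (simp add: boxes_bump_def)
  qed
qed

lemma boxes_bump_nonneg: "0 \<le> boxes_bump c n x" and boxes_bump_le_1: "boxes_bump c n x \<le> 1"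
proof -
  have "0 \<le> (\<Prod>j<n. 1 - box_bump (fst (c j)) (snd (c j)) x)"
    by (intro prod_nonneg) (simp add: box_bump_le_1)
  moreover have "(\<Prod>j<n. 1 - box_bump (fst (c j)) (snd (c j)) x) \<le> 1"
    by (intro prod_le_1) (simp add: box_bump_le_1 box_bump_nonneg)
  ultimately show "0 \<le> boxes_bump c n x" "boxes_bump c n x \<le> 1"
    by (auto simp: boxes_bump_def power_le_one)
qed

lemma boxes_bump_le_indicator:
  "boxes_bump c n x \<le> indicator (\<Union>j. box (fst (c j)) (snd (c j))) x"
proof (cases "x \<in> (\<Union>j. box (fst (c j)) (snd (c j)))")
  case False
  then have "box_bump (fst (c j)) (snd (c j)) x = 0" for j
    by (auto simp: box_bump_eq_0_iff)
  then show ?thesis by (simp add: boxes_bump_def)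
qed (simp add: boxes_bump_le_1)

lemma boxes_bump_tendsto:
  "(\<lambda>n. boxes_bump c n x) \<longlonglongrightarrow> indicator (\<Union>j. box (fst (c j)) (snd (c j))) x"
proof (cases "x \<in> (\<Union>j. box (fst (c j)) (snd (c j)))")
  case True
  then obtain j where j: "x \<in> box (fst (c j)) (snd (c j))" by auto
  define \<beta> where "\<beta> j = box_bump (fst (c j)) (snd (c j)) x" for j
  have \<beta>: "0 \<le> \<beta> i" "\<beta> i \<le> 1" for i
    by (auto simp: \<beta>_def box_bump_nonneg box_bump_le_1)
  have "\<beta> j \<noteq> 0" using j by (auto simp: \<beta>_def box_bump_eq_0_iff)
  with \<beta>[of j] have "0 < \<beta> j" by simp
  have "(\<lambda>n. (1 - \<beta> j) ^ n) \<longlonglongrightarrow> 0"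
    using \<beta>[of j] \<open>0 < \<beta> j\<close> by (intro LIMSEQ_power_zero) auto
  then have "(\<lambda>n. (\<Prod>j<n. 1 - \<beta> j) ^ n) \<longlonglongrightarrow> 0"
  proof (rule tendsto_sandwich[OF _ _ tendsto_const, rotated 2])
    show "\<forall>\<^sub>F n in sequentially. 0 \<le> (\<Prod>j<n. 1 - \<beta> j) ^ n"
      using \<beta> by (auto intro!: always_eventually zero_le_power prod_nonneg)
    show "\<forall>\<^sub>F n in sequentially. (\<Prod>j<n. 1 - \<beta> j) ^ n \<le> (1 - \<beta> j) ^ n"
      using eventually_gt_at_top[of j]
    proof eventually_elim
      case (elim n)
      have "(\<Prod>j<n. 1 - \<beta> j) = (1 - \<beta> j) * (\<Prod>j\<in>{..<n} - {j}. 1 - \<beta> j)"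
        using elim by (intro prod.remove) auto
      also have "\<dots> \<le> (1 - \<beta> j) * 1"
        using \<beta> by (intro mult_left_mono prod_le_1) auto
      finally show ?case
        using \<beta> by (intro power_mono) (auto intro!: prod_nonneg)
    qed
  qed
  then have "(\<lambda>n. 1 - (\<Prod>j<n. 1 - \<beta> j) ^ n) \<longlonglongrightarrow> 1 - 0"
    by (intro tendsto_intros)
  then show ?thesis using True by (simp add: boxes_bump_def \<beta>_def)
next
  case False
  then have "box_bump (fst (c j)) (snd (c j)) x = 0" for j
    by (auto simp: box_bump_eq_0_iff)
  then show ?thesis using False by (simp add: boxes_bump_def)
qed

lemma open_eq_UN_boxes:
  fixes U :: "'a::euclidean_space set"
  assumes "open U"
  shows "\<exists>c :: nat \<Rightarrow> 'a \<times> 'a. U = (\<Union>j. box (fst (c j)) (snd (c j)))"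
proof -
  obtain D where D: "countable D" "\<And>X. X \<in> D \<Longrightarrow> \<exists>a b. X = box a b" "\<Union>D = U"
    using open_countable_Union_open_box[OF assms] by metis
  \<comment> \<open>The empty box is added so that the countable family is nonempty and can be
    listed by all naturals.\<close>
  let ?D = "insert (box (0::'a) 0) D"
  obtain X :: "nat \<Rightarrow> 'a set" where X: "range X = ?D"
    using uncountable_def[of ?D] D(1) by (metis countable_insert insert_not_empty)
  have "\<exists>p. X j = box (fst p) (snd p)" for j
    using D(2) X by (metis fst_conv insert_iff rangeI snd_conv)
  then obtain c where "\<And>j. X j = box (fst (c j)) (snd (c j))" by metis
  moreover have "U = \<Union>(range X)" using D(3) X by auto
  ultimately show ?thesis by auto
qed

section \<open>Dilated cutoffs\<close>

lemma cont_diff_scale: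
  assumes "cont_diff k f" shows "cont_diff k (\<lambda>x. f (r *\<^sub>R x))"
  using assms
proof (induction k arbitrary: f)
  case 0
  then have "continuous_on UNIV (f \<circ> (\<lambda>x. r *\<^sub>R x))"
    by (intro continuous_on_compose continuous_intros) (auto intro: continuous_on_subset)
  then show ?case by (simp add: o_def)
next
  case (Suc k)
  show ?case
  proof (rule cont_diff_SucI)
    show "((\<lambda>x. f (r *\<^sub>R x)) has_derivative (\<lambda>h. frechet_derivative f (at (r *\<^sub>R x)) (r *\<^sub>R h))) (at x)" for x
      by (rule has_derivative_compose[OF _ cont_diff_has_derivative[OF Suc.prems]])
         (auto intro!: derivative_eq_intros)
    have "linear (frechet_derivative f (at y))" for y
      using cont_diff_has_derivative[OF Suc.prems] has_derivative_linear by blast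
    then have "(\<lambda>x. frechet_derivative f (at (r *\<^sub>R x)) (r *\<^sub>R i)) = (\<lambda>x. r * frechet_derivative f (at (r *\<^sub>R x)) i)" for i
      by (auto simp: linear_cmul)
    then show "cont_diff k (\<lambda>x. frechet_derivative f (at (r *\<^sub>R x)) (r *\<^sub>R i))" if "i \<in> Basis" for i
      using Suc that by (auto intro!: cont_diff_mult cont_diff_const)
  qed
qed

lemma test_function_mult_const: "f \<in> test_functions \<Longrightarrow> (\<lambda>x. c * f x) \<in> test_functions"
  by (rule test_functionI[of _ "fun_support f"])
     (auto simp: test_functions_def eq_0_outside_fun_support intro!: cont_diff_mult cont_diff_const)

lemma test_function_scale:
  assumes "f \<in> test_functions" "r \<noteq> 0"
  shows "(\<lambda>x. f (r *\<^sub>R x)) \<in> test_functions"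
proof (rule test_functionI[where K = "(\<lambda>x. x /\<^sub>R r) ` fun_support f"])
  show "compact ((\<lambda>x. x /\<^sub>R r) ` fun_support f)"
    using assms by (auto simp: test_functions_def intro!: compact_scaling)
  show "f (r *\<^sub>R x) = 0" if "x \<notin> (\<lambda>x. x /\<^sub>R r) ` fun_support f" for x
  proof (rule eq_0_outside_fun_support[of "r *\<^sub>R x" f])
    have "x = (r *\<^sub>R x) /\<^sub>R r" using assms by simp
    then show "r *\<^sub>R x \<notin> fun_support f" using that by blast
  qed
qed (use assms in \<open>auto simp: test_functions_def intro!: cont_diff_scale\<close>)

lemma box_bump_test_function: "box_bump a b \<in> test_functions"
proof (rule test_functionI[OF cont_diff_box_bump compact_cbox])
  show "box_bump a b x = 0" if "x \<notin> cbox a b" for x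
    using that box_subset_cbox[of a b] by (auto simp: box_bump_eq_0_iff)
qed

text \<open>The normalisation is at the origin: the dilations h (x / n) converge pointwise to h 0 =
  1 by continuity, which recovers total masses by dominated convergence.\<close>

lemma exists_cutoff:
  obtains h :: "'a::euclidean_space \<Rightarrow> real"
  where "h \<in> test_functions" "h 0 = 1" "\<And>x. 0 \<le> h x"
proof -
  let ?b = "box_bump (- One) (One::'a)"
  have "0 \<in> box (- One) (One::'a)" by (auto simp: mem_box)
  then have "?b 0 \<noteq> 0" by (simp add: box_bump_eq_0_iff)
  then have 1: "(1 / ?b 0) * ?b 0 = 1" by simp
  have 2: "(\<lambda>x. (1 / ?b 0) * ?b x) \<in> test_functions"
    by (intro test_function_mult_const box_bump_test_function)
  have 3: "0 \<le> (1 / ?b 0) * ?b x" for x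
    by (simp add: box_bump_nonneg)
  show ?thesis by (rule that[OF 2 1 3])
qed

lemma gradient_scale:
  assumes "f \<in> test_functions"
  shows "gradient (\<lambda>x. f (r *\<^sub>R x)) x = r *\<^sub>R gradient f (r *\<^sub>R x)"
proof (rule gradient_unique)
  have "((\<lambda>x. f (r *\<^sub>R x)) has_derivative (\<lambda>h. (r *\<^sub>R h) \<bullet> gradient f (r *\<^sub>R x))) (at x)"
    by (rule has_derivative_compose[OF _ test_function_has_gradient[OF assms, unfolded gderiv_def]])
       (auto intro!: derivative_eq_intros)
  then show "GDERIV (\<lambda>x. f (r *\<^sub>R x)) x :> r *\<^sub>R gradient f (r *\<^sub>R x)"
    by (simp add: gderiv_def)
qed

lemma cont_diff_real_SucI:
  fixes f :: "real \<Rightarrow> real"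
  assumes "\<And>x. (f has_real_derivative f' x) (at x)" "cont_diff k f'"
  shows "cont_diff (Suc k) f"
  by (rule cont_diff_SucI[of f "\<lambda>x h. h * f' x"])
     (use assms in \<open>auto simp: has_field_derivative_def mult.commute[of "f' _"] mult_commute_abs\<close>)

lemma test_function_has_real_derivative:
  assumes "\<phi> \<in> test_functions"
  shows "(\<phi> has_real_derivative deriv \<phi> x) (at x)"
  using test_function_has_gradient[OF assms, of x]
  by (metis DERIV_imp_deriv gderiv_def has_field_derivative_def inner_real_def mult_commute_abs)

lemma deriv_test_function_continuous:
  assumes "\<phi> \<in> test_functions"
  shows "continuous_on UNIV (deriv \<phi>)"
proof -
  have "deriv \<phi> = gradient \<phi>"
    using test_function_has_gradient[OF assms]
    by (auto simp: fun_eq_iff gderiv_def has_field_derivative_def mult_commute_abs intro!: DERIV_imp_deriv)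
  then show ?thesis using gradient_test_function_continuous[OF assms] by simp
qed


section \<open>Absolutely continuous functions of one variable\<close>

text \<open>The differentiation theorem applied here controls averages over intervals to the right
  of a point. Applied also to the reflection t -> h (- t) it controls those to the left, so the
  exceptional set is the first null set together with the reflection of the second. Extending g by 0
  lets these intervals leave [0, T].\<close>

lemma lebesgue_differentiation:
  fixes g :: "real \<Rightarrow> real"
  assumes g: "integrable (lebesgue_on {0..T}) g"
  shows "AE t in lebesgue_on {0..T}.
    ((\<lambda>s. integral {0..s} g) has_real_derivative g t) (at t within {0..T})"
proof -
  define h where "h t = (if t \<in> {0..T} then g t else 0)" for t
  have "integrable lebesgue h"
    unfolding h_def[abs_def] using g by (subst Lebesgue_Measure.integrable_restrict_UNIV) auto
  then have "h integrable_on UNIV"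
    using integrable_on_lebesgue by blast
  then have h_int: "h integrable_on {a..b}" for a b
    by (rule integrable_on_subinterval) auto
  then have "h integrable_on cbox a b" for a b by simp
  then obtain N where N: "negligible N" "\<And>x e. \<lbrakk>x \<notin> N; 0 < e\<rbrakk> \<Longrightarrow>
      \<exists>d>0. \<forall>r. 0 < r \<and> r < d \<longrightarrow>
        norm (integral (cbox x (x + r *\<^sub>R One)) h /\<^sub>R r ^ DIM(real) - h x) < e"
    using integrable_ccontinuous_explicit[of h] by blast
  have "(\<lambda>x. h (- x)) integrable_on {-b.. -a}" for a b
    using h_int by simp
  then have "(\<lambda>x. h (- x)) integrable_on cbox a b" for a b
    by (metis box_real(2) minus_minus)
  then obtain N' where N': "negligible N'" "\<And>x e. \<lbrakk>x \<notin> N'; 0 < e\<rbrakk> \<Longrightarrow>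
      \<exists>d>0. \<forall>r. 0 < r \<and> r < d \<longrightarrow>
        norm (integral (cbox x (x + r *\<^sub>R One)) (\<lambda>x. h (- x)) /\<^sub>R r ^ DIM(real) - h (- x)) < e"
    using integrable_ccontinuous_explicit[of "\<lambda>x. h (- x)"] by blast
  have "negligible (N \<union> uminus ` N')"
    using N N' by (auto intro!: negligible_differentiable_image_negligible derivative_intros)
  then have "AE t in lebesgue. t \<notin> N \<union> uminus ` N'"
    using AE_not_in negligible_iff_null_sets by blast
  then have "AE t in lebesgue_on {0..T}. t \<notin> N \<union> uminus ` N'"
    by (subst AE_restrict_space_iff) auto
  moreover have "AE t in lebesgue_on {0..T}. t \<in> {0..T}"
    by (rule AE_I2) simp
  moreover have *: "((\<lambda>s. integral {0..s} g) has_real_derivative g t) (at t within {0..T})"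
    if t: "t \<in> {0..T}" "t \<notin> N \<union> uminus ` N'" for t
    unfolding has_field_derivative_iff
  proof (rule tendstoI)
    fix e :: real assume "0 < e"
    have "t \<notin> N" using t by auto
    from N(2)[OF this \<open>0 < e\<close>] obtain d1 where d1: "0 < d1"
      "\<And>r. 0 < r \<Longrightarrow> r < d1 \<Longrightarrow> \<bar>integral {t..t + r} h / r - h t\<bar> < e"
      by (auto simp: divide_inverse mult.commute)
    have "- t \<notin> N'"
    proof
      assume "- t \<in> N'"
      then have "- (- t) \<in> uminus ` N'" by blast
      then show False using t by simp
    qed
    from N'(2)[OF this \<open>0 < e\<close>] obtain d2 where d2: "0 < d2"
      "\<And>r. 0 < r \<Longrightarrow> r < d2 \<Longrightarrow> \<bar>integral {- t..- t + r} (\<lambda>x. h (- x)) / r - h t\<bar> < e"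
      by (auto simp: divide_inverse mult.commute)
    have "integral {- t..- t + r} (\<lambda>x. h (- x)) = integral {t - r..t} h" for r
      using Henstock_Kurzweil_Integration.integral_reflect_real[of t "t - r" h] by simp
    note d2 = d2(1) d2(2)[unfolded this]
    have diff: "integral {0..y} g - integral {0..x} g = integral {x..y} h"
      if "0 \<le> x" "x \<le> y" "y \<le> T" for x y
    proof -
      have "integral {0..z} g = integral {0..z} h" if "z \<le> T" for z
        using that by (intro integral_cong) (auto simp: h_def)
      moreover have "integral {0..x} h + integral {x..y} h = integral {0..y} h"
        using that h_int by (intro Henstock_Kurzweil_Integration.integral_combine) auto
      ultimately show ?thesis using that by simp
    qed
    have "dist ((integral {0..y} g - integral {0..t} g) / (y - t)) (g t) < e"
      if y: "y \<in> {0..T}" "y \<noteq> t" "dist y t < min d1 d2" for y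
    proof (cases "t < y")
      case True
      then show ?thesis
        using d1(2)[of "y - t"] y t diff[of t y] by (auto simp: dist_real_def h_def)
    next
      case False
      then have "(integral {0..y} g - integral {0..t} g) / (y - t) = integral {t - (t - y)..t} h / (t - y)"
        using y t diff[of y t] by (simp add: field_simps)
      then show ?thesis
        using d2(2)[of "t - y"] y t False by (auto simp: dist_real_def h_def)
    qed
    then show "\<forall>\<^sub>F y in at t within {0..T}.
        dist ((integral {0..y} g - integral {0..t} g) / (y - t)) (g t) < e"
      using d1(1) d2(1) unfolding eventually_at by (intro exI[of _ "min d1 d2"]) auto
  qed
  ultimately show ?thesis by (auto elim!: eventually_elim2 intro: *)
qed

section \<open>Absolute continuity of indefinite integrals\<close>

text \<open>Truncating |f| at a suitable height n leaves an excess of integral below e / 2, and the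
  truncated part contributes at most n times the measure of A.\<close>

lemma integral_small_measure:
  fixes f :: "'a \<Rightarrow> real"
  assumes f: "integrable M f" and "0 < e"
  shows "\<exists>d>0. \<forall>A\<in>sets M. emeasure M A < ennreal d \<longrightarrow> (\<integral>x. indicator A x * \<bar>f x\<bar> \<partial>M) < e"
proof -
  have [measurable]: "f \<in> borel_measurable M" using f by auto
  have "(\<lambda>n. \<integral>x. \<bar>f x\<bar> - min \<bar>f x\<bar> (real n) \<partial>M) \<longlonglongrightarrow> (\<integral>x. 0 \<partial>M)"
  proof (rule integral_dominated_convergence[where w = "\<lambda>x. \<bar>f x\<bar>"])
    show "AE x in M. (\<lambda>n. \<bar>f x\<bar> - min \<bar>f x\<bar> (real n)) \<longlonglongrightarrow> 0"
    proof (rule AE_I2)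
      fix x
      have "eventually (\<lambda>n. \<bar>f x\<bar> \<le> real n) sequentially"
        using filterlim_real_sequentially by (auto simp: filterlim_at_top)
      then have "eventually (\<lambda>n. 0 = \<bar>f x\<bar> - min \<bar>f x\<bar> (real n)) sequentially"
        by eventually_elim simp
      then show "(\<lambda>n. \<bar>f x\<bar> - min \<bar>f x\<bar> (real n)) \<longlonglongrightarrow> 0"
        by (rule Lim_transform_eventually[OF tendsto_const])
    qed
  qed (use f in auto)
  then have "\<forall>\<^sub>F n in sequentially. (\<integral>x. \<bar>f x\<bar> - min \<bar>f x\<bar> (real n) \<partial>M) < e / 2"
    using \<open>0 < e\<close> by (intro order_tendstoD(2)) auto
  then obtain n where n: "(\<integral>x. \<bar>f x\<bar> - min \<bar>f x\<bar> (real n) \<partial>M) < e / 2"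
    using eventually_happens'[OF sequentially_bot] by blast
  have int: "integrable M (\<lambda>x. \<bar>f x\<bar> - min \<bar>f x\<bar> (real n))"
    by (rule Bochner_Integration.integrable_bound[of M f]) (use f in auto)
  \<comment> \<open>The \<open>+ 1\<close> in the threshold keeps it well defined for n = 0.\<close>
  have "(\<integral>x. indicator A x * \<bar>f x\<bar> \<partial>M) < e"
    if A: "A \<in> sets M" "emeasure M A < ennreal (e / 2 / (real n + 1))" for A
  proof -
    have fin: "emeasure M A < \<infinity>" using A(2) by (rule less_trans) simp
    have m: "measure M A < e / 2 / (real n + 1)"
      using A(2) fin \<open>0 < e\<close> by (simp add: emeasure_eq_ennreal_measure less_top ennreal_less_iff)
    have "integrable M (indicator A :: _ \<Rightarrow> real)"
      using A fin by simp
    then have "(\<integral>x. indicator A x * \<bar>f x\<bar> \<partial>M) \<le> (\<integral>x. (\<bar>f x\<bar> - min \<bar>f x\<bar> (real n)) + real n * indicator A x \<partial>M)"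
      using int integrable_mult_indicator[OF A(1) integrable_abs[OF f]]
      by (intro integral_mono Bochner_Integration.integrable_add integrable_mult_right)
        (auto split: split_indicator)
    also have "\<dots> = (\<integral>x. \<bar>f x\<bar> - min \<bar>f x\<bar> (real n) \<partial>M) + real n * measure M A"
      using int A fin by (subst Bochner_Integration.integral_add) auto
    also have "\<dots> < e / 2 + e / 2"
    proof -
      have "real n * measure M A \<le> (real n + 1) * (e / 2 / (real n + 1))"
        using m by (intro mult_mono) auto
      also have "\<dots> = e / 2"
        using nonzero_mult_div_cancel_left[of "real n + 1" "e / 2"] by (simp add: add_nonneg_eq_0_iff)
      finally show ?thesis using n by simp
    qed
    finally show ?thesis by simp
  qed
  then show ?thesis using \<open>0 < e\<close>
    by (intro exI[of _ "e / 2 / (real n + 1)"]) auto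
qed

text \<open>The admissible interval families of the epsilon-delta definition, bundled so that the
  condition can be passed along without unfolding its quantifiers.\<close>

definition disjoint_intervals :: "real \<Rightarrow> nat \<Rightarrow> (nat \<Rightarrow> real) \<Rightarrow> (nat \<Rightarrow> real) \<Rightarrow> bool" where
  "disjoint_intervals T n a b \<longleftrightarrow> (\<forall>i<n. 0 \<le> a i \<and> a i \<le> b i \<and> b i \<le> T) \<and>
    disjoint_family_on (\<lambda>i. {a i<..<b i}) {..<n}"

lemma absolutely_continuous_fun_iff:
  "absolutely_continuous_fun T F \<longleftrightarrow> (\<forall>e>0. \<exists>d>0. \<forall>n a b.
    disjoint_intervals T n a b \<and> (\<Sum>i<n. b i - a i) < d \<longrightarrow> (\<Sum>i<n. \<bar>F (b i) - F (a i)\<bar>) < e)"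
  by (simp add: absolutely_continuous_fun_def disjoint_intervals_def conj_assoc)

lemma absolutely_continuous_indefinite_integral:
  fixes g :: "real \<Rightarrow> real"
  assumes g: "integrable (lebesgue_on {0..T}) g"
  shows "absolutely_continuous_fun T (\<lambda>t. c + integral {0..t} g)"
  unfolding absolutely_continuous_fun_iff
proof (intro allI impI)
  fix e :: real assume "0 < e"
  define h where "h t = (if t \<in> {0..T} then g t else 0)" for t
  have h: "integrable lebesgue h"
    unfolding h_def[abs_def] using g by (subst Lebesgue_Measure.integrable_restrict_UNIV) auto
  have h': "integrable (lebesgue_on {a..b}) h" for a b
    using integrable_mult_indicator[OF _ h, of "{a..b}"] by (simp add: integrable_restrict_space)
  obtain d where d: "0 < d" "\<And>A. A \<in> sets lebesgue \<Longrightarrow> emeasure lebesgue A < ennreal d \<Longrightarrow>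
      (\<integral>x. indicator A x * \<bar>h x\<bar> \<partial>lebesgue) < e"
    using integral_small_measure[OF h \<open>0 < e\<close>] by blast
  show "\<exists>d>0. \<forall>(n::nat) a b. disjoint_intervals T n a b \<and> (\<Sum>i<n. b i - a i) < d \<longrightarrow>
        (\<Sum>i<n. \<bar>c + integral {0..b i} g - (c + integral {0..a i} g)\<bar>) < e"
  proof (intro exI[of _ d] conjI allI impI)
    fix n :: nat and a b :: "nat \<Rightarrow> real"
    assume "disjoint_intervals T n a b \<and> (\<Sum>i<n. b i - a i) < d"
    note * = this[unfolded disjoint_intervals_def]
    define A where "A = (\<Union>i<n. {a i<..<b i})"
    have A: "A \<in> sets lebesgue" by (auto simp: A_def)
    have "emeasure lebesgue A = (\<Sum>i<n. emeasure lebesgue {a i<..<b i})"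
      unfolding A_def using * by (intro sum_emeasure[symmetric]) auto
    also have "\<dots> = (\<Sum>i<n. ennreal (b i - a i))"
      using * by (intro sum.cong) auto
    also have "\<dots> = ennreal (\<Sum>i<n. b i - a i)"
      using * by (intro sum_ennreal) auto
    finally have "emeasure lebesgue A < ennreal d"
      using * d(1) by (simp add: ennreal_lessI)
    have "\<bar>c + integral {0..b i} g - (c + integral {0..a i} g)\<bar> \<le>
        (\<integral>x. indicator {a i<..<b i} x * \<bar>h x\<bar> \<partial>lebesgue)" if "i < n" for i
    proof -
      have ab: "0 \<le> a i" "a i \<le> b i" "b i \<le> T" using * that by auto
      have hi: "h integrable_on {x..y}" for x y
        using integrable_on_lebesgue_on[OF h'] by auto
      have "integral {0..z} g = integral {0..z} h" if "z \<le> T" for z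
        using that by (intro integral_cong) (auto simp: h_def)
      moreover have "integral {0..a i} h + integral {a i..b i} h = integral {0..b i} h"
        using ab hi by (intro Henstock_Kurzweil_Integration.integral_combine) auto
      ultimately have "c + integral {0..b i} g - (c + integral {0..a i} g) = integral {a i..b i} h"
        using ab by simp
      \<comment> \<open>Disjointness is assumed of the open intervals; the closed ones may share end
        points.\<close>
      also have "\<dots> = integral {a i<..<b i} h"
        by (simp add: integral_open_interval_real)
      also have "\<dots> = integral\<^sup>L (lebesgue_on {a i<..<b i}) h"
        using integrable_mult_indicator[OF _ h, of "{a i<..<b i}"]
        by (intro lebesgue_integral_eq_integral[symmetric]) (auto simp: integrable_restrict_space)
      also have "\<dots> = (\<integral>x. indicator {a i<..<b i} x *\<^sub>R h x \<partial>lebesgue)"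
        by (subst integral_restrict_space) auto
      also have "\<bar>\<dots>\<bar> \<le> (\<integral>x. \<bar>indicator {a i<..<b i} x *\<^sub>R h x\<bar> \<partial>lebesgue)"
        by (rule integral_abs_bound)
      also have "\<dots> = (\<integral>x. indicator {a i<..<b i} x * \<bar>h x\<bar> \<partial>lebesgue)"
        by (simp add: abs_mult)
      finally show ?thesis .
    qed
    then have "(\<Sum>i<n. \<bar>c + integral {0..b i} g - (c + integral {0..a i} g)\<bar>) \<le>
        (\<Sum>i<n. \<integral>x. indicator {a i<..<b i} x * \<bar>h x\<bar> \<partial>lebesgue)"
      by (intro sum_mono) auto
    also have "\<dots> = (\<integral>x. (\<Sum>i<n. indicator {a i<..<b i} x * \<bar>h x\<bar>) \<partial>lebesgue)"
      using integrable_mult_indicator[OF _ integrable_abs[OF h]]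
      by (intro Bochner_Integration.integral_sum[symmetric]) auto
    also have "\<dots> = (\<integral>x. indicator A x * \<bar>h x\<bar> \<partial>lebesgue)"
      using * unfolding A_def
      by (intro Bochner_Integration.integral_cong refl)
         (auto simp: indicator_UN_disjoint sum_distrib_right)
    also have "\<dots> < e"
      by (rule d) fact+
    finally show "(\<Sum>i<n. \<bar>c + integral {0..b i} g - (c + integral {0..a i} g)\<bar>) < e" .
  qed (rule d(1))
qed

section \<open>Lebesgue's fundamental theorem of calculus\<close>

text \<open>The straddle lemma: as u <= x <= v, the errors of the linear approximation at u and at v
  are at most e (x - u) and e (v - x), and these add up to e (v - u).\<close>

lemma has_derivative_straddle:
  fixes F :: "real \<Rightarrow> real"
  assumes "(F has_real_derivative m) (at x within S)" "0 < e"
  shows "\<exists>d>0. \<forall>u v. u \<in> S \<and> v \<in> S \<and> u \<le> x \<and> x \<le> v \<and> {u..v} \<subseteq> ball x d \<longrightarrow>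
    \<bar>m * (v - u) - (F v - F u)\<bar> \<le> e * (v - u)"
proof -
  have "(F has_derivative (*) m) (at x within S)"
    using assms(1) by (simp add: has_field_derivative_def)
  then obtain d where d: "0 < d" "\<And>y. y \<in> S \<Longrightarrow> \<bar>y - x\<bar> < d \<Longrightarrow> \<bar>F y - F x - m * (y - x)\<bar> \<le> e * \<bar>y - x\<bar>"
    using assms(2) unfolding has_derivative_within_alt by force
  have "\<bar>m * (v - u) - (F v - F u)\<bar> \<le> e * (v - u)"
    if "u \<in> S" "v \<in> S" "u \<le> x" "x \<le> v" "{u..v} \<subseteq> ball x d" for u v
  proof -
    have "u \<in> ball x d" "v \<in> ball x d"
      using that by (auto simp: subset_iff)
    then have "\<bar>F u - F x - m * (u - x)\<bar> \<le> e * (x - u)" "\<bar>F v - F x - m * (v - x)\<bar> \<le> e * (v - x)"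
      using d(2)[of u] d(2)[of v] that by (auto simp: dist_real_def)
    then show ?thesis by (auto simp: algebra_simps abs_le_iff)
  qed
  then show ?thesis using d(1) by blast
qed

lemma absolutely_continuous_funE:
  assumes "absolutely_continuous_fun T F" "0 < e"
  obtains d where "0 < d" "\<And>(n::nat) a b.
        disjoint_intervals T n a b \<Longrightarrow> (\<Sum>i<n. b i - a i) < d \<Longrightarrow> (\<Sum>i<n. \<bar>F (b i) - F (a i)\<bar>) < e"
proof -
  obtain d where "0 < d" and d: "\<forall>(n::nat) a b.
        disjoint_intervals T n a b \<and> (\<Sum>i<n. b i - a i) < d \<longrightarrow>
        (\<Sum>i<n. \<bar>F (b i) - F (a i)\<bar>) < e"
    using assms(1)[unfolded absolutely_continuous_fun_iff, rule_format, OF assms(2)] by (elim exE conjE)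
  show thesis
    by (rule that[OF \<open>0 < d\<close>], rule d[rule_format]) auto
qed

text \<open>The gauge integral delivers the integrability of f together with the value. The
  increments of F over a tagged division telescope, so it is enough that the deviations of f x times
  the length of k from the increment of F over k have a small sum.\<close>

theorem fundamental_theorem_absolutely_continuous:
  fixes F f :: "real \<Rightarrow> real"
  assumes AC: "absolutely_continuous_fun T F" and "0 < T"
    and deriv: "AE t in lebesgue_on {0..T}. (F has_real_derivative f t) (at t within {0..T})"
  shows "(f has_integral F T - F 0) {0..T}"
proof -
  obtain N where N: "N \<in> null_sets (lebesgue_on {0..T})"
    "{t \<in> space (lebesgue_on {0..T}). \<not> (F has_real_derivative f t) (at t within {0..T})} \<subseteq> N"
    using deriv unfolding eventually_ae_filter by auto
  have N0: "N \<in> null_sets lebesgue"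
    using N(1) by (subst (asm) null_sets_restrict_space) auto
  have d: "(F has_real_derivative f t) (at t within {0..T})" if "t \<in> {0..T}" "t \<notin> N" for t
    using that N(2) by auto
  \<comment> \<open>On the null set \<open>N\<close> the values of f carry no information. With 0
    there, a piece tagged in \<open>N\<close> contributes just its increment of F; a spike argument
    restores f at the end.\<close>
  define f0 where "f0 t = (if t \<in> N then 0 else f t)" for t
  have "(f0 has_integral F T - F 0) (cbox 0 T)"
    unfolding has_integral
  proof (intro allI impI)
    fix e :: real assume "0 < e"
    \<comment> \<open>Tags outside \<open>N\<close> cost at most r * T, tags in \<open>N\<close>
      less than r, and r * T + r is strictly below r * (T + 2) = e.\<close>
    define r where "r = e / (T + 2)"
    have "r * (T + 2) = e"
      using \<open>0 < T\<close> by (simp add: r_def)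
    moreover have "0 < r"
      using \<open>0 < e\<close> \<open>0 < T\<close> by (simp add: r_def)
    ultimately have r: "0 < r" "r * T + r < e"
      by (auto simp: algebra_simps)
    obtain \<delta> where \<delta>: "0 < \<delta>" "\<And>(n::nat) a b.
        disjoint_intervals T n a b \<Longrightarrow> (\<Sum>i<n. b i - a i) < \<delta> \<Longrightarrow> (\<Sum>i<n. \<bar>F (b i) - F (a i)\<bar>) < r"
      using absolutely_continuous_funE[OF AC r(1)] by blast
    obtain U where U: "open U" "N \<subseteq> U" "U - N \<in> lmeasurable" "emeasure lebesgue (U - N) < ennreal \<delta>"
      using sets_lebesgue_outer_open[of N \<delta>] N0 \<delta>(1) by auto
    have mU: "emeasure lebesgue U < ennreal \<delta>"
    proof -
      have "emeasure lebesgue U = emeasure lebesgue (U - N)"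
        using N0 U(1) by (intro emeasure_Diff_null_set[symmetric]) auto
      then show ?thesis using U(4) by simp
    qed
    have "\<exists>\<rho>>0. t \<in> {0..T} - N \<longrightarrow> (\<forall>u v. u \<in> {0..T} \<and> v \<in> {0..T} \<and> u \<le> t \<and> t \<le> v \<and> {u..v} \<subseteq> ball t \<rho> \<longrightarrow>
      \<bar>f t * (v - u) - (F v - F u)\<bar> \<le> r * (v - u))" for t
      using has_derivative_straddle[OF d r(1), of t] by (cases "t \<in> {0..T} - N") (auto intro: zero_less_one)
    then obtain \<rho> where \<rho>: "\<And>t. 0 < \<rho> t" "\<And>t u v. t \<in> {0..T} - N \<Longrightarrow> u \<in> {0..T} \<Longrightarrow> v \<in> {0..T} \<Longrightarrow>
        u \<le> t \<Longrightarrow> t \<le> v \<Longrightarrow> {u..v} \<subseteq> ball t (\<rho> t) \<Longrightarrow> \<bar>f t * (v - u) - (F v - F u)\<bar> \<le> r * (v - u)"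
      by metis
    \<comment> \<open>A gauge that is straddling at points of differentiability and confined to a thin open set at the others:
      the first kind of interval is controlled by the derivative, the second by absolute continuity.\<close>
    define \<gamma> where "\<gamma> t = (if t \<in> N then U else ball t (\<rho> t))" for t
    have "gauge \<gamma>"
      using U \<rho>(1) by (auto simp: gauge_def \<gamma>_def)
    moreover have *: "norm ((\<Sum>(x, k)\<in>D. measure lborel k *\<^sub>R f0 x) - (F T - F 0)) < e"
      if D: "D tagged_division_of cbox 0 T" and fine: "\<gamma> fine D" for D
    proof -
      have D': "D tagged_division_of {0..T}" using D by simp
      have fin: "finite D" using D by (rule tagged_division_of_finite)
      have k: "Inf k \<le> Sup k \<and> k = {Inf k..Sup k} \<and> x \<in> k \<and> 0 \<le> Inf k \<and> Sup k \<le> T \<and> measure lborel k = Sup k - Inf k"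
        if xk: "(x, k) \<in> D" for x k
      proof -
        obtain a b where "k = cbox a b"
          using tagged_division_ofD(4)[OF D xk] by blast
        then have ab: "k = {a..b}" by simp
        moreover have "x \<in> k" "k \<subseteq> {0..T}"
          using tagged_division_ofD(2,3)[OF D xk] by auto
        ultimately show ?thesis by auto
      qed
      define D1 where "D1 = {p \<in> D. fst p \<notin> N}"
      define D2 where "D2 = {p \<in> D. fst p \<in> N}"
      have D12: "D = D1 \<union> D2" "D1 \<inter> D2 = {}" "finite D1" "finite D2"
        using fin by (auto simp: D1_def D2_def)
      \<comment> \<open>The increment of F over [0, T] is distributed over the pieces by
        telescoping.\<close>
      have "(\<Sum>(x, k)\<in>D. measure lborel k *\<^sub>R f0 x) - (F T - F 0) =
          (\<Sum>(x, k)\<in>D. measure lborel k * f0 x - (F (Sup k) - F (Inf k)))"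
        using additive_tagged_division_1[OF _ D', of F] \<open>0 < T\<close>
        by (simp add: sum_subtractf split_def)
      also have "\<bar>\<dots>\<bar> \<le> (\<Sum>(x, k)\<in>D. \<bar>measure lborel k * f0 x - (F (Sup k) - F (Inf k))\<bar>)"
        by (rule order_trans[OF sum_abs]) (simp add: split_def)
      also have "\<dots> = (\<Sum>(x, k)\<in>D1. \<bar>measure lborel k * f0 x - (F (Sup k) - F (Inf k))\<bar>) +
          (\<Sum>(x, k)\<in>D2. \<bar>measure lborel k * f0 x - (F (Sup k) - F (Inf k))\<bar>)"
        using D12 by (simp add: sum.union_disjoint)
      also have "(\<Sum>(x, k)\<in>D1. \<bar>measure lborel k * f0 x - (F (Sup k) - F (Inf k))\<bar>) \<le> (\<Sum>(x, k)\<in>D. r * (Sup k - Inf k))"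
      proof -
        have "(\<Sum>(x, k)\<in>D1. \<bar>measure lborel k * f0 x - (F (Sup k) - F (Inf k))\<bar>) \<le> (\<Sum>(x, k)\<in>D1. r * (Sup k - Inf k))"
        proof (rule sum_mono, clarify)
          fix x k assume "(x, k) \<in> D1"
          then have xk: "(x, k) \<in> D" "x \<notin> N" by (auto simp: D1_def)
          note kk = k[OF xk(1)]
          have "k \<subseteq> ball x (\<rho> x)"
            using fineD[OF fine xk(1)] xk(2) by (simp add: \<gamma>_def)
          then have "{Inf k..Sup k} \<subseteq> ball x (\<rho> x)" using kk by metis
          moreover have "Inf k \<le> x" "x \<le> Sup k" using kk by (metis atLeastAtMost_iff)+
          ultimately have "\<bar>f x * (Sup k - Inf k) - (F (Sup k) - F (Inf k))\<bar> \<le> r * (Sup k - Inf k)"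
            using kk xk(2) by (intro \<rho>(2)) auto
          then show "\<bar>measure lborel k * f0 x - (F (Sup k) - F (Inf k))\<bar> \<le> r * (Sup k - Inf k)"
            using kk xk(2) by (simp add: f0_def mult.commute)
        qed
        also have "\<dots> \<le> (\<Sum>(x, k)\<in>D. r * (Sup k - Inf k))"
          using fin k r(1) by (intro sum_mono2) (auto simp: D1_def)
        finally show ?thesis .
      qed
      also have "(\<Sum>(x, k)\<in>D. r * (Sup k - Inf k)) = r * T"
        using additive_tagged_division_1[OF _ D', of "\<lambda>x. x"] \<open>0 < T\<close>
        by (simp add: sum_distrib_left[symmetric] split_def)
      also have "(\<Sum>(x, k)\<in>D2. \<bar>measure lborel k * f0 x - (F (Sup k) - F (Inf k))\<bar>) < r"
      proof -
        \<comment> \<open>Absolute continuity speaks of families indexed by an initial segment of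
          the naturals, so the pieces tagged in \<open>N\<close> are enumerated.\<close>
        obtain \<eta> where \<eta>: "bij_betw \<eta> {..<card D2} D2"
          using ex_bij_betw_nat_finite[OF D12(4)] by (auto simp: atLeast0LessThan)
        define a b where "a i = Inf (snd (\<eta> i))" and "b i = Sup (snd (\<eta> i))" for i
        have \<eta>D: "\<eta> i \<in> D" "fst (\<eta> i) \<in> N" if "i < card D2" for i
          using bij_betwE[OF \<eta>] that by (auto simp: D2_def)
        have ab: "0 \<le> a i \<and> a i \<le> b i \<and> b i \<le> T" "snd (\<eta> i) = {a i..b i}" if "i < card D2" for i
          using k[of "fst (\<eta> i)" "snd (\<eta> i)"] \<eta>D[OF that] by (auto simp: a_def b_def)
        have dis: "disjoint_family_on (\<lambda>i. {a i<..<b i}) {..<card D2}"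
          unfolding disjoint_family_on_def
        proof (intro ballI impI)
          fix i j assume ij: "i \<in> {..<card D2}" "j \<in> {..<card D2}" "i \<noteq> j"
          then have "\<eta> i \<noteq> \<eta> j"
            using \<eta> by (auto simp: bij_betw_def inj_on_def)
          then have "interior (snd (\<eta> i)) \<inter> interior (snd (\<eta> j)) = {}"
            using ij \<eta>D tagged_division_ofD(5)[OF D, of "fst (\<eta> i)" "snd (\<eta> i)" "fst (\<eta> j)" "snd (\<eta> j)"] by auto
          then show "{a i<..<b i} \<inter> {a j<..<b j} = {}"
            using ij ab by auto
        qed
        have "ennreal (\<Sum>i<card D2. b i - a i) = (\<Sum>i<card D2. ennreal (b i - a i))"
          using ab by (intro sum_ennreal[symmetric]) auto
        also have "\<dots> = (\<Sum>i<card D2. emeasure lebesgue {a i<..<b i})"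
          using ab by (intro sum.cong) auto
        also have "\<dots> = emeasure lebesgue (\<Union>i<card D2. {a i<..<b i})"
          using dis by (intro sum_emeasure) auto
        also have "\<dots> \<le> emeasure lebesgue U"
        proof (rule emeasure_mono)
          have "{a i<..<b i} \<subseteq> U" if "i < card D2" for i
          proof -
            have "snd (\<eta> i) \<subseteq> \<gamma> (fst (\<eta> i))"
              using fineD[OF fine, of "fst (\<eta> i)" "snd (\<eta> i)"] \<eta>D[OF that] by simp
            then show ?thesis
              using ab(2)[OF that] \<eta>D(2)[OF that] by (auto simp: \<gamma>_def)
          qed
          then show "(\<Union>i<card D2. {a i<..<b i}) \<subseteq> U" by blast
        qed (use U in auto)
        also note mU
        finally have "(\<Sum>i<card D2. b i - a i) < \<delta>"
          using ab by (subst (asm) ennreal_less_iff) (auto intro!: sum_nonneg)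
        then have "(\<Sum>i<card D2. \<bar>F (b i) - F (a i)\<bar>) < r"
          using ab dis by (intro \<delta>(2)) (auto simp: disjoint_intervals_def)
        also have "(\<Sum>i<card D2. \<bar>F (b i) - F (a i)\<bar>) = (\<Sum>p\<in>D2. \<bar>F (Sup (snd p)) - F (Inf (snd p))\<bar>)"
          unfolding a_def b_def using \<eta> by (rule sum.reindex_bij_betw)
        also have "\<dots> = (\<Sum>(x, k)\<in>D2. \<bar>measure lborel k * f0 x - (F (Sup k) - F (Inf k))\<bar>)"
          by (intro sum.cong) (auto simp: D2_def f0_def)
        finally show ?thesis .
      qed
      finally show ?thesis using r(2) by simp
    qed
    ultimately show "\<exists>\<gamma>. gauge \<gamma> \<and> (\<forall>D. D tagged_division_of cbox 0 T \<and> \<gamma> fine D \<longrightarrow>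
        norm ((\<Sum>(x, k)\<in>D. measure lborel k *\<^sub>R f0 x) - (F T - F 0)) < e)"
      by (intro exI[of _ \<gamma>] conjI allI impI *) auto
  qed
  then have "(f0 has_integral F T - F 0) {0..T}" by simp
  moreover have "negligible N"
    using N0 by (simp add: negligible_iff_null_sets)
  ultimately show ?thesis
    by (intro has_integral_spike[of N "{0..T}" f f0]) (auto simp: f0_def)
qed

lemma absolutely_continuous_fun_cong:
  assumes F: "absolutely_continuous_fun T F" and eq: "\<And>t. t \<in> {0..T} \<Longrightarrow> G t = F t"
  shows "absolutely_continuous_fun T G"
proof -
  have *: "(\<Sum>i<n. \<bar>F (b i) - F (a i)\<bar>) = (\<Sum>i<n. \<bar>G (b i) - G (a i)\<bar>)"
    if "\<forall>i<n. 0 \<le> a i \<and> a i \<le> b i \<and> b i \<le> T" for n :: nat and a b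
  proof (rule sum.cong[OF refl])
    fix i assume "i \<in> {..<n}"
    then have "a i \<in> {0..T}" "b i \<in> {0..T}" using that by force+
    then show "\<bar>F (b i) - F (a i)\<bar> = \<bar>G (b i) - G (a i)\<bar>" using eq by simp
  qed
  have "absolutely_continuous_fun T F = absolutely_continuous_fun T G"
    unfolding absolutely_continuous_fun_iff
    by (intro all_cong1 ex_cong1 conj_cong imp_cong refl, elim conjE, subst *) (auto simp: disjoint_intervals_def)
  then show ?thesis using F by simp
qed

lemma absolutely_continuous_imp_continuous:
  assumes "absolutely_continuous_fun T F"
  shows "continuous_on {0..T} F"
  unfolding continuous_on_iff
proof (intro ballI allI impI)
  fix x e :: real assume x: "x \<in> {0..T}" and "0 < e"
  from absolutely_continuous_funE[OF assms \<open>0 < e\<close>] obtain d where d: "0 < d" "\<And>(n::nat) a b.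
        disjoint_intervals T n a b \<Longrightarrow> (\<Sum>i<n. b i - a i) < d \<Longrightarrow> (\<Sum>i<n. \<bar>F (b i) - F (a i)\<bar>) < e"
    by blast
  have "dist (F y) (F x) < e" if "y \<in> {0..T}" "dist y x < d" for y
    using d(2)[of "Suc 0" "\<lambda>_. x" "\<lambda>_. y"] d(2)[of "Suc 0" "\<lambda>_. y" "\<lambda>_. x"] that x
    by (cases "x \<le> y") (auto simp: disjoint_intervals_def disjoint_family_on_def dist_real_def abs_minus_commute)
  then show "\<exists>d>0. \<forall>y\<in>{0..T}. dist y x < d \<longrightarrow> dist (F y) (F x) < e"
    using d(1) by blast
qed

lemma lipschitz_imp_absolutely_continuous:
  assumes "\<And>x y. \<bar>F x - F y\<bar> \<le> B * \<bar>x - y\<bar>"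
  shows "absolutely_continuous_fun T F"
  unfolding absolutely_continuous_fun_iff
proof (intro allI impI)
  fix e :: real assume "0 < e"
  have "0 \<le> B" using assms[of 1 0] by (auto intro: order_trans[OF abs_ge_zero])
  show "\<exists>d>0. \<forall>(n::nat) a b. disjoint_intervals T n a b \<and> (\<Sum>i<n. b i - a i) < d \<longrightarrow>
        (\<Sum>i<n. \<bar>F (b i) - F (a i)\<bar>) < e"
  proof (intro exI conjI allI impI)
    show "0 < e / (B + 1)" using \<open>0 < e\<close> \<open>0 \<le> B\<close> by simp
    fix n :: nat and a b :: "nat \<Rightarrow> real"
    assume "disjoint_intervals T n a b \<and> (\<Sum>i<n. b i - a i) < e / (B + 1)"
    note * = this[unfolded disjoint_intervals_def]
    have "(\<Sum>i<n. \<bar>F (b i) - F (a i)\<bar>) \<le> (\<Sum>i<n. B * (b i - a i))"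
      using * assms by (intro sum_mono) (smt (verit) lessThan_iff)
    also have "\<dots> = B * (\<Sum>i<n. b i - a i)" by (simp add: sum_distrib_left)
    also have "\<dots> \<le> (B + 1) * (\<Sum>i<n. b i - a i)"
      using * by (intro mult_right_mono sum_nonneg) auto
    also have "\<dots> < e"
      using * \<open>0 \<le> B\<close> by (simp add: field_simps)
    finally show "(\<Sum>i<n. \<bar>F (b i) - F (a i)\<bar>) < e" .
  qed
qed

lemma absolutely_continuous_mult:
  assumes F: "absolutely_continuous_fun T F" and G: "absolutely_continuous_fun T G"
  shows "absolutely_continuous_fun T (\<lambda>t. F t * G t)"
  unfolding absolutely_continuous_fun_iff
proof (intro allI impI)
  fix e :: real assume "0 < e"
  have "bounded (F ` {0..T})" "bounded (G ` {0..T})"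
    using absolutely_continuous_imp_continuous[OF F] absolutely_continuous_imp_continuous[OF G]
    by (auto intro!: compact_imp_bounded compact_continuous_image)
  then obtain A B where AB: "\<And>t. t \<in> {0..T} \<Longrightarrow> \<bar>F t\<bar> \<le> A" "\<And>t. t \<in> {0..T} \<Longrightarrow> \<bar>G t\<bar> \<le> B"
    unfolding bounded_iff by (metis imageI real_norm_def)
  \<comment> \<open>A common bound for both functions on [0, T]; the 1 makes it a positive
    divisor.\<close>
  define C where "C = max 1 (max A B)"
  have C: "1 \<le> C" "\<And>t. t \<in> {0..T} \<Longrightarrow> \<bar>F t\<bar> \<le> C" "\<And>t. t \<in> {0..T} \<Longrightarrow> \<bar>G t\<bar> \<le> C"
    using AB by (auto simp: C_def le_max_iff_disj)
  then have "0 < e / (2 * C)" using \<open>0 < e\<close> by simp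
  note e = this
  from absolutely_continuous_funE[OF F e] obtain d1 where d1: "0 < d1" "\<And>(n::nat) a b.
        disjoint_intervals T n a b \<Longrightarrow> (\<Sum>i<n. b i - a i) < d1 \<Longrightarrow> (\<Sum>i<n. \<bar>F (b i) - F (a i)\<bar>) < e / (2 * C)"
    by blast
  from absolutely_continuous_funE[OF G e] obtain d2 where d2: "0 < d2" "\<And>(n::nat) a b.
        disjoint_intervals T n a b \<Longrightarrow> (\<Sum>i<n. b i - a i) < d2 \<Longrightarrow> (\<Sum>i<n. \<bar>G (b i) - G (a i)\<bar>) < e / (2 * C)"
    by blast
  show "\<exists>d>0. \<forall>(n::nat) a b. disjoint_intervals T n a b \<and> (\<Sum>i<n. b i - a i) < d \<longrightarrow>
        (\<Sum>i<n. \<bar>F (b i) * G (b i) - F (a i) * G (a i)\<bar>) < e"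
  proof (intro exI conjI allI impI)
    show "0 < min d1 d2" using d1 d2 by simp
    fix n :: nat and a b :: "nat \<Rightarrow> real"
    assume **: "disjoint_intervals T n a b \<and> (\<Sum>i<n. b i - a i) < min d1 d2"
    note * = this[unfolded disjoint_intervals_def]
    have "(\<Sum>i<n. \<bar>F (b i) * G (b i) - F (a i) * G (a i)\<bar>) \<le>
        (\<Sum>i<n. C * \<bar>F (b i) - F (a i)\<bar> + C * \<bar>G (b i) - G (a i)\<bar>)"
    proof (rule sum_mono)
      fix i assume "i \<in> {..<n}"
      then have "a i \<in> {0..T}" "b i \<in> {0..T}" using * by force+
      have "F (b i) * G (b i) - F (a i) * G (a i) = G (b i) * (F (b i) - F (a i)) + F (a i) * (G (b i) - G (a i))"
        by (simp add: algebra_simps)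
      also have "\<bar>\<dots>\<bar> \<le> \<bar>G (b i)\<bar> * \<bar>F (b i) - F (a i)\<bar> + \<bar>F (a i)\<bar> * \<bar>G (b i) - G (a i)\<bar>"
        by (metis abs_mult abs_triangle_ineq)
      also have "\<dots> \<le> C * \<bar>F (b i) - F (a i)\<bar> + C * \<bar>G (b i) - G (a i)\<bar>"
        using C \<open>a i \<in> _\<close> \<open>b i \<in> _\<close> by (intro add_mono mult_right_mono) auto
      finally show "\<bar>F (b i) * G (b i) - F (a i) * G (a i)\<bar> \<le> C * \<bar>F (b i) - F (a i)\<bar> + C * \<bar>G (b i) - G (a i)\<bar>" .
    qed
    also have "\<dots> = C * (\<Sum>i<n. \<bar>F (b i) - F (a i)\<bar>) + C * (\<Sum>i<n. \<bar>G (b i) - G (a i)\<bar>)"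
      by (simp add: sum.distrib sum_distrib_left)
    also have "\<dots> < C * (e / (2 * C)) + C * (e / (2 * C))"
      using C(1) ** d1(2)[of n a b] d2(2)[of n a b] by (intro add_strict_mono mult_strict_left_mono) auto
    also have "\<dots> = e" using C(1) by simp
    finally show "(\<Sum>i<n. \<bar>F (b i) * G (b i) - F (a i) * G (a i)\<bar>) < e" .
  qed
qed


section \<open>Integration by parts against test functions\<close>

lemma integrable_lebesgue_on_subset:
  fixes f :: "real \<Rightarrow> real"
  assumes f: "integrable (lebesgue_on S) f" and S: "S \<in> sets lebesgue" "A \<in> sets lebesgue" "A \<subseteq> S"
  shows "integrable (lebesgue_on A) f"
proof -
  have "integrable lebesgue (\<lambda>x. indicator S x *\<^sub>R f x)"
    using f S by (simp add: integrable_restrict_space)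
  from integrable_mult_indicator[OF S(2) this]
  have "integrable lebesgue (\<lambda>x. indicator A x *\<^sub>R (indicator S x *\<^sub>R f x))" .
  also have "(\<lambda>x. indicator A x *\<^sub>R (indicator S x *\<^sub>R f x)) = (\<lambda>x. indicator A x *\<^sub>R f x)"
    using S(3) by (auto simp: fun_eq_iff split: split_indicator)
  finally show ?thesis using S by (simp add: integrable_restrict_space)
qed

text \<open>\<open>distributional_derivative\<close> uses the Bochner integral over the open
  interval, the calculus lemmas the gauge integral over the closed one; the end points have measure
  0.\<close>

lemma integral_lebesgue_on_Ioo:
  fixes f :: "real \<Rightarrow> real"
  assumes "integrable (lebesgue_on {a..b}) f"
  shows "integral\<^sup>L (lebesgue_on {a<..<b}) f = integral {a..b} f"
proof -
  have "integrable (lebesgue_on {a<..<b}) f"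
    by (rule integrable_lebesgue_on_subset[OF assms]) auto
  then have "integral\<^sup>L (lebesgue_on {a<..<b}) f = integral {a<..<b} f"
    by (intro lebesgue_integral_eq_integral) auto
  then show ?thesis by (simp add: integral_open_interval_real)
qed

lemma integrable_continuous_mult:
  fixes f g :: "real \<Rightarrow> real"
  assumes g: "integrable (lebesgue_on {a..b}) g" and f: "continuous_on UNIV f"
  shows "integrable (lebesgue_on {a..b}) (\<lambda>t. f t * g t)"
proof -
  have "bounded (f ` {a..b})"
    using f by (intro compact_imp_bounded compact_continuous_image) (auto intro: continuous_on_subset)
  then obtain B where B: "\<And>t. t \<in> {a..b} \<Longrightarrow> \<bar>f t\<bar> \<le> B"
    unfolding bounded_iff by (metis imageI real_norm_def)
  have [measurable]: "f \<in> borel_measurable (lebesgue_on {a..b})"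
    using f by (intro measurable_restrict_space1 measurable_completion)
      (simp add: borel_measurable_continuous_onI)
  have [measurable]: "g \<in> borel_measurable (lebesgue_on {a..b})" using g by auto
  show ?thesis
  proof (rule Bochner_Integration.integrable_bound)
    show "integrable (lebesgue_on {a..b}) (\<lambda>t. B * g t)" using g by simp
    show "AE t in lebesgue_on {a..b}. norm (f t * g t) \<le> norm (B * g t)"
    proof (rule AE_I2)
      fix t assume "t \<in> space (lebesgue_on {a..b})"
      then have "\<bar>f t\<bar> \<le> \<bar>B\<bar>" using B[of t] by simp
      then show "norm (f t * g t) \<le> norm (B * g t)"
        by (simp add: abs_mult mult_right_mono)
    qed
  qed simp
qed

lemma integrable_lebesgue_on_continuous:
  fixes f :: "real \<Rightarrow> real"
  assumes "continuous_on {a..b} f"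
  shows "integrable (lebesgue_on {a..b}) f"
  using assms by (intro absolutely_integrable_imp_integrable
      absolutely_integrable_continuous_real) auto

lemma test_function_lipschitz:
  fixes \<phi> :: "real \<Rightarrow> real"
  assumes "\<phi> \<in> test_functions"
  shows "\<exists>B. \<forall>x y. \<bar>\<phi> x - \<phi> y\<bar> \<le> B * \<bar>x - y\<bar>"
proof -
  have d: "(\<phi> has_real_derivative gradient \<phi> x) (at x)" for x
    using test_function_has_gradient[OF assms, of x]
    by (simp add: gderiv_def has_field_derivative_def mult_commute_abs)
  obtain B where B: "\<And>x. \<bar>gradient \<phi> x\<bar> \<le> B"
    using gradient_test_function_bounded[OF assms] by auto
  have "norm (\<phi> x - \<phi> y) \<le> B * norm (x - y)" for x y
    by (rule field_differentiable_bound[of UNIV \<phi> "gradient \<phi>"]) (use d B in auto)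
  then show ?thesis by auto
qed

text \<open>The fundamental theorem is applied to the product \<phi> * u, which is absolutely
  continuous because test functions are Lipschitz, and which vanishes at 0 and T.\<close>

lemma absolutely_continuous_integration_by_parts:
  fixes u g \<phi> :: "real \<Rightarrow> real"
  assumes "0 < T" and u: "absolutely_continuous_fun T u"
    and g: "integrable (lebesgue_on {0..T}) g"
    and deriv: "AE t in lebesgue_on {0..T}. (u has_real_derivative g t) (at t within {0..T})"
    and \<phi>: "\<phi> \<in> test_functions" "\<phi> 0 = 0" "\<phi> T = 0"
  shows "(\<integral>t. deriv \<phi> t * u t \<partial>lebesgue_on {0<..<T}) = - (\<integral>t. \<phi> t * g t \<partial>lebesgue_on {0<..<T})"
proof -
  have "absolutely_continuous_fun T \<phi>"
    using test_function_lipschitz[OF \<phi>(1)] lipschitz_imp_absolutely_continuous by metis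
  then have AC: "absolutely_continuous_fun T (\<lambda>t. \<phi> t * u t)"
    using u by (rule absolutely_continuous_mult)
  have "AE t in lebesgue_on {0..T}.
      ((\<lambda>t. \<phi> t * u t) has_real_derivative deriv \<phi> t * u t + \<phi> t * g t) (at t within {0..T})"
    using deriv
  proof eventually_elim
    case (elim t)
    have "(\<phi> has_real_derivative deriv \<phi> t) (at t within {0..T})"
      using test_function_has_real_derivative[OF \<phi>(1)] by (rule has_field_derivative_at_within)
    from DERIV_mult[OF this elim] show ?case by (simp add: mult.commute)
  qed
  then have "((\<lambda>t. deriv \<phi> t * u t + \<phi> t * g t) has_integral \<phi> T * u T - \<phi> 0 * u 0) {0..T}"
    by (rule fundamental_theorem_absolutely_continuous[OF AC \<open>0 < T\<close>])
  then have *: "integral {0..T} (\<lambda>t. deriv \<phi> t * u t + \<phi> t * g t) = 0"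
    using \<phi> by (simp add: integral_unique)
  have 1: "integrable (lebesgue_on {0..T}) (\<lambda>t. deriv \<phi> t * u t)"
    using absolutely_continuous_imp_continuous[OF u] deriv_test_function_continuous[OF \<phi>(1)]
    by (intro integrable_continuous_mult integrable_lebesgue_on_continuous)
  have 2: "integrable (lebesgue_on {0..T}) (\<lambda>t. \<phi> t * g t)"
    using g test_function_continuous[OF \<phi>(1)] by (rule integrable_continuous_mult)
  have "(\<lambda>t. deriv \<phi> t * u t) integrable_on {0..T}" "(\<lambda>t. \<phi> t * g t) integrable_on {0..T}"
    using 1 2 by (auto intro: integrable_on_lebesgue_on)
  with * have "integral {0..T} (\<lambda>t. deriv \<phi> t * u t) + integral {0..T} (\<lambda>t. \<phi> t * g t) = 0"
    by (simp add: Henstock_Kurzweil_Integration.integral_add)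
  then show ?thesis
    using integral_lebesgue_on_Ioo[OF 1] integral_lebesgue_on_Ioo[OF 2] by simp
qed

lemma test_function_diff:
  assumes "f \<in> test_functions" "g \<in> test_functions"
  shows "(\<lambda>x. f x - g x) \<in> test_functions"
proof (rule test_functionI)
  show "cont_diff k (\<lambda>x. f x - g x)" for k
    using cont_diff_add[OF _ cont_diff_mult[OF cont_diff_const[of k "-1"]], of f g] assms
    by (auto simp: test_functions_def)
  show "compact (fun_support f \<union> fun_support g)"
    using assms by (auto simp: test_functions_def)
  show "f x - g x = 0" if "x \<notin> fun_support f \<union> fun_support g" for x
    using that eq_0_outside_fun_support[of x f] eq_0_outside_fun_support[of x g] by auto
qed

section \<open>Functions with vanishing weak derivative\<close>

text \<open>The vanishing integral brings the antiderivative back to 0 at b, and so makes it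
  compactly supported.\<close>

lemma test_function_antiderivative:
  fixes \<psi> :: "real \<Rightarrow> real"
  assumes \<psi>: "\<psi> \<in> test_functions" and "a < b" and supp: "\<And>x. x \<notin> {a..b} \<Longrightarrow> \<psi> x = 0"
    and int0: "integral {a..b} \<psi> = 0"
  obtains \<Psi> where "\<Psi> \<in> test_functions" "\<And>x. deriv \<Psi> x = \<psi> x" "\<And>x. x \<notin> {a..b} \<Longrightarrow> \<Psi> x = 0"
proof -
  have "\<exists>\<Psi>. \<forall>x::real. -\<infinity> < ereal x \<longrightarrow> ereal x < \<infinity> \<longrightarrow> (\<Psi> has_vector_derivative \<psi> x) (at x)"
    using test_function_continuous[OF \<psi>]
    by (intro einterval_antiderivative) (auto simp: continuous_on_eq_continuous_at)
  then obtain \<Psi>0 where \<Psi>0: "\<And>x. (\<Psi>0 has_real_derivative \<psi> x) (at x)"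
    by (auto simp: has_real_derivative_iff_has_vector_derivative)
  define \<Psi> where "\<Psi> x = \<Psi>0 x - \<Psi>0 a" for x
  have d: "(\<Psi> has_real_derivative \<psi> x) (at x)" for x
    unfolding \<Psi>_def[abs_def] using \<Psi>0 by (auto intro!: derivative_eq_intros)
  \<comment> \<open>\<open>supp\<close> says nothing at a and b themselves; there \<psi> vanishes by
    continuity, as points outside [a, b] are arbitrarily close.\<close>
  have zero_deriv: "\<psi> x = 0" if "x \<le> a \<or> b \<le> x" for x
  proof (rule ccontr)
    assume "\<psi> x \<noteq> 0"
    moreover have "open (- {y. \<psi> y = 0})"
      using closed_Collect_eq[OF test_function_continuous[OF \<psi>] continuous_on_const] by (rule open_Compl)
    ultimately obtain r where r: "0 < r" "ball x r \<subseteq> - {y. \<psi> y = 0}"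
      unfolding open_contains_ball by auto
    have "x - r / 2 \<in> ball x r" "x + r / 2 \<in> ball x r"
      using r(1) by (auto simp: dist_real_def)
    then have "\<psi> (x - r / 2) \<noteq> 0" "\<psi> (x + r / 2) \<noteq> 0" using r(2) by blast+
    then show False using supp[of "x - r / 2"] supp[of "x + r / 2"] that r(1) \<open>a < b\<close> by fastforce
  qed
  have d0: "(\<Psi> has_real_derivative 0) (at x within S)" if "x \<le> a \<or> b \<le> x" for x S
    using has_field_derivative_at_within[OF d] zero_deriv[OF that] by metis
  have left: "\<Psi> x = 0" if "x \<le> a" for x
  proof -
    have "\<exists>c. \<forall>y\<in>{..a}. \<Psi> y = c"
      by (intro has_field_derivative_zero_constant d0) auto
    then obtain c where "\<And>y. y \<le> a \<Longrightarrow> \<Psi> y = c" by auto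
    from this[of x] this[of a] that show ?thesis by (simp add: \<Psi>_def)
  qed
  have "\<Psi> b = 0"
  proof -
    have "(\<psi> has_integral \<Psi> b - \<Psi> a) {a..b}"
      using \<open>a < b\<close> d by (intro fundamental_theorem_of_calculus)
        (auto simp: has_real_derivative_iff_has_vector_derivative[symmetric] intro: has_field_derivative_at_within)
    then show ?thesis using int0 by (simp add: integral_unique \<Psi>_def)
  qed
  have right: "\<Psi> x = 0" if "b \<le> x" for x
  proof -
    have "\<exists>c. \<forall>y\<in>{b..}. \<Psi> y = c"
      by (intro has_field_derivative_zero_constant d0) auto
    then obtain c where "\<And>y. b \<le> y \<Longrightarrow> \<Psi> y = c" by auto
    from this[of x] this[of b] that \<open>\<Psi> b = 0\<close> show ?thesis by simp
  qed
  have out: "\<Psi> x = 0" if "x \<notin> {a..b}" for x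
    using that left right by fastforce
  have "cont_diff k \<Psi>" for k
  proof (rule cont_diff_Suc_imp, rule cont_diff_real_SucI[OF d])
    show "cont_diff k \<psi>" using \<psi> by (simp add: test_functions_def)
  qed
  then have "\<Psi> \<in> test_functions"
    using out by (intro test_functionI[of \<Psi> "{a..b}"]) auto
  then show ?thesis
    using d out by (intro that[of \<Psi>]) (auto intro: DERIV_imp_deriv)
qed

lemma fun_support_subset: "closed K \<Longrightarrow> (\<And>x. x \<notin> K \<Longrightarrow> f x = 0) \<Longrightarrow> fun_support f \<subseteq> K"
  unfolding fun_support_def by (rule closure_minimal) auto

text \<open>Subtracting from a compactly supported \<psi> the right multiple of a fixed bump leaves
  a function of integral 0, hence the derivative of a test function. So the integral of \<psi> * k
  is a fixed multiple c of the integral of \<psi>. Letting \<psi> approach indicators of intervals,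
  k - c integrates to 0 over every inner interval, and Lebesgue differentiation makes it vanish
  almost everywhere.\<close>

lemma du_Bois_Reymond:
  fixes k :: "real \<Rightarrow> real"
  assumes "0 < T" and k: "integrable (lebesgue_on {0..T}) k"
    and weak: "\<And>\<phi>. \<phi> \<in> test_functions \<Longrightarrow> fun_support \<phi> \<subseteq> {0<..<T} \<Longrightarrow>
      integral {0..T} (\<lambda>t. deriv \<phi> t * k t) = 0"
  shows "\<exists>c. AE t in lebesgue_on {0..T}. k t = c"
proof -
  \<comment> \<open>Supported in the middle third, away from 0 and T, and positive at T / 2, so that
    its integral can be divided by.\<close>
  define \<psi>0 :: "real \<Rightarrow> real" where "\<psi>0 = box_bump (T / 3) (2 * T / 3)"
  define I where "I \<psi> = integral {0..T} \<psi>" for \<psi> :: "real \<Rightarrow> real"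
  define h where "h \<psi> = integral {0..T} (\<lambda>t. \<psi> t * k t)" for \<psi> :: "real \<Rightarrow> real"
  have \<psi>0: "\<psi>0 \<in> test_functions" unfolding \<psi>0_def by (rule box_bump_test_function)
  have \<psi>0_out: "\<psi>0 x = 0" if "x \<notin> {T / 3..2 * T / 3}" for x
    using that unfolding \<psi>0_def box_bump_eq_0_iff box_real
    by (meson atLeastAtMost_iff greaterThanLessThan_iff less_imp_le)
  have ti: "\<psi> integrable_on {0..T}" "(\<lambda>t. \<psi> t * k t) integrable_on {0..T}"
    if "\<psi> \<in> test_functions" for \<psi>
    using test_function_continuous[OF that] integrable_continuous_mult[OF k]
    by (auto intro: integrable_continuous_interval continuous_on_subset integrable_on_lebesgue_on)
  have "0 < I \<psi>0"
  proof -
    have "I \<psi>0 \<noteq> 0"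
    proof
      assume "I \<psi>0 = 0"
      moreover have "0 \<le> \<psi>0 x" for x
        by (simp add: \<psi>0_def box_bump_nonneg)
      ultimately have "\<psi>0 (T / 2) = 0"
        using integral_eq_0_iff[of 0 T \<psi>0] \<open>0 < T\<close>
          continuous_on_subset[OF test_function_continuous[OF \<psi>0] subset_UNIV]
        by (simp add: I_def)
      then show False using \<open>0 < T\<close> by (simp add: \<psi>0_def box_bump_eq_0_iff)
    qed
    moreover have "0 \<le> I \<psi>0"
      unfolding I_def using ti[OF \<psi>0] by (intro Henstock_Kurzweil_Integration.integral_nonneg) (auto simp: \<psi>0_def box_bump_nonneg)
    ultimately show ?thesis by simp
  qed
  define c where "c = h \<psi>0 / I \<psi>0"
  have main: "h \<psi> = c * I \<psi>"
    if \<psi>: "\<psi> \<in> test_functions" and ab: "0 < a" "b < T" and out: "\<And>x. x \<notin> {a..b} \<Longrightarrow> \<psi> x = 0" for \<psi> a b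
  proof -
    define A where "A = min a (T / 3)"
    define B where "B = max b (2 * T / 3)"
    have AB: "0 < A" "A < B" "B < T" using ab \<open>0 < T\<close> by (auto simp: A_def B_def)
    \<comment> \<open>The combination of the two test functions with integral 0 is the derivative of a test function.\<close>
    define \<eta> where "\<eta> x = I \<psi>0 * \<psi> x - I \<psi> * \<psi>0 x" for x
    have \<eta>: "\<eta> \<in> test_functions"
      unfolding \<eta>_def[abs_def] by (intro test_function_diff test_function_mult_const \<psi> \<psi>0)
    have \<eta>_out: "\<eta> x = 0" if "x \<notin> {A..B}" for x
    proof -
      have "x \<notin> {a..b}" "x \<notin> {T / 3..2 * T / 3}"
        using that by (auto simp: A_def B_def)
      then show ?thesis using out \<psi>0_out by (simp add: \<eta>_def)
    qed
    have "integral {0..T} \<eta> = I \<psi>0 * I \<psi> - I \<psi> * I \<psi>0"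
      unfolding \<eta>_def[abs_def] I_def using ti[OF \<psi>] ti[OF \<psi>0]
      by (subst Henstock_Kurzweil_Integration.integral_diff) (auto intro: integrable_on_mult_right)
    moreover have "integral {0..T} \<eta> = integral {A..B} \<eta>"
    proof -
      have "integral {0..T} (\<lambda>x. if x \<in> {A..B} then \<eta> x else 0) = integral {A..B} \<eta>"
        using AB by (subst Henstock_Kurzweil_Integration.integral_restrict_Int) (auto simp: Int_absorb2 Int_absorb1)
      moreover have "(\<lambda>x. if x \<in> {A..B} then \<eta> x else 0) = \<eta>"
        using \<eta>_out by auto
      ultimately show ?thesis by simp
    qed
    ultimately have "integral {A..B} \<eta> = 0" by simp
    then obtain \<Psi> where \<Psi>: "\<Psi> \<in> test_functions" "\<And>x. deriv \<Psi> x = \<eta> x" "\<And>x. x \<notin> {A..B} \<Longrightarrow> \<Psi> x = 0"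
      using test_function_antiderivative[OF \<eta> \<open>A < B\<close> \<eta>_out] by blast
    have "fun_support \<Psi> \<subseteq> {A..B}"
      using \<Psi>(3) by (intro fun_support_subset) auto
    also have "{A..B} \<subseteq> {0<..<T}" using AB by auto
    finally have "integral {0..T} (\<lambda>t. \<eta> t * k t) = 0"
      using weak[OF \<Psi>(1)] by (simp add: \<Psi>(2))
    also have "(\<lambda>t. \<eta> t * k t) = (\<lambda>t. I \<psi>0 * (\<psi> t * k t) - I \<psi> * (\<psi>0 t * k t))"
      by (auto simp: \<eta>_def algebra_simps)
    also have "integral {0..T} \<dots> = I \<psi>0 * h \<psi> - I \<psi> * h \<psi>0"
      unfolding h_def using ti[OF \<psi>] ti[OF \<psi>0]
      by (subst Henstock_Kurzweil_Integration.integral_diff) (auto intro: integrable_on_mult_right)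
    finally show ?thesis
      using \<open>0 < I \<psi>0\<close> by (simp add: c_def field_simps)
  qed
  define l where "l t = k t - c" for t
  have l: "integrable (lebesgue_on {0..T}) l"
    unfolding l_def[abs_def] using k integrable_lebesgue_on_continuous[of 0 T "\<lambda>_. c"] by simp
  have box: "integral {a..b} l = 0" if ab: "0 < a" "a < b" "b < T" for a b
  proof -
    \<comment> \<open>With a constant sequence of boxes the bumps converge to the indicator of the
      single interval (a, b) and vanish outside [a, b].\<close>
    define g where "g n = boxes_bump (\<lambda>_. (a, b)) n" for n
    have g: "g n \<in> test_functions" "g n x = 0" if "x \<notin> {a..b}" for n x
      unfolding g_def using boxes_bump_test_function that
        boxes_bump_nonneg[of "\<lambda>_. (a, b)" n x] boxes_bump_le_indicator[of "\<lambda>_. (a, b)" n x]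
      by (auto simp: indicator_def split: if_splits)
    have gt: "g n \<in> test_functions" for n
      unfolding g_def by (rule boxes_bump_test_function)
    have "(\<integral>t. g n t * l t \<partial>lebesgue_on {0..T}) = 0" for n
    proof -
      have "(\<integral>t. g n t * l t \<partial>lebesgue_on {0..T}) = integral {0..T} (\<lambda>t. g n t * l t)"
        using integrable_continuous_mult[OF l test_function_continuous[OF gt]]
        by (intro lebesgue_integral_eq_integral) auto
      also have "\<dots> = integral {0..T} (\<lambda>t. g n t * k t - c * g n t)"
        by (simp add: l_def algebra_simps)
      also have "\<dots> = h (g n) - c * I (g n)"
        unfolding h_def I_def using ti[OF gt]
        by (subst Henstock_Kurzweil_Integration.integral_diff) (auto intro: integrable_on_mult_right)
      also have "\<dots> = 0"
        using main[OF gt \<open>0 < a\<close> \<open>b < T\<close> g(2)] by simp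
      finally show ?thesis .
    qed
    moreover have "(\<lambda>n. \<integral>t. g n t * l t \<partial>lebesgue_on {0..T}) \<longlonglongrightarrow> (\<integral>t. indicator {a<..<b} t * l t \<partial>lebesgue_on {0..T})"
    proof (rule integral_dominated_convergence[where w = "\<lambda>t. \<bar>l t\<bar>"])
      have [measurable]: "l \<in> borel_measurable (lebesgue_on {0..T})" using l by auto
      show "(\<lambda>t. indicator {a<..<b} t * l t) \<in> borel_measurable (lebesgue_on {0..T})"
      proof (rule borel_measurable_times)
        show "indicator {a<..<b} \<in> borel_measurable (lebesgue_on {0..T})"
          by (intro measurable_restrict_space1 measurable_completion) simp
      qed fact
      show "(\<lambda>t. g n t * l t) \<in> borel_measurable (lebesgue_on {0..T})" for n
        using integrable_continuous_mult[OF l test_function_continuous[OF gt]] by auto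
      show "integrable (lebesgue_on {0..T}) (\<lambda>t. \<bar>l t\<bar>)" using l by simp
      show "AE t in lebesgue_on {0..T}. (\<lambda>n. g n t * l t) \<longlonglongrightarrow> indicator {a<..<b} t * l t"
        using boxes_bump_tendsto[of "\<lambda>_. (a, b)"] by (intro AE_I2 tendsto_intros) (simp add: g_def)
      show "AE t in lebesgue_on {0..T}. norm (g n t * l t) \<le> \<bar>l t\<bar>" for n
        using boxes_bump_nonneg[of "\<lambda>_. (a, b)" n] boxes_bump_le_1[of "\<lambda>_. (a, b)" n]
        by (auto simp: g_def abs_mult intro!: mult_left_le_one_le)
    qed
    ultimately have "(\<integral>t. indicator {a<..<b} t * l t \<partial>lebesgue_on {0..T}) = 0"
      by (simp add: LIMSEQ_const_iff)
    also have "(\<integral>t. indicator {a<..<b} t * l t \<partial>lebesgue_on {0..T}) =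
        (\<integral>t. indicator {0..T} t *\<^sub>R (indicator {a<..<b} t * l t) \<partial>lebesgue)"
      by (subst integral_restrict_space) auto
    also have "\<dots> = (\<integral>t. indicator {a<..<b} t *\<^sub>R l t \<partial>lebesgue)"
      using ab by (intro Bochner_Integration.integral_cong) (auto split: split_indicator)
    also have "\<dots> = (\<integral>t. l t \<partial>lebesgue_on {a<..<b})"
      by (subst integral_restrict_space) auto
    also have "\<dots> = integral {a..b} l"
    proof (rule integral_lebesgue_on_Ioo)
      show "integrable (lebesgue_on {a..b}) l"
        using ab by (intro integrable_lebesgue_on_subset[OF l]) auto
    qed
    finally show ?thesis .
  qed
  have "AE t in lebesgue_on {0..T}. t \<notin> {0, T}"
  proof -
    have "AE t in lebesgue. t \<notin> {0, T}"
      by (rule AE_not_in) (simp add: negligible_iff_null_sets[symmetric])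
    then show ?thesis by (subst AE_restrict_space_iff) auto
  qed
  moreover have "AE t in lebesgue_on {0..T}. t \<in> {0..T}"
    by (rule AE_I2) simp
  ultimately have "AE t in lebesgue_on {0..T}. l t = 0"
    using lebesgue_differentiation[OF l]
  proof eventually_elim
    case (elim t)
    then have t: "0 < t" "t < T" by auto
    \<comment> \<open>Integrals over intervals strictly inside (0, T) vanish, so the indefinite
      integral of l is constant there; its derivative l t at t must then be 0.\<close>
    have const: "integral {0..s} l = integral {0..t} l" if "s \<in> {0<..<T}" for s
    proof -
      have li: "l integrable_on {0..T}" using integrable_on_lebesgue_on[OF l] by simp
      have "integral {0..x} l + integral {x..y} l = integral {0..y} l" if "0 < x" "x < y" "y < T" for x y
        using that by (intro Henstock_Kurzweil_Integration.integral_combine integrable_on_subinterval[OF li]) auto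
      note comb = this
      show ?thesis
      proof (cases s t rule: linorder_cases)
        case less
        then have "integral {0..s} l + integral {s..t} l = integral {0..t} l" "integral {s..t} l = 0"
          using that t by (auto intro!: comb box)
        then show ?thesis by linarith
      next
        case greater
        then have "integral {0..t} l + integral {t..s} l = integral {0..s} l" "integral {t..s} l = 0"
          using that t by (auto intro!: comb box)
        then show ?thesis by linarith
      qed simp
    qed
    have "at t within {0..T} = at t"
      using t by (intro at_within_interior) simp
    note elim(3)[unfolded this]
    moreover have "((\<lambda>s. integral {0..s} l) has_real_derivative 0) (at t)"
    proof (rule has_field_derivative_transform_within_open)
      show "((\<lambda>s. integral {0..t} l) has_real_derivative 0) (at t)" by simp
      show "open {0<..<T}" "t \<in> {0<..<T}" using t by auto
      show "\<And>s. s \<in> {0<..<T} \<Longrightarrow> integral {0..t} l = integral {0..s} l" using const by simp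
    qed
    ultimately show ?case by (rule DERIV_unique)
  qed
  then show ?thesis by (intro exI[of _ c]) (simp add: l_def)
qed

text \<open>By integration by parts the indefinite integral of g also has distributional derivative
  g, so its difference from u has weak derivative 0 and is constant.\<close>

lemma distributional_derivative_imp_indefinite_integral:
  fixes u g :: "real \<Rightarrow> real"
  assumes "0 < T" and u: "integrable (lebesgue_on {0..T}) u" and g: "integrable (lebesgue_on {0..T}) g"
    and dd: "distributional_derivative T u g"
  shows "\<exists>c. AE t in lebesgue_on {0..T}. u t = c + integral {0..t} g"
proof -
  define G where "G t = integral {0..t} g" for t
  have AC: "absolutely_continuous_fun T G"
    using absolutely_continuous_indefinite_integral[OF g, of 0] by (simp add: G_def[abs_def])
  have G: "integrable (lebesgue_on {0..T}) G"
    by (intro integrable_lebesgue_on_continuous absolutely_continuous_imp_continuous AC)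
  have "\<exists>c. AE t in lebesgue_on {0..T}. u t - G t = c"
  proof (rule du_Bois_Reymond[OF \<open>0 < T\<close>])
    show "integrable (lebesgue_on {0..T}) (\<lambda>t. u t - G t)" using u G by simp
    fix \<phi> :: "real \<Rightarrow> real"
    assume \<phi>: "\<phi> \<in> test_functions" "fun_support \<phi> \<subseteq> {0<..<T}"
    have "0 \<notin> fun_support \<phi>" "T \<notin> fun_support \<phi>" using \<phi>(2) by force+
    then have "\<phi> 0 = 0" "\<phi> T = 0" by (auto intro: eq_0_outside_fun_support)
    then have "(\<integral>t. deriv \<phi> t * G t \<partial>lebesgue_on {0<..<T}) = - (\<integral>t. \<phi> t * g t \<partial>lebesgue_on {0<..<T})"
      using lebesgue_differentiation[OF g] \<phi>(1)
      by (intro absolutely_continuous_integration_by_parts[OF \<open>0 < T\<close> AC g]) (auto simp: G_def[abs_def])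
    also have "\<dots> = (\<integral>t. deriv \<phi> t * u t \<partial>lebesgue_on {0<..<T})"
      using dd \<phi> by (simp add: distributional_derivative_def)
    finally have eq: "(\<integral>t. deriv \<phi> t * u t \<partial>lebesgue_on {0<..<T}) = (\<integral>t. deriv \<phi> t * G t \<partial>lebesgue_on {0<..<T})" ..
    have 1: "integrable (lebesgue_on {0..T}) (\<lambda>t. deriv \<phi> t * u t)"
      "integrable (lebesgue_on {0..T}) (\<lambda>t. deriv \<phi> t * G t)"
      using u G deriv_test_function_continuous[OF \<phi>(1)] by (auto intro: integrable_continuous_mult)
    then have "integral {0..T} (\<lambda>t. deriv \<phi> t * u t) = integral {0..T} (\<lambda>t. deriv \<phi> t * G t)"
      using eq by (simp add: integral_lebesgue_on_Ioo)
    moreover have "(\<lambda>t. deriv \<phi> t * u t) integrable_on {0..T}" "(\<lambda>t. deriv \<phi> t * G t) integrable_on {0..T}"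
      using 1 by (auto intro: integrable_on_lebesgue_on)
    ultimately show "integral {0..T} (\<lambda>t. deriv \<phi> t * (u t - G t)) = 0"
      by (simp add: right_diff_distrib Henstock_Kurzweil_Integration.integral_diff)
  qed
  then obtain c where "AE t in lebesgue_on {0..T}. u t - G t = c" by blast
  then have "AE t in lebesgue_on {0..T}. u t = c + integral {0..t} g"
    unfolding G_def by eventually_elim linarith
  then show ?thesis by blast
qed


section \<open>Convergence against test functions\<close>

lemma borel_probsD:
  assumes "M \<in> borel_probs"
  shows "prob_space M" "sets M = sets borel" "space M = UNIV"
  using assms sets_eq_imp_space_eq[of M borel] by (auto simp: space_prob_algebra)

lemma borel_probsI: "prob_space M \<Longrightarrow> sets M = sets borel \<Longrightarrow> M \<in> borel_probs"
  by (simp add: space_prob_algebra)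

lemma integrable_bounded_borel:
  fixes f :: "'a::topological_space \<Rightarrow> real"
  assumes "M \<in> borel_probs" "f \<in> borel_measurable borel" "\<And>x. \<bar>f x\<bar> \<le> B"
  shows "integrable M f"
proof -
  interpret prob_space M using borel_probsD assms by blast
  have "f \<in> borel_measurable M"
    using assms borel_probsD(2)[OF assms(1)] by (simp cong: measurable_cong_sets)
  then show ?thesis using assms(3) by (intro integrable_const_bound[of _ B]) auto
qed

lemma test_function_borel_measurable: "f \<in> test_functions \<Longrightarrow> f \<in> borel_measurable borel"
  by (simp add: borel_measurable_continuous_onI test_function_continuous)

lemma integrable_test_function:
  assumes "M \<in> borel_probs" "f \<in> test_functions"
  shows "integrable M f"
  using test_function_bounded[OF assms(2)] test_function_borel_measurable[OF assms(2)]
    integrable_bounded_borel[OF assms(1)] by blast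

lemma abs_integral_le_bound:
  assumes M: "M \<in> borel_probs" and f: "f \<in> test_functions" and B: "\<And>x. \<bar>f x\<bar> \<le> B"
  shows "\<bar>\<integral>x. f x \<partial>M\<bar> \<le> B"
proof -
  interpret prob_space M using borel_probsD[OF M] by simp
  have "\<bar>\<integral>x. f x \<partial>M\<bar> \<le> (\<integral>x. \<bar>f x\<bar> \<partial>M)" by (rule integral_abs_bound)
  also have "\<dots> \<le> B"
    using integrable_test_function[OF M f] B by (intro integral_le_const) auto
  finally show ?thesis .
qed

lemma integral_boxes_bump_tendsto:
  fixes M :: "'a::euclidean_space measure"
  assumes M: "M \<in> borel_probs"
  shows "(\<lambda>n. \<integral>x. boxes_bump c n x \<partial>M) \<longlonglongrightarrow> measure M (\<Union>j. box (fst (c j)) (snd (c j)))"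
proof -
  interpret prob_space M using borel_probsD[OF M] by simp
  let ?U = "\<Union>j. box (fst (c j)) (snd (c j)) :: 'a set"
  have U: "?U \<in> sets M" using borel_probsD[OF M] by (simp add: open_UN)
  have "(\<lambda>n. \<integral>x. boxes_bump c n x \<partial>M) \<longlonglongrightarrow> (\<integral>x. indicator ?U x \<partial>M)"
  proof (rule integral_dominated_convergence[where w = "\<lambda>x. 1"])
    show "(\<lambda>x. indicator ?U x :: real) \<in> borel_measurable M" using U by simp
    show "boxes_bump c n \<in> borel_measurable M" for n
      using integrable_test_function[OF M boxes_bump_test_function] by auto
    show "AE x in M. (\<lambda>n. boxes_bump c n x) \<longlonglongrightarrow> indicator ?U x"
      by (intro AE_I2 boxes_bump_tendsto)
    show "AE x in M. norm (boxes_bump c n x) \<le> 1" for n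
      by (intro AE_I2) (simp add: boxes_bump_nonneg boxes_bump_le_1)
  qed simp
  then show ?thesis using U by simp
qed

text \<open>Together with \<open>integral_boxes_bump_tendsto\<close> this approximates the mass of
  an open set from below by test functions; lower semicontinuity on open sets rests on it.\<close>

lemma integral_boxes_bump_le:
  fixes M :: "'a::euclidean_space measure"
  assumes M: "M \<in> borel_probs"
  shows "(\<integral>x. boxes_bump c n x \<partial>M) \<le> measure M (\<Union>j. box (fst (c j)) (snd (c j)))"
proof -
  interpret prob_space M using borel_probsD[OF M] by simp
  let ?U = "\<Union>j. box (fst (c j)) (snd (c j)) :: 'a set"
  have U: "?U \<in> sets M" using borel_probsD[OF M] by (simp add: open_UN)
  have "(\<integral>x. boxes_bump c n x \<partial>M) \<le> (\<integral>x. indicator ?U x \<partial>M)"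
    using U integrable_test_function[OF M boxes_bump_test_function] boxes_bump_le_indicator
    by (intro integral_mono) (auto simp: integrable_indicator_iff emeasure_eq_measure)
  then show ?thesis using U by simp
qed

section \<open>Measures are determined by test functions\<close>

text \<open>Open sets form an intersection-stable generator, and the mass of an open set is a
  pointwise limit of pairings with test functions. In this way a solution of the measure
  differential equation, whose definition has no clause on measurability in time, is seen to be
  measurable.\<close>

lemma measurable_of_test_functions:
  fixes K :: "'b \<Rightarrow> 'a::euclidean_space measure"
  assumes K: "\<And>t. t \<in> space X \<Longrightarrow> K t \<in> borel_probs"
    and meas: "\<And>f. f \<in> test_functions \<Longrightarrow> (\<lambda>t. \<integral>x. f x \<partial>K t) \<in> borel_measurable X"
  shows "K \<in> X \<rightarrow>\<^sub>M prob_algebra borel"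
proof (rule measurable_prob_algebra_generated[where G = "{U. open U}" and \<Omega> = UNIV])
  show "sets borel = sigma_sets UNIV {U :: 'a set. open U}"
    by (simp add: borel_def)
  show "Int_stable {U :: 'a set. open U}" by (auto simp: Int_stable_def)
  fix U :: "'a set" assume "U \<in> {U. open U}"
  then have "open U" by simp
  from open_eq_UN_boxes[OF this] obtain c where U: "U = (\<Union>j::nat. box (fst (c j)) (snd (c j)))" ..
  have "(\<lambda>t. measure (K t) U) \<in> borel_measurable X"
  proof (rule borel_measurable_LIMSEQ_real)
    show "(\<lambda>n. \<integral>x. boxes_bump c n x \<partial>K t) \<longlonglongrightarrow> measure (K t) U" if "t \<in> space X" for t
      unfolding U using K[OF that] by (rule integral_boxes_bump_tendsto)
    show "(\<lambda>t. \<integral>x. boxes_bump c n x \<partial>K t) \<in> borel_measurable X" for n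
      by (rule meas[OF boxes_bump_test_function])
  qed
  moreover have "emeasure (K t) U = ennreal (measure (K t) U)" if "t \<in> space X" for t
    using borel_probsD(1)[OF K[OF that]] by (simp add: finite_measure.emeasure_eq_measure prob_space_def)
  ultimately show "(\<lambda>t. emeasure (K t) U) \<in> borel_measurable X"
    by (simp cong: measurable_cong)
qed (use K borel_probsD in auto)

lemma borel_probs_eqI_open:
  fixes M N :: "'a::euclidean_space measure"
  assumes M: "M \<in> borel_probs" and N: "N \<in> borel_probs"
    and eq: "\<And>U. open U \<Longrightarrow> measure M U = measure N U"
  shows "M = N"
proof (rule measure_eqI_generator_eq[where E = "{U. open U}" and \<Omega> = UNIV and A = "\<lambda>_. UNIV"])
  interpret M: prob_space M using borel_probsD[OF M] by simp
  interpret N: prob_space N using borel_probsD[OF N] by simp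
  show "sets M = sigma_sets UNIV {U. open U}" "sets N = sigma_sets UNIV {U. open U}"
    using borel_probsD[OF M] borel_probsD[OF N] by (simp_all add: borel_def)
  show "emeasure M U = emeasure N U" if "U \<in> {U. open U}" for U
    using that eq by (simp add: M.emeasure_eq_measure N.emeasure_eq_measure)
  show "emeasure M UNIV \<noteq> \<infinity>" for i :: nat by simp
qed (auto simp: Int_stable_def)

lemma countable_determining_test_functions:
  "\<exists>C \<subseteq> test_functions. countable C \<and>
    (\<forall>M\<in>borel_probs. \<forall>N\<in>borel_probs. (\<forall>f\<in>C. (\<integral>x. f x \<partial>M) = (\<integral>x. f x \<partial>N)) \<longrightarrow>
      M = (N :: 'a::euclidean_space measure))"
proof -
  obtain B :: "'a set set" where B: "countable B" "topological_basis B"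
    using ex_countable_basis by blast
  \<comment> \<open>Finite unions of basis sets: every open set is then an increasing union of
    members, so continuity from below applies, and the family stays countable.\<close>
  define \<V> where "\<V> = {\<Union>F | F. F \<subseteq> B \<and> finite F}"
  have "countable {F. F \<subseteq> B \<and> finite F}"
    using countable_Collect_finite_subset[OF B(1)] by (simp add: conj_commute)
  then have "countable ((\<lambda>F. \<Union>F) ` {F. F \<subseteq> B \<and> finite F})" by blast
  also have "(\<lambda>F. \<Union>F) ` {F. F \<subseteq> B \<and> finite F} = \<V>" by (auto simp: \<V>_def)
  finally have "countable \<V>" .
  have openV: "open V" if "V \<in> \<V>" for V
    using that topological_basis_open[OF B(2)] by (auto simp: \<V>_def)
  then have "\<exists>c. V = (\<Union>j::nat. box (fst (c j)) (snd (c j)))" if "V \<in> \<V>" for V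
    using that open_eq_UN_boxes by blast
  then obtain c where c: "\<And>V. V \<in> \<V> \<Longrightarrow> V = (\<Union>j::nat. box (fst (c V j)) (snd (c V j)))"
    by metis
  define C where "C = (\<Union>V\<in>\<V>. range (boxes_bump (c V)))"
  have "M = N" if M: "M \<in> borel_probs" and N: "N \<in> borel_probs"
    and eq: "\<forall>f\<in>C. (\<integral>x. f x \<partial>M) = (\<integral>x. f x \<partial>N)" for M N :: "'a measure"
  proof (rule borel_probs_eqI_open[OF M N])
    interpret M: prob_space M using borel_probsD[OF M] by simp
    interpret N: prob_space N using borel_probsD[OF N] by simp
    have V: "measure M V = measure N V" if "V \<in> \<V>" for V
    proof -
      have "(\<integral>x. boxes_bump (c V) n x \<partial>M) = (\<integral>x. boxes_bump (c V) n x \<partial>N)" for n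
        using eq that by (auto simp: C_def)
      moreover note integral_boxes_bump_tendsto[OF M, of "c V", folded c[OF that]]
        integral_boxes_bump_tendsto[OF N, of "c V", folded c[OF that]]
      ultimately show ?thesis using LIMSEQ_unique by simp
    qed
    fix U :: "'a set" assume "open U"
    then obtain B' where B': "B' \<subseteq> B" "\<Union>B' = U"
      using B(2) unfolding topological_basis_def by blast
    show "measure M U = measure N U"
    proof (cases "B' = {}")
      case True
      then show ?thesis using B' by auto
    next
      case False
      moreover have "countable B'" using B B' countable_subset by blast
      ultimately obtain b :: "nat \<Rightarrow> 'a set" where b: "range b = B'"
        using uncountable_def by blast
      define W where "W n = (\<Union>i\<le>n. b i)" for n
      have W: "W n \<in> \<V>" for n
        using b B'(1) by (auto simp: W_def \<V>_def intro!: exI[of _ "b ` {..n}"])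
      have "U = (\<Union>n. W n)"
        using b B'(2) by (auto simp: W_def)
      moreover have "incseq W" by (force simp: W_def incseq_def)
      moreover have "range W \<subseteq> sets borel" using W openV by auto
      ultimately have "(\<lambda>n. measure M (W n)) \<longlonglongrightarrow> measure M U" "(\<lambda>n. measure N (W n)) \<longlonglongrightarrow> measure N U"
        using M.finite_Lim_measure_incseq[of W] N.finite_Lim_measure_incseq[of W]
        by (simp_all add: borel_probsD(2)[OF M] borel_probsD(2)[OF N])
      moreover have "(\<lambda>n. measure M (W n)) = (\<lambda>n. measure N (W n))"
        using V[OF W] by (intro ext)
      ultimately show ?thesis by (metis LIMSEQ_unique)
    qed
  qed
  moreover have "countable C"
    unfolding C_def using \<open>countable \<V>\<close> by (intro countable_UN) auto
  moreover have "C \<subseteq> test_functions"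
    by (auto simp: C_def boxes_bump_test_function)
  ultimately show ?thesis by blast
qed

section \<open>From test functions to narrow convergence\<close>

text \<open>One half of the portmanteau theorem: a bump below the indicator of U that nearly attains
  the mass of U under M transfers the bound to \<open>N i\<close>. The filter is general because it
  will be that of s tending to t within [0, T].\<close>

lemma test_convergence_open:
  fixes N :: "'b \<Rightarrow> 'a::euclidean_space measure"
  assumes M: "M \<in> borel_probs" and N: "eventually (\<lambda>i. N i \<in> borel_probs) F"
    and conv: "\<And>f. f \<in> test_functions \<Longrightarrow> ((\<lambda>i. \<integral>x. f x \<partial>N i) \<longlongrightarrow> (\<integral>x. f x \<partial>M)) F"
    and "open U" "0 < e"
  shows "eventually (\<lambda>i. measure M U - e < measure (N i) U) F"
proof -
  from open_eq_UN_boxes[OF \<open>open U\<close>] obtain c where U: "U = (\<Union>j::nat. box (fst (c j)) (snd (c j)))" ..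
  have "eventually (\<lambda>n. measure M U - e < (\<integral>x. boxes_bump c n x \<partial>M)) sequentially"
    using integral_boxes_bump_tendsto[OF M, of c] \<open>0 < e\<close> unfolding U by (intro order_tendstoD(1)) auto
  then obtain n where "measure M U - e < (\<integral>x. boxes_bump c n x \<partial>M)"
    using eventually_happens'[OF sequentially_bot] by blast
  then have "eventually (\<lambda>i. measure M U - e < (\<integral>x. boxes_bump c n x \<partial>N i)) F"
    by (intro order_tendstoD(1)[OF conv[OF boxes_bump_test_function]])
  with N show ?thesis
  proof eventually_elim
    case (elim i)
    then show ?case using integral_boxes_bump_le[of "N i" c n] unfolding U by simp
  qed
qed

text \<open>The sum counts the j >= 1 with j < m y. There are \<lceil>m y\<rceil> - 1 of them, and
  none for y = 0, so after division by m the count is at most y and at least y - 1 / m.\<close>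

lemma layer_sum_bounds:
  fixes y :: real
  assumes "0 < m" "0 \<le> y" "y \<le> 1"
  shows "(\<Sum>j=1..m. indicator {r. real j / real m < r} y) / real m \<le> y"
    and "y - 1 / real m \<le> (\<Sum>j=1..m. indicator {r. real j / real m < r} y) / real m"
proof -
  let ?c = "nat \<lceil>real m * y\<rceil>"
  have le: "real m * y \<le> real m" using assms by (simp add: mult_left_le)
  have "(\<Sum>j=1..m. indicator {r. real j / real m < r} y) = real (card {j \<in> {1..m}. real j / real m < y})"
    by (simp add: indicator_def sum.If_cases Int_def)
  also have "{j \<in> {1..m}. real j / real m < y} = {1..<?c}"
  proof -
    have "real j / real m < y \<longleftrightarrow> j < ?c" for j
      using assms(1) by (simp add: divide_less_eq mult.commute less_ceiling_iff zless_nat_eq_int_zless)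
    moreover have "j \<le> m" if "real j / real m < y" for j
    proof -
      have "real j < real m * y" using that assms(1) by (simp add: divide_less_eq mult.commute)
      then show ?thesis using le by linarith
    qed
    ultimately show ?thesis by auto
  qed
  finally have s: "(\<Sum>j=1..m. indicator {r. real j / real m < r} y) = real (?c - 1)" by simp
  have "real m * y - 1 \<le> real (?c - 1)" "real (?c - 1) \<le> real m * y"
    using assms by (auto simp: of_nat_diff_if) linarith+
  then have "(real m * y - 1) / real m \<le> real (?c - 1) / real m" "real (?c - 1) / real m \<le> real m * y / real m"
    by (intro divide_right_mono; simp)+
  then show "(\<Sum>j=1..m. indicator {r. real j / real m < r} y) / real m \<le> y"
    "y - 1 / real m \<le> (\<Sum>j=1..m. indicator {r. real j / real m < r} y) / real m"
    unfolding s using assms(1) by (simp_all add: diff_divide_distrib)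
qed

text \<open>Superlevel sets of a continuous function are open, so the lower bound on open sets
  passes to integrals. Half of e pays for the layers of height 1 / m, the other half for the
  finitely many open sets, which are treated simultaneously.\<close>

lemma test_convergence_lower:
  fixes N :: "'b \<Rightarrow> 'a::euclidean_space measure" and f :: "'a \<Rightarrow> real"
  assumes M: "M \<in> borel_probs" and N: "eventually (\<lambda>i. N i \<in> borel_probs) F"
    and conv: "\<And>f. f \<in> test_functions \<Longrightarrow> ((\<lambda>i. \<integral>x. f x \<partial>N i) \<longlongrightarrow> (\<integral>x. f x \<partial>M)) F"
    and f: "continuous_on UNIV f" "\<And>x. 0 \<le> f x" "\<And>x. f x \<le> 1" and "0 < e"
  shows "eventually (\<lambda>i. (\<integral>x. f x \<partial>M) - e < (\<integral>x. f x \<partial>N i)) F"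
proof -
  obtain m where m: "0 < m" "1 / real m < e / 2"
    using \<open>0 < e\<close> ex_inverse_of_nat_less[of "e / 2"] by (auto simp: inverse_eq_divide)
  define U where "U j = {x. real j / real m < f x}" for j
  have U: "open (U j)" for j
    unfolding U_def using f(1) by (intro open_Collect_less continuous_on_const)
  \<comment> \<open>A finite layer-cake sum approximates f from below by indicators of open sets.\<close>
  define S where "S x = (\<Sum>j=1..m. indicator (U j) x) / real m" for x
  have S: "S x \<le> f x" "f x - 1 / real m \<le> S x" for x
    using layer_sum_bounds[OF m(1) f(2)[of x] f(3)[of x]] by (simp_all add: S_def U_def indicator_def)
  have intS: "(\<integral>x. S x \<partial>K) = (\<Sum>j=1..m. measure K (U j)) / real m \<and> integrable K S \<and> integrable K f \<and> prob_space K"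
    if K: "K \<in> borel_probs" for K
  proof -
    interpret prob_space K using borel_probsD[OF K] by simp
    have [simp]: "U j \<in> sets K" "U j \<inter> space K = U j" for j using U borel_probsD[OF K] by auto
    have i: "integrable K (indicator (U j) :: _ \<Rightarrow> real)" for j
      by (simp add: integrable_indicator_iff emeasure_eq_measure)
    have "integrable K f"
      by (rule integrable_bounded_borel[OF K, of _ 1]) (use f in \<open>auto simp: borel_measurable_continuous_onI\<close>)
    moreover have "integrable K S" unfolding S_def[abs_def] using i by auto
    moreover have "(\<integral>x. S x \<partial>K) = (\<Sum>j=1..m. measure K (U j)) / real m"
      unfolding S_def[abs_def] using i by (simp add: Bochner_Integration.integral_sum)
    ultimately show ?thesis using prob_space_axioms by simp
  qed
  have "eventually (\<lambda>i. \<forall>j\<in>{1..m}. measure M (U j) - e / 2 < measure (N i) (U j)) F"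
    using \<open>0 < e\<close> conv by (intro eventually_ball_finite ballI test_convergence_open[OF M N _ U]) auto
  with N show ?thesis
  proof eventually_elim
    case (elim i)
    interpret M: prob_space M using borel_probsD[OF M] by simp
    have "(\<integral>x. f x \<partial>M) - 1 / real m = (\<integral>x. f x - 1 / real m \<partial>M)"
      using intS[OF M] M.prob_space by (subst Bochner_Integration.integral_diff) auto
    also have "\<dots> \<le> (\<integral>x. S x \<partial>M)"
      using intS[OF M] S(2) by (intro integral_mono) auto
    also have "\<dots> = (\<Sum>j=1..m. measure M (U j)) / real m"
      using intS[OF M] by simp
    also have "\<dots> \<le> (\<Sum>j=1..m. measure (N i) (U j) + e / 2) / real m"
      using elim(2) by (intro divide_right_mono sum_mono) force+
    also have "\<dots> = (\<integral>x. S x \<partial>N i) + e / 2"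
      using intS[OF elim(1)] m(1) by (simp add: sum.distrib add_divide_distrib)
    also have "(\<integral>x. S x \<partial>N i) \<le> (\<integral>x. f x \<partial>N i)"
      using intS[OF elim(1)] S(1) by (intro integral_mono) auto
    finally show ?case using m(2) by simp
  qed
qed

text \<open>After rescaling f to a function g with values in [0, 1], the lower estimate for 1 - g is
  an upper estimate for g because all measures involved have mass 1.\<close>

lemma test_convergence_imp_narrow:
  fixes N :: "'b \<Rightarrow> 'a::euclidean_space measure" and f :: "'a \<Rightarrow> real"
  assumes M: "M \<in> borel_probs" and N: "eventually (\<lambda>i. N i \<in> borel_probs) F"
    and conv: "\<And>f. f \<in> test_functions \<Longrightarrow> ((\<lambda>i. \<integral>x. f x \<partial>N i) \<longlongrightarrow> (\<integral>x. f x \<partial>M)) F"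
    and f: "continuous_on UNIV f" "bounded (range f)"
  shows "((\<lambda>i. \<integral>x. f x \<partial>N i) \<longlongrightarrow> (\<integral>x. f x \<partial>M :: real)) F"
proof -
  obtain B where B: "0 < B" "\<And>x. \<bar>f x\<bar> \<le> B"
    using f(2) by (auto simp: bounded_pos)
  define g where "g x = (f x + B) / (2 * B)" for x
  have g: "continuous_on UNIV g" "0 \<le> g x" "g x \<le> 1" for x
    using f(1) B(1) B(2)[of x] by (auto simp: g_def[abs_def] abs_le_iff field_simps intro!: continuous_intros)
  have int: "(\<integral>x. f x \<partial>K) = 2 * B * (\<integral>x. g x \<partial>K) - B" "(\<integral>x. 1 - g x \<partial>K) = 1 - (\<integral>x. g x \<partial>K)"
    if K: "K \<in> borel_probs" for K
  proof -
    interpret prob_space K using borel_probsD[OF K] by simp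
    have i: "integrable K g"
      by (rule integrable_bounded_borel[OF K, of _ 1]) (use g in \<open>auto simp: borel_measurable_continuous_onI\<close>)
    have "f = (\<lambda>x. 2 * B * g x - B)" using B(1) by (auto simp: g_def)
    then have "(\<integral>x. f x \<partial>K) = (\<integral>x. 2 * B * g x - B \<partial>K)" by simp
    then show "(\<integral>x. f x \<partial>K) = 2 * B * (\<integral>x. g x \<partial>K) - B"
      using i prob_space by (simp add: Bochner_Integration.integral_diff)
    show "(\<integral>x. 1 - g x \<partial>K) = 1 - (\<integral>x. g x \<partial>K)"
      using i prob_space by (simp add: Bochner_Integration.integral_diff)
  qed
  have g': "continuous_on UNIV (\<lambda>x. 1 - g x)" using g(1) by (intro continuous_intros)
  have "((\<lambda>i. \<integral>x. g x \<partial>N i) \<longlongrightarrow> (\<integral>x. g x \<partial>M)) F"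
  proof (rule tendstoI)
    fix e :: real assume "0 < e"
    have "eventually (\<lambda>i. (\<integral>x. g x \<partial>M) - e < (\<integral>x. g x \<partial>N i)) F"
      using conv g \<open>0 < e\<close> by (intro test_convergence_lower[OF M N])
    moreover have "eventually (\<lambda>i. (\<integral>x. 1 - g x \<partial>M) - e < (\<integral>x. 1 - g x \<partial>N i)) F"
      using conv g' g \<open>0 < e\<close> by (intro test_convergence_lower[OF M N]) auto
    ultimately show "eventually (\<lambda>i. dist (\<integral>x. g x \<partial>N i) (\<integral>x. g x \<partial>M) < e) F"
      using N
    proof eventually_elim
      case (elim i)
      then show ?case using int(2)[OF M] int(2)[OF elim(3)] by (simp add: dist_real_def abs_less_iff)
    qed
  qed
  then have "((\<lambda>i. 2 * B * (\<integral>x. g x \<partial>N i) - B) \<longlongrightarrow> 2 * B * (\<integral>x. g x \<partial>M) - B) F"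
    by (intro tendsto_intros)
  moreover have "eventually (\<lambda>i. 2 * B * (\<integral>x. g x \<partial>N i) - B = (\<integral>x. f x \<partial>N i)) F"
    using N by eventually_elim (rule int(1)[symmetric])
  ultimately show ?thesis
    by (subst int(1)[OF M]) (rule Lim_transform_eventually)
qed


section \<open>Vague compactness\<close>

text \<open>A Borel probability measure on a Euclidean space is transported to the real line by a Borel right
  inverse of Schoenberg's space-filling curve, so that Helly's selection theorem gives compactness in
  every dimension.\<close>

text \<open>A continuous function of period 2 that is 0 on $[0, 1/3]$ and 1 on $[2/3, 1]$, so that its value
  at $3^n s$ is half the digit of index $n$ (from 0) when all ternary digits of $s$ are 0 or 2.\<close>

definition schoenberg_wave :: "real \<Rightarrow> real" where
  "schoenberg_wave y = max 0 (min 1 (1 / 2 - cos (pi * y)))"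

lemma schoenberg_wave_bounds: "0 \<le> schoenberg_wave y" "schoenberg_wave y \<le> 1"
  by (auto simp: schoenberg_wave_def)

lemma schoenberg_wave_continuous: "continuous_on S schoenberg_wave"
  unfolding schoenberg_wave_def[abs_def] by (intro continuous_intros)

lemma cos_ge_half: "\<bar>x\<bar> \<le> pi / 3 \<Longrightarrow> 1 / 2 \<le> cos x"
  using cos_monotone_0_pi_le[of "\<bar>x\<bar>" "pi / 3"] pi_gt_zero by (simp add: cos_60)

text \<open>Modulo the period 2 only 2 b / 3 + r matters. It lies in [0, 1/3] for b = 0, where cos
  (pi y) >= 1/2, and in [2/3, 1] for b = 1, where cos (pi y) <= -1/2; the clipping turns these into
  the values 0 and 1.\<close>

lemma schoenberg_wave_digit:
  assumes "b \<in> {0, 1}" "0 \<le> r" "r \<le> 1 / 3"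
  shows "schoenberg_wave (2 * real_of_int N + 2 * b / 3 + r) = b"
proof -
  have "cos (pi * (2 * real_of_int N + 2 * b / 3 + r)) = cos (pi * (2 * b / 3 + r) + 2 * pi * real_of_int N)"
    by (simp add: algebra_simps)
  also have "\<dots> = cos (pi * (2 * b / 3 + r))"
    by (simp add: cos_add sin_int_2pin cos_int_2pin)
  finally have eq: "cos (pi * (2 * real_of_int N + 2 * b / 3 + r)) = cos (pi * (2 * b / 3 + r))" .
  show ?thesis
  proof (cases "b = 0")
    case True
    have "1 / 2 \<le> cos (pi * r)"
      using assms mult_left_mono[of r "1 / 3" pi] pi_gt_zero by (intro cos_ge_half) (simp add: abs_mult)
    then show ?thesis using True eq by (simp add: schoenberg_wave_def)
  next
    case False
    then have b: "b = 1" using assms by simp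
    have "pi * (2 / 3 + r) = pi - pi * (1 / 3 - r)" by (simp add: algebra_simps)
    then have "cos (pi * (2 / 3 + r)) = - cos (pi * (1 / 3 - r))" by (metis cos_pi_minus)
    moreover have "1 / 2 \<le> cos (pi * (1 / 3 - r))"
      using assms mult_left_mono[of "1 / 3 - r" "1 / 3" pi] pi_gt_zero
      by (intro cos_ge_half) (simp add: abs_mult)
    ultimately show ?thesis using b eq by (simp add: schoenberg_wave_def)
  qed
qed

lemma summable_ternary:
  fixes b :: "nat \<Rightarrow> real"
  assumes "\<And>n. b n \<in> {0, 1}"
  shows "summable (\<lambda>n. 2 * b n / 3 ^ Suc n)"
proof (rule summable_comparison_test')
  show "summable (\<lambda>n. 2 * (1 / 3 :: real) ^ Suc n)"
    by (intro summable_mult) (simp add: summable_geometric)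
  show "norm (2 * b n / 3 ^ Suc n) \<le> 2 * (1 / 3) ^ Suc n" if "n \<ge> 0" for n
    using assms[of n] by (auto simp: power_divide)
qed

text \<open>Multiplication by 3^n turns the digits before position n into an even integer, since all
  are 0 or 2, and leaves 2 b n / 3 plus a tail. The tail is at most 2/9 + 2/27 + ... = 1/3, which is
  the width of the plateaus of the wave.\<close>

lemma schoenberg_wave_ternary:
  fixes b :: "nat \<Rightarrow> real"
  assumes b: "\<And>n. b n \<in> {0, 1}"
  shows "schoenberg_wave (3 ^ n * (\<Sum>m. 2 * b m / 3 ^ Suc m)) = b n"
proof -
  have b01: "0 \<le> b m" "b m \<le> 1" for m using b[of m] by auto
  have "\<exists>N. 3 ^ n * (\<Sum>m<n. 2 * b m / 3 ^ Suc m) = 2 * real_of_int N"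
  proof (induction n)
    case 0
    show ?case by (intro exI[of _ 0]) simp
  next
    case (Suc n)
    then obtain N where N: "3 ^ n * (\<Sum>m<n. 2 * b m / 3 ^ Suc m) = 2 * real_of_int N" ..
    have "3 ^ Suc n * (\<Sum>m<Suc n. 2 * b m / 3 ^ Suc m) = 3 * (3 ^ n * (\<Sum>m<n. 2 * b m / 3 ^ Suc m)) + 2 * b n"
      by (simp add: distrib_left)
    also have "\<dots> = 2 * real_of_int (3 * N + (if b n = 1 then 1 else 0))"
      using b[of n] N by auto
    finally show ?case ..
  qed
  then obtain N where N: "3 ^ n * (\<Sum>m<n. 2 * b m / 3 ^ Suc m) = 2 * real_of_int N" ..
  define r where "r = (\<Sum>m. 2 * b (m + Suc n) / 3 ^ Suc (Suc m))"
  have r_sum: "summable (\<lambda>m. 2 * b (m + Suc n) / 3 ^ Suc (Suc m))"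
    using summable_mult[OF summable_ternary[of "\<lambda>m. b (m + Suc n)"], of "1/3"] b by simp
  have geo: "(\<lambda>m. 2 / 9 * (1 / 3 :: real) ^ m) sums (2 / 9 * (1 / (1 - 1 / 3)))"
    by (intro sums_mult geometric_sums) simp
  have "r \<le> (\<Sum>m. 2 / 9 * (1 / 3) ^ m)"
    unfolding r_def
  proof (rule suminf_le[OF _ r_sum sums_summable[OF geo]])
    show "2 * b (m + Suc n) / 3 ^ Suc (Suc m) \<le> 2 / 9 * (1 / 3) ^ m" for m
      using b01(2)[of "m + Suc n"] by (simp add: power_divide field_simps)
  qed
  also have "\<dots> = 1 / 3" using sums_unique[OF geo] by simp
  finally have "r \<le> 1 / 3" .
  moreover have "0 \<le> r" unfolding r_def using b01(1) by (intro suminf_nonneg r_sum) simp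
  moreover have "3 ^ n * (\<Sum>m. 2 * b m / 3 ^ Suc m) = 2 * real_of_int N + 2 * b n / 3 + r"
  proof -
    have "(\<Sum>m. 2 * b m / 3 ^ Suc m) = (\<Sum>m. 2 * b (m + Suc n) / 3 ^ Suc (m + Suc n)) + (\<Sum>m<Suc n. 2 * b m / 3 ^ Suc m)"
      using b by (intro suminf_split_initial_segment summable_ternary)
    moreover have "3 ^ n * (\<Sum>m. 2 * b (m + Suc n) / 3 ^ Suc (m + Suc n)) = r"
    proof -
      have "3 ^ n * (\<Sum>m. 2 * b (m + Suc n) / 3 ^ Suc (m + Suc n)) = (\<Sum>m. 3 ^ n * (2 * b (m + Suc n) / 3 ^ Suc (m + Suc n)))"
        using summable_ignore_initial_segment[OF summable_ternary[of b, OF b], of "Suc n"] by (rule suminf_mult[symmetric])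
      also have "\<dots> = r" unfolding r_def by (intro suminf_cong) (simp add: power_add)
      finally show ?thesis .
    qed
    ultimately show ?thesis using N by (simp add: distrib_left)
  qed
  ultimately show ?thesis using schoenberg_wave_digit[OF b] by simp
qed

section \<open>Schoenberg's curve and its Borel right inverse\<close>

text \<open>For y in [0, 1) this is the digit of weight 1 / 2^(k + 1). The floors make it a Borel
  function of y and select one expansion where there are two.\<close>

definition binary_digit :: "nat \<Rightarrow> real \<Rightarrow> real" where
  "binary_digit k y = real_of_int \<lfloor>2 ^ Suc k * y\<rfloor> - 2 * real_of_int \<lfloor>2 ^ k * y\<rfloor>"

lemma binary_digit_cases: "binary_digit k y \<in> {0, 1}"
proof -
  have "\<lfloor>2 ^ Suc k * y\<rfloor> = 2 * \<lfloor>2 ^ k * y\<rfloor> \<or> \<lfloor>2 ^ Suc k * y\<rfloor> = 2 * \<lfloor>2 ^ k * y\<rfloor> + 1"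
    by (simp add: mult.assoc) linarith
  then show ?thesis by (auto simp: binary_digit_def)
qed

text \<open>The partial sums telescope to \<lfloor>2^n y\<rfloor> / 2^n, which is within 1 / 2^n of
  y. The telescope starts at \<lfloor>y\<rfloor>, which is 0 on [0, 1).\<close>

lemma binary_digit_sums:
  assumes "0 \<le> y" "y < 1"
  shows "(\<lambda>k. binary_digit k y / 2 ^ Suc k) sums y"
proof -
  have partial: "(\<Sum>k<n. binary_digit k y / 2 ^ Suc k) = real_of_int \<lfloor>2 ^ n * y\<rfloor> / 2 ^ n" for n
  proof (induction n)
    case 0
    have "\<lfloor>y\<rfloor> = 0" using assms by linarith
    then show ?case by simp
  next
    case (Suc n)
    then show ?case by (simp add: binary_digit_def field_simps)
  qed
  have "(\<lambda>n. real_of_int \<lfloor>2 ^ n * y\<rfloor> / 2 ^ n) \<longlonglongrightarrow> y"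
  proof (rule tendsto_sandwich)
    show "\<forall>\<^sub>F n in sequentially. y - (1 / 2) ^ n \<le> real_of_int \<lfloor>2 ^ n * y\<rfloor> / 2 ^ n"
    proof (rule always_eventually, rule allI)
      fix n
      have "2 ^ n * y - 1 \<le> real_of_int \<lfloor>2 ^ n * y\<rfloor>" by linarith
      then have "(2 ^ n * y - 1) / 2 ^ n \<le> real_of_int \<lfloor>2 ^ n * y\<rfloor> / 2 ^ n" by (intro divide_right_mono) auto
      then show "y - (1 / 2) ^ n \<le> real_of_int \<lfloor>2 ^ n * y\<rfloor> / 2 ^ n"
        by (simp add: diff_divide_distrib power_divide)
    qed
    show "\<forall>\<^sub>F n in sequentially. real_of_int \<lfloor>2 ^ n * y\<rfloor> / 2 ^ n \<le> y"
      by (intro always_eventually allI) (simp add: divide_le_eq mult.commute)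
    have "(\<lambda>n. y - (1 / 2 :: real) ^ n) \<longlonglongrightarrow> y - 0"
      by (intro tendsto_intros LIMSEQ_power_zero) simp
    then show "(\<lambda>n. y - (1 / 2 :: real) ^ n) \<longlonglongrightarrow> y" by simp
  qed simp
  then show ?thesis by (simp add: sums_def partial del: power_Suc)
qed

lemma binary_digit_measurable [measurable]: "binary_digit k \<in> borel_measurable borel"
  unfolding binary_digit_def[abs_def] by measurable

text \<open>\<open>s\<close> interleaves the binary digits of all coordinates as the ternary digits
  0 and 2 of one number; the pairing function reserves one ternary position for each coordinate and
  digit. The wave reads the digits off again, and each coordinate of \<gamma> is a uniformly
  convergent series of continuous functions. For \<open>s\<close>, Borel measurability is enough to
  push measures forward.\<close>

lemma space_filling_curve:
  obtains \<gamma> :: "real \<Rightarrow> 'a::euclidean_space" and s :: "'a \<Rightarrow> real"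
  where "continuous_on UNIV \<gamma>" "s \<in> borel_measurable borel" "\<And>x. 0 \<le> s x" "\<And>x. s x \<le> 1"
    "\<And>x. x \<in> box 0 One \<Longrightarrow> \<gamma> (s x) = x"
proof -
  obtain idx :: "'a \<Rightarrow> nat" where idx: "inj_on idx Basis"
    using finite_imp_inj_to_nat_seg[OF finite_Basis] by metis
  \<comment> \<open>For indices outside the range of \<open>idx\<close> this is an unspecified
    vector; the digits read from it are still 0 or 1, and \<gamma> does not look at their
    positions.\<close>
  define basis_at where "basis_at j = inv_into Basis idx j" for j
  have basis_at: "basis_at (idx i) = i" if "i \<in> Basis" for i
    unfolding basis_at_def using idx that by simp
  define b where "b n x = (case prod_decode n of (j, k) \<Rightarrow> binary_digit k (x \<bullet> basis_at j))" for n and x :: 'a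
  have b01: "b n x \<in> {0, 1}" for n x
    using binary_digit_cases by (auto simp: b_def split: prod.split)
  define s where "s x = (\<Sum>n. 2 * b n x / 3 ^ Suc n)" for x
  define \<gamma>i where "\<gamma>i i t = (\<Sum>k. schoenberg_wave (3 ^ prod_encode (idx i, k) * t) / 2 ^ Suc k)" for i t
  define \<gamma> where "\<gamma> t = (\<Sum>i\<in>Basis. \<gamma>i i t *\<^sub>R i)" for t
  have cont: "continuous_on UNIV (\<gamma>i i)" for i
  proof -
    have "uniform_limit UNIV (\<lambda>n t. \<Sum>k<n. schoenberg_wave (3 ^ prod_encode (idx i, k) * t) / 2 ^ Suc k) (\<gamma>i i) sequentially"
      unfolding \<gamma>i_def[abs_def]
    proof (rule Weierstrass_m_test)
      show "norm (schoenberg_wave (3 ^ prod_encode (idx i, k) * t) / 2 ^ Suc k) \<le> (1 / 2) ^ Suc k" for k t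
        using schoenberg_wave_bounds by (auto simp: power_divide divide_right_mono)
      show "summable (\<lambda>k. (1 / 2 :: real) ^ Suc k)" by (simp add: summable_geometric)
    qed
    moreover have "continuous_on UNIV (\<lambda>t. \<Sum>k<n. schoenberg_wave (3 ^ prod_encode (idx i, k) * t) / 2 ^ Suc k)" for n
      by (intro continuous_intros continuous_on_compose2[OF schoenberg_wave_continuous[of UNIV]]) auto
    ultimately show ?thesis
      by (intro uniform_limit_theorem[OF always_eventually]) auto
  qed
  have s_bounds: "0 \<le> s x" "s x \<le> 1" for x
  proof -
    have b: "0 \<le> b n x" "b n x \<le> 1" for n using b01[of n x] by auto
    have geo: "(\<lambda>m. 2 / 3 * (1 / 3 :: real) ^ m) sums (2 / 3 * (1 / (1 - 1 / 3)))"
      by (intro sums_mult geometric_sums) simp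
    show "0 \<le> s x" unfolding s_def using b b01 by (intro suminf_nonneg summable_ternary) auto
    have "s x \<le> (\<Sum>m. 2 / 3 * (1 / 3 :: real) ^ m)"
      unfolding s_def
    proof (rule suminf_le[OF _ summable_ternary sums_summable[OF geo]])
      show "2 * b n x / 3 ^ Suc n \<le> 2 / 3 * (1 / 3) ^ n" for n
        using b(2)[of n] by (simp add: power_divide field_simps)
    qed (use b01 in auto)
    then show "s x \<le> 1" using sums_unique[OF geo] by simp
  qed
  have "\<gamma> (s x) = x" if x: "x \<in> box 0 One" for x
  proof (rule euclidean_eqI)
    fix i :: 'a assume i: "i \<in> Basis"
    have "schoenberg_wave (3 ^ prod_encode (idx i, k) * s x) = binary_digit k (x \<bullet> i)" for k
      unfolding s_def using schoenberg_wave_ternary[of "\<lambda>n. b n x"] b01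
      by (simp add: b_def basis_at[OF i])
    then have "\<gamma>i i (s x) = (\<Sum>k. binary_digit k (x \<bullet> i) / 2 ^ Suc k)"
      by (simp add: \<gamma>i_def)
    also have "\<dots> = x \<bullet> i"
      using x i by (intro sums_unique[symmetric] binary_digit_sums) (auto simp: mem_box)
    finally show "\<gamma> (s x) \<bullet> i = x \<bullet> i"
      using i by (simp add: \<gamma>_def)
  qed
  moreover have "b n \<in> borel_measurable borel" for n
    unfolding b_def[abs_def] by (cases "prod_decode n") simp
  then have "s \<in> borel_measurable borel"
    unfolding s_def[abs_def] by measurable
  moreover have "continuous_on UNIV \<gamma>"
    unfolding \<gamma>_def[abs_def] using cont by (intro continuous_intros)
  ultimately show ?thesis using s_bounds by (intro that[of \<gamma> s])
qed

text \<open>Coordinatewise arctan scaled into (0, 1), with inverse tan. It moves the whole space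
  into the open unit box, where the right inverse of the curve is available; points near the
  boundary of the box represent infinity.\<close>

lemma unit_box_chart:
  obtains H :: "'a::euclidean_space \<Rightarrow> 'a" and G :: "'a \<Rightarrow> 'a"
  where "continuous_on UNIV H" "\<And>x. H x \<in> box 0 One" "\<And>x. G (H x) = x"
    "continuous_on (box 0 One) G" "\<And>y. y \<in> box 0 One \<Longrightarrow> H (G y) = y" "G \<in> borel_measurable borel"
proof -
  define H where "H x = (\<Sum>i\<in>Basis. (1 / 2 + arctan (x \<bullet> i) / pi) *\<^sub>R i)" for x :: 'a
  define G where "G y = (\<Sum>i\<in>Basis. tan (pi * (y \<bullet> i - 1 / 2)) *\<^sub>R i)" for y :: 'a
  have "continuous_on UNIV H"
    unfolding H_def[abs_def] by (intro continuous_intros) auto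
  moreover have "H x \<in> box 0 One" for x
  proof -
    have "0 < 1 / 2 + arctan z / pi" "1 / 2 + arctan z / pi < 1" for z
      using arctan_lbound[of z] arctan_ubound[of z] pi_gt_zero by (auto simp: field_simps)
    then show ?thesis by (auto simp: mem_box H_def)
  qed
  moreover have "G (H x) = x" for x
    by (rule euclidean_eqI) (simp add: G_def H_def tan_arctan)
  moreover have arg: "- (pi / 2) < pi * (z - 1 / 2)" "pi * (z - 1 / 2) < pi / 2" if "0 < z" "z < 1" for z :: real
    using that mult_strict_left_mono[of "- (1 / 2)" "z - 1 / 2" pi]
      mult_strict_left_mono[of "z - 1 / 2" "1 / 2" pi] by auto
  have "continuous_on (box 0 One) (\<lambda>y::'a. tan (pi * (y \<bullet> i - 1 / 2)))" if "i \<in> Basis" for i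
  proof (rule continuous_on_compose2[where g = tan and f = "\<lambda>y. pi * (y \<bullet> i - 1 / 2)"])
    show "continuous_on {z. cos z \<noteq> 0} (tan :: real \<Rightarrow> real)"
      by (rule continuous_on_tan) (auto intro: continuous_intros)
    show "(\<lambda>y. pi * ((y::'a) \<bullet> i - 1 / 2)) ` box 0 One \<subseteq> {z. cos z \<noteq> 0}"
    proof clarify
      fix y :: 'a assume "cos (pi * (y \<bullet> i - 1 / 2)) = 0" and "y \<in> box 0 One"
      then have "0 < cos (pi * (y \<bullet> i - 1 / 2))"
        using arg[of "y \<bullet> i"] that by (intro cos_gt_zero_pi) (auto simp: mem_box)
      then show False using \<open>cos (pi * (y \<bullet> i - 1 / 2)) = 0\<close> by simp
    qed
  qed (intro continuous_intros)
  then have "continuous_on (box 0 One) G"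
    unfolding G_def[abs_def] by (intro continuous_on_sum continuous_on_scaleR continuous_on_const)
  moreover have "H (G y) = y" if "y \<in> box 0 One" for y
  proof (rule euclidean_eqI)
    fix i :: 'a assume "i \<in> Basis"
    then show "H (G y) \<bullet> i = y \<bullet> i"
      using arg[of "y \<bullet> i"] that by (simp add: H_def G_def arctan_tan mem_box)
  qed
  moreover have "G \<in> borel_measurable borel"
  proof -
    have [measurable]: "(tan :: real \<Rightarrow> real) \<in> borel_measurable borel"
      unfolding tan_def[abs_def] by measurable
    show ?thesis unfolding G_def[abs_def] by measurable
  qed
  ultimately show ?thesis by (intro that[of H G])
qed

text \<open>The laws of s (H x) live on [0, 1], so they are tight and Helly's theorem gives a limit
  \<Lambda> on the line. It is carried back by G and \<gamma> from the set of t with \<gamma> t in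
  the open box; what \<Lambda> charges elsewhere is mass lost at infinity, so the limit has mass at
  most 1. Convergence is tested with the continuous function t -> F (\<gamma> t), and \<gamma> (s (H
  x)) = H x turns its integrals back into those of f.\<close>

lemma vague_compactness:
  fixes M :: "nat \<Rightarrow> 'a::euclidean_space measure"
  assumes M: "\<And>n. M n \<in> borel_probs"
  shows "\<exists>r \<sigma>. strict_mono (r :: nat \<Rightarrow> nat) \<and> sets \<sigma> = sets borel \<and> emeasure \<sigma> UNIV \<le> 1 \<and>
    (\<forall>f :: 'a \<Rightarrow> real. continuous_on UNIV f \<longrightarrow> compact (fun_support f) \<longrightarrow>
       (\<lambda>n. \<integral>x. f x \<partial>M (r n)) \<longlonglongrightarrow> (\<integral>x. f x \<partial>\<sigma>))"
proof -
  obtain \<gamma> :: "real \<Rightarrow> 'a" and s where \<gamma>: "continuous_on UNIV \<gamma>" and s[measurable]: "s \<in> borel_measurable borel"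
    and s_bounds: "\<And>x. 0 \<le> s x" "\<And>x. s x \<le> 1" and \<gamma>s: "\<And>x. x \<in> box 0 One \<Longrightarrow> \<gamma> (s x) = x"
    using space_filling_curve by blast
  obtain H G :: "'a \<Rightarrow> 'a" where H: "continuous_on UNIV H" "\<And>x. H x \<in> box 0 One" and GH: "\<And>x. G (H x) = x"
    and G: "continuous_on (box 0 One) G" and HG: "\<And>y. y \<in> box 0 One \<Longrightarrow> H (G y) = y"
    and G_meas[measurable]: "G \<in> borel_measurable borel"
    using unit_box_chart by blast
  have [measurable]: "\<gamma> \<in> borel_measurable borel" "H \<in> borel_measurable borel"
    using \<gamma> H(1) by (auto intro: borel_measurable_continuous_onI)
  have sM[measurable_cong]: "sets (M n) = sets borel" for n using borel_probsD[OF M] by simp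
  define L where "L n = distr (M n) borel (\<lambda>x. s (H x))" for n
  have L: "real_distribution (L n)" for n
  proof -
    interpret prob_space "M n" using borel_probsD[OF M] by simp
    show ?thesis unfolding L_def by (intro real_distribution_distr) measurable
  qed
  have "tight L"
    unfolding tight_def
  proof (intro conjI allI impI L)
    fix e :: real assume "0 < e"
    \<comment> \<open>\<open>tight\<close> is phrased with half-open intervals, so the left end is
      taken below 0.\<close>
    have "measure (L n) {-1<..1} = 1" for n
    proof -
      interpret prob_space "M n" using borel_probsD[OF M] by simp
      have "(\<lambda>x. s (H x)) -` {-1<..1} \<inter> space (M n) = space (M n)"
        using s_bounds less_le_trans[of "-1" "0::real", OF _ s_bounds(1)] by auto
      then show ?thesis unfolding L_def by (subst measure_distr) (auto simp: prob_space)
    qed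
    then show "\<exists>a b. a < b \<and> (\<forall>n. 1 - e < measure (L n) {a<..b})"
      using \<open>0 < e\<close> by (intro exI[of _ "-1"] exI[of _ 1]) auto
  qed
  then obtain r \<Lambda> where r: "strict_mono (r :: nat \<Rightarrow> nat)" and \<Lambda>: "real_distribution \<Lambda>"
    and wc: "weak_conv_m (L \<circ> id \<circ> r) \<Lambda>"
    using tight_imp_convergent_subsubsequence[of L id] by (auto simp: strict_mono_id)
  interpret \<Lambda>: real_distribution \<Lambda> by fact
  define A where "A = \<gamma> -` box 0 One"
  have A: "A \<in> sets \<Lambda>"
  proof -
    have "\<gamma> -` box 0 One \<inter> space \<Lambda> \<in> sets \<Lambda>" by (rule measurable_sets[of \<gamma> \<Lambda> borel]) auto
    then show ?thesis by (simp add: A_def)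
  qed
  define \<sigma> where "\<sigma> = distr (restrict_space \<Lambda> A) borel (\<lambda>t. G (\<gamma> t))"
  have meas: "(\<lambda>t. G (\<gamma> t)) \<in> restrict_space \<Lambda> A \<rightarrow>\<^sub>M borel"
    by (rule measurable_restrict_space1) measurable
  have "emeasure \<sigma> UNIV \<le> 1"
  proof -
    have "emeasure \<sigma> UNIV = emeasure \<Lambda> A"
      unfolding \<sigma>_def using A meas
      by (subst emeasure_distr) (auto simp: emeasure_restrict_space space_restrict_space)
    then show ?thesis by (simp add: \<Lambda>.emeasure_le_1)
  qed
  moreover have "(\<lambda>n. \<integral>x. f x \<partial>M (r n)) \<longlonglongrightarrow> (\<integral>x. f x \<partial>\<sigma>)"
    if f: "continuous_on UNIV f" "compact (fun_support f)" for f :: "'a \<Rightarrow> real"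
  proof -
    have [measurable]: "f \<in> borel_measurable borel" using f(1) by (rule borel_measurable_continuous_onI)
    obtain B where B: "\<And>x. \<bar>f x\<bar> \<le> B"
      using continuous_compact_support_bounded[of f "fun_support f"] f eq_0_outside_fun_support[of _ f] by auto
    \<comment> \<open>This is f read in the chart. H maps its support to a compact subset of the
      open box, so the extension by 0 is continuous on the whole space.\<close>
    define F where "F y = (if y \<in> box 0 One then f (G y) else 0)" for y
    have F_out: "F y = 0" if "y \<notin> H ` fun_support f" for y
    proof (cases "y \<in> box 0 One")
      case True
      then have "G y \<notin> fun_support f" using that HG by (metis imageI)
      then show ?thesis by (simp add: F_def eq_0_outside_fun_support)
    qed (simp add: F_def)
    have "compact (H ` fun_support f)"
      using f(2) H(1) by (meson compact_continuous_image continuous_on_subset subset_UNIV)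
    then have "open (- H ` fun_support f)" by (simp add: compact_imp_closed open_Compl)
    moreover have "continuous_on (- H ` fun_support f) F"
      using F_out by (subst continuous_on_cong[OF refl, of _ _ "\<lambda>_. 0"]) auto
    moreover have "continuous_on (box 0 One) F"
    proof -
      have "continuous_on (box 0 One) (\<lambda>y. f (G y))"
        using f(1) G by (rule continuous_on_compose2) auto
      then show ?thesis by (subst continuous_on_cong[OF refl, of _ _ "\<lambda>y. f (G y)"]) (auto simp: F_def)
    qed
    ultimately have "continuous_on (box 0 One \<union> - H ` fun_support f) F"
      by (intro continuous_on_open_Un) auto
    moreover have "box 0 One \<union> - H ` fun_support f = UNIV" using H(2) by auto
    ultimately have F: "continuous_on UNIV F" by simp
    then have [measurable]: "F \<in> borel_measurable borel" by (rule borel_measurable_continuous_onI)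
    have F\<gamma>: "continuous_on UNIV (\<lambda>t. F (\<gamma> t))"
      using F \<gamma> by (rule continuous_on_compose2) auto
    have "(\<lambda>n. integral\<^sup>L ((L \<circ> id \<circ> r) n) (\<lambda>t. F (\<gamma> t))) \<longlonglongrightarrow> integral\<^sup>L \<Lambda> (\<lambda>t. F (\<gamma> t))"
    proof (rule weak_conv_imp_integral_bdd_continuous_conv[OF _ \<Lambda> wc, where B = B])
      show "real_distribution ((L \<circ> id \<circ> r) n)" for n using L by simp
      show "isCont (\<lambda>t. F (\<gamma> t)) t" for t using F\<gamma> by (simp add: continuous_on_eq_continuous_at)
      have "0 \<le> B" using B[of 0] by simp
      then show "norm (F (\<gamma> t)) \<le> B" for t using B by (simp add: F_def)
    qed
    moreover have "integral\<^sup>L ((L \<circ> id \<circ> r) n) (\<lambda>t. F (\<gamma> t)) = (\<integral>x. f x \<partial>M (r n))" for n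
    proof -
      have "integral\<^sup>L (L (r n)) (\<lambda>t. F (\<gamma> t)) = (\<integral>x. F (\<gamma> (s (H x))) \<partial>M (r n))"
        unfolding L_def by (rule integral_distr) measurable
      then show ?thesis using H(2) GH by (simp add: \<gamma>s F_def)
    qed
    moreover have "integral\<^sup>L \<Lambda> (\<lambda>t. F (\<gamma> t)) = (\<integral>x. f x \<partial>\<sigma>)"
    proof -
      have "(\<integral>x. f x \<partial>\<sigma>) = (\<integral>t. f (G (\<gamma> t)) \<partial>restrict_space \<Lambda> A)"
        unfolding \<sigma>_def using meas by (rule integral_distr) measurable
      also have "\<dots> = (\<integral>t. indicator A t *\<^sub>R f (G (\<gamma> t)) \<partial>\<Lambda>)"
        using A by (intro integral_restrict_space) auto
      also have "\<dots> = integral\<^sup>L \<Lambda> (\<lambda>t. F (\<gamma> t))"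
        by (intro Bochner_Integration.integral_cong refl) (auto simp: F_def A_def)
      finally show ?thesis ..
    qed
    ultimately show ?thesis by simp
  qed
  moreover have "sets \<sigma> = sets borel" by (simp add: \<sigma>_def)
  ultimately show ?thesis using r by blast
qed


section \<open>Integration against kernels and disintegrations\<close>

text \<open>The Bochner integral has the default value 0 where \<open>F t\<close> is not integrable.
  Positive and negative parts give measurable functions of t, and the case distinction on the
  finiteness of the integral of |F t x| is itself measurable.\<close>

lemma integral_kernel_measurable:
  fixes F :: "'t \<Rightarrow> 'b \<Rightarrow> real"
  assumes K: "K \<in> X \<rightarrow>\<^sub>M subprob_algebra B" and F: "(\<lambda>(t, x). F t x) \<in> borel_measurable (X \<Otimes>\<^sub>M B)"
  shows "(\<lambda>t. \<integral>x. F t x \<partial>K t) \<in> borel_measurable X"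
proof -
  have [measurable]: "(\<lambda>p. F (fst p) (snd p)) \<in> borel_measurable (X \<Otimes>\<^sub>M B)"
    using F by (simp add: split_def)
  have nn: "(\<lambda>t. \<integral>\<^sup>+x. ennreal (g (F t x)) \<partial>K t) \<in> borel_measurable X"
    if [measurable]: "g \<in> borel_measurable borel" for g :: "real \<Rightarrow> real"
  proof -
    have "(\<lambda>(t, x). ennreal (g (F t x))) \<in> borel_measurable (X \<Otimes>\<^sub>M B)"
      unfolding split_def by measurable
    from nn_integral_measurable_subprob_algebra2[OF this K] show ?thesis .
  qed
  define a b c where "a t = (\<integral>\<^sup>+x. ennreal (F t x) \<partial>K t)"
    and "b t = (\<integral>\<^sup>+x. ennreal (- F t x) \<partial>K t)" and "c t = (\<integral>\<^sup>+x. ennreal \<bar>F t x\<bar> \<partial>K t)" for t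
  have [measurable]: "a \<in> borel_measurable X" "b \<in> borel_measurable X" "c \<in> borel_measurable X"
    using nn[of "\<lambda>y. y"] nn[of uminus] nn[of abs] by (simp_all add: a_def[abs_def] b_def[abs_def] c_def[abs_def])
  have "(\<lambda>t. if c t < \<infinity> then enn2real (a t) - enn2real (b t) else 0) \<in> borel_measurable X"
    by measurable
  then show ?thesis
  proof (rule measurable_cong[THEN iffD1, rotated])
    fix t assume t: "t \<in> space X"
    have "F t \<in> borel_measurable B"
      using measurable_compose[OF measurable_Pair1'[OF t] F] by simp
    then have "F t \<in> borel_measurable (K t)"
      using sets_kernel[OF K t] by (simp cong: measurable_cong_sets)
    then have "integrable (K t) (F t) \<longleftrightarrow> c t < \<infinity>"
      by (simp add: integrable_iff_bounded c_def)
    then show "(if c t < \<infinity> then enn2real (a t) - enn2real (b t) else 0) = (\<integral>x. F t x \<partial>K t)"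
      by (simp add: a_def b_def real_lebesgue_integral_def not_integrable_integral_eq)
  qed
qed

text \<open>Positive and negative parts are treated by the formula for nonnegative functions.
  \<open>fin\<close> makes both iterated integrals finite, so that they may be subtracted, and makes
  the inner integral converge for almost every x.\<close>

lemma integral_bind_kernel:
  fixes f :: "'b \<Rightarrow> real"
  assumes K: "K \<in> M \<rightarrow>\<^sub>M subprob_algebra B" and f: "f \<in> borel_measurable B"
    and ne: "space M \<noteq> {}"
    and fin: "(\<integral>\<^sup>+x. (\<integral>\<^sup>+y. ennreal \<bar>f y\<bar> \<partial>K x) \<partial>M) < \<infinity>"
  shows "(\<integral>y. f y \<partial>(M \<bind> K)) = (\<integral>x. (\<integral>y. f y \<partial>K x) \<partial>M)"
proof -
  note [measurable] = f
  have sK: "sets (K x) = sets B" if "x \<in> space M" for x using sets_kernel[OF K that] .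
  have fK: "f \<in> borel_measurable (K x)" if "x \<in> space M" for x
    using f sK[OF that] by (simp cong: measurable_cong_sets)
  have sb: "sets (M \<bind> K) = sets B" by (rule sets_bind[OF sK ne])
  have fb: "f \<in> borel_measurable (M \<bind> K)"
    using f sb by (simp cong: measurable_cong_sets)
  have meas: "(\<lambda>x. \<integral>\<^sup>+y. g y \<partial>K x) \<in> borel_measurable M" if "g \<in> borel_measurable B" for g
    using measurable_compose[OF K nn_integral_measurable_subprob_algebra[OF that]] .
  define a where "a x = (\<integral>\<^sup>+y. ennreal (f y) \<partial>K x)" for x
  define b where "b x = (\<integral>\<^sup>+y. ennreal (- f y) \<partial>K x)" for x
  define c where "c x = (\<integral>\<^sup>+y. ennreal \<bar>f y\<bar> \<partial>K x)" for x
  have [measurable]: "a \<in> borel_measurable M" "b \<in> borel_measurable M" "c \<in> borel_measurable M"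
    unfolding a_def[abs_def] b_def[abs_def] c_def[abs_def] by (auto intro!: meas)
  have ac: "a x \<le> c x" "b x \<le> c x" for x
    unfolding a_def b_def c_def by (auto intro!: nn_integral_mono ennreal_leI)
  have cint: "(\<integral>\<^sup>+x. c x \<partial>M) < \<infinity>"
    using fin by (simp add: c_def)
  then have c_fin: "AE x in M. c x < \<infinity>"
    using nn_integral_PInf_AE[of c M] by (auto simp: less_top)
  have intK: "integrable (K x) f" if "x \<in> space M" "c x < \<infinity>" for x
    using that fK by (intro integrableI_bounded) (auto simp: c_def)
  have "(\<integral>\<^sup>+y. ennreal (norm (f y)) \<partial>(M \<bind> K)) = (\<integral>\<^sup>+x. c x \<partial>M)"
    unfolding c_def real_norm_def by (rule nn_integral_bind[OF _ K]) simp
  then have int: "integrable (M \<bind> K) f"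
    using cint fb by (intro integrableI_bounded) auto
  have ab_fin: "(\<integral>\<^sup>+x. a x \<partial>M) < \<infinity>" "(\<integral>\<^sup>+x. b x \<partial>M) < \<infinity>"
    using cint nn_integral_mono[of M a c] nn_integral_mono[of M b c] ac
    by (auto intro: le_less_trans)
  have e2r: "integrable M (\<lambda>x. enn2real (g x)) \<and> (\<integral>x. enn2real (g x) \<partial>M) = enn2real (\<integral>\<^sup>+x. g x \<partial>M)"
    if [measurable]: "g \<in> borel_measurable M" and g: "(\<integral>\<^sup>+x. g x \<partial>M) < \<infinity>" for g
  proof -
    have "AE x in M. g x < \<infinity>"
      using nn_integral_PInf_AE[of g M] g by (auto simp: less_top)
    then have eq: "(\<integral>\<^sup>+x. ennreal (enn2real (g x)) \<partial>M) = (\<integral>\<^sup>+x. g x \<partial>M)"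
      by (intro nn_integral_cong_AE) (auto elim!: eventually_mono simp: less_top)
    then have "integrable M (\<lambda>x. enn2real (g x))"
      using g by (intro integrableI_bounded) auto
    moreover have "(\<integral>x. enn2real (g x) \<partial>M) = enn2real (\<integral>\<^sup>+x. g x \<partial>M)"
      using eq by (subst integral_eq_nn_integral) auto
    ultimately show ?thesis ..
  qed
  have "(\<integral>y. f y \<partial>(M \<bind> K)) = enn2real (\<integral>\<^sup>+x. a x \<partial>M) - enn2real (\<integral>\<^sup>+x. b x \<partial>M)"
    unfolding real_lebesgue_integral_def[OF int] a_def b_def
    by (subst (1 2) nn_integral_bind[OF _ K]) auto
  also have "\<dots> = (\<integral>x. enn2real (a x) - enn2real (b x) \<partial>M)"
    using e2r[of a] e2r[of b] ab_fin by (subst Bochner_Integration.integral_diff) auto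
  also have "\<dots> = (\<integral>x. (\<integral>y. f y \<partial>K x) \<partial>M)"
  proof (rule integral_cong_AE)
    show "(\<lambda>x. enn2real (a x) - enn2real (b x)) \<in> borel_measurable M" by measurable
    show "(\<lambda>x. \<integral>y. f y \<partial>K x) \<in> borel_measurable M"
      by (rule integral_kernel_measurable[OF K]) (simp add: split_def)
    show "AE x in M. enn2real (a x) - enn2real (b x) = (\<integral>y. f y \<partial>K x)"
      using AE_space c_fin by eventually_elim (simp add: intK real_lebesgue_integral_def a_def b_def)
  qed
  finally show "(\<integral>y. f y \<partial>(M \<bind> K)) = (\<integral>x. (\<integral>y. f y \<partial>K x) \<partial>M)" .
qed

text \<open>\<open>disintegration\<close> tests bounded Borel functions, whereas the flux integrand
  is unbounded in v. Indicators already identify \<open>M\<close> as the mixture over m of the fibre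
  measures placed at x, and in this form unbounded integrands are accessible.\<close>

lemma disintegration_eq_bind:
  fixes M :: "('a::euclidean_space \<times> 'a) measure"
  assumes M: "M \<in> borel_probs" and m: "m \<in> borel_probs" and d: "disintegration M m \<nu>"
  shows "M = m \<bind> (\<lambda>x. distr (\<nu> x) borel (Pair x))"
    and "(\<lambda>x. distr (\<nu> x) borel (Pair x)) \<in> m \<rightarrow>\<^sub>M subprob_algebra borel"
    and "\<And>x. sets (\<nu> x) = sets borel" "\<And>x. prob_space (\<nu> x)"
proof -
  interpret m: prob_space m using borel_probsD[OF m] by simp
  interpret M: prob_space M using borel_probsD[OF M] by simp
  have \<nu>: "\<nu> \<in> borel \<rightarrow>\<^sub>M prob_algebra borel" using d by (simp add: disintegration_def)
  have [measurable_cong]: "sets m = sets borel" using borel_probsD[OF m] by simp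
  show s\<nu>: "sets (\<nu> x) = sets borel" and p\<nu>: "prob_space (\<nu> x)" for x
    using measurable_space[OF \<nu>, of x] by (auto simp: space_prob_algebra)
  let ?K = "\<lambda>x. distr (\<nu> x) borel (Pair x)"
  have "(\<lambda>(x, v). Pair x v) \<in> borel \<Otimes>\<^sub>M borel \<rightarrow>\<^sub>M (borel :: ('a \<times> 'a) measure)"
    by (simp add: borel_prod[symmetric])
  then have K: "?K \<in> borel \<rightarrow>\<^sub>M subprob_algebra borel"
    by (rule measurable_distr2) (rule measurable_prob_algebraD[OF \<nu>])
  then show Km: "?K \<in> m \<rightarrow>\<^sub>M subprob_algebra borel"
    by (simp cong: measurable_cong_sets)
  show "M = m \<bind> ?K"
  proof (rule measure_eqI)
    show "sets M = sets (m \<bind> ?K)"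
      using borel_probsD[OF M] m.not_empty by simp
    fix A assume "A \<in> sets M"
    then have A[measurable]: "A \<in> sets borel" using borel_probsD[OF M] by simp
    have [measurable]: "Pair x \<in> \<nu> x \<rightarrow>\<^sub>M borel" for x
      using s\<nu>[of x] by (simp cong: measurable_cong_sets add: borel_prod[symmetric])
    have Kp: "prob_space (?K x)" for x
      by (intro prob_space.prob_space_distr p\<nu>) measurable
    have Kx: "(\<integral>v. indicator A (x, v) \<partial>\<nu> x) = measure (?K x) A" for x
    proof -
      have "measure (?K x) A = measure (\<nu> x) (Pair x -` A \<inter> space (\<nu> x))"
        by (rule measure_distr) auto
      also have "\<dots> = (\<integral>v. indicator (Pair x -` A \<inter> space (\<nu> x)) v \<partial>\<nu> x)"
        by simp
      also have "\<dots> = (\<integral>v. indicator A (x, v) \<partial>\<nu> x)"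
        by (intro Bochner_Integration.integral_cong refl) (auto simp: indicator_def)
      finally show ?thesis ..
    qed
    have [measurable]: "(\<lambda>x. measure (?K x) A) \<in> borel_measurable m"
      using measurable_compose[OF Km measurable_measure_subprob_algebra[OF A]] .
    have "emeasure (m \<bind> ?K) A = (\<integral>\<^sup>+x. emeasure (?K x) A \<partial>m)"
      by (rule emeasure_bind[OF m.not_empty Km A])
    also have "\<dots> = (\<integral>\<^sup>+x. ennreal (measure (?K x) A) \<partial>m)"
      using Kp by (simp add: finite_measure.emeasure_eq_measure prob_space_def)
    also have "\<dots> = ennreal (\<integral>x. measure (?K x) A \<partial>m)"
      using prob_space.prob_le_1[OF Kp] by (intro nn_integral_eq_integral m.integrable_const_bound[of _ 1]) auto
    also have "(\<integral>x. measure (?K x) A \<partial>m) = (\<integral>x. (\<integral>v. indicator A (x, v) \<partial>\<nu> x) \<partial>m)"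
      by (simp only: Kx)
    also have "\<dots> = (\<integral>z. indicator A z \<partial>M)"
    proof -
      have "bounded (range (indicator A :: _ \<Rightarrow> real))"
        by (auto simp: bounded_iff intro!: exI[of _ 1] split: split_indicator)
      moreover have "\<forall>g \<in> borel_measurable borel. bounded (range g) \<longrightarrow>
          (\<integral>z. g z \<partial>M) = (\<integral>x. (\<integral>v. (g (x, v) :: real) \<partial>\<nu> x) \<partial>m)"
        using d unfolding disintegration_def by blast
      moreover have "indicator A \<in> borel_measurable borel" by simp
      ultimately show ?thesis by metis
    qed
    also have "ennreal \<dots> = emeasure M A"
      using \<open>A \<in> sets M\<close> by (simp add: M.emeasure_eq_measure)
    finally show "emeasure M A = emeasure (m \<bind> ?K) A" ..
  qed
qed

lemma disintegration_nn_integral: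
  fixes M :: "('a::euclidean_space \<times> 'a) measure"
  assumes M: "M \<in> borel_probs" and m: "m \<in> borel_probs" and d: "disintegration M m \<nu>"
    and g: "g \<in> borel_measurable borel"
  shows "(\<integral>\<^sup>+z. g z \<partial>M) = (\<integral>\<^sup>+x. (\<integral>\<^sup>+v. g (x, v) \<partial>\<nu> x) \<partial>m)"
proof -
  note b = disintegration_eq_bind[OF M m d]
  have "(\<integral>\<^sup>+z. g z \<partial>distr (\<nu> x) borel (Pair x)) = (\<integral>\<^sup>+v. g (x, v) \<partial>\<nu> x)" for x
  proof (rule nn_integral_distr)
    show "Pair x \<in> \<nu> x \<rightarrow>\<^sub>M borel"
      using b(3)[of x] by (simp cong: measurable_cong_sets add: borel_prod[symmetric])
  qed (use g in simp)
  moreover have "(\<integral>\<^sup>+z. g z \<partial>M) = (\<integral>\<^sup>+x. (\<integral>\<^sup>+z. g z \<partial>distr (\<nu> x) borel (Pair x)) \<partial>m)"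
    by (subst b(1)) (rule nn_integral_bind[OF g b(2)])
  ultimately show ?thesis by simp
qed

lemma disintegration_integral:
  fixes M :: "('a::euclidean_space \<times> 'a) measure" and g :: "'a \<times> 'a \<Rightarrow> real"
  assumes M: "M \<in> borel_probs" and m: "m \<in> borel_probs" and d: "disintegration M m \<nu>"
    and g: "g \<in> borel_measurable borel" and int: "integrable M g"
  shows "(\<integral>z. g z \<partial>M) = (\<integral>x. (\<integral>v. g (x, v) \<partial>\<nu> x) \<partial>m)"
proof -
  note b = disintegration_eq_bind[OF M m d]
  have [measurable]: "Pair x \<in> \<nu> x \<rightarrow>\<^sub>M borel" for x
    using b(3)[of x] by (simp cong: measurable_cong_sets add: borel_prod[symmetric])
  have "(\<integral>\<^sup>+x. (\<integral>\<^sup>+z. ennreal \<bar>g z\<bar> \<partial>distr (\<nu> x) borel (Pair x)) \<partial>m) = (\<integral>\<^sup>+z. ennreal \<bar>g z\<bar> \<partial>M)"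
    using g by (subst b(1)) (rule nn_integral_bind[OF _ b(2), symmetric], simp)
  also have "\<dots> < \<infinity>" using int by (simp add: integrable_iff_bounded)
  finally have fin: "(\<integral>\<^sup>+x. (\<integral>\<^sup>+z. ennreal \<bar>g z\<bar> \<partial>distr (\<nu> x) borel (Pair x)) \<partial>m) < \<infinity>" .
  have "(\<integral>z. g z \<partial>M) = (\<integral>x. (\<integral>z. g z \<partial>distr (\<nu> x) borel (Pair x)) \<partial>m)"
    using borel_probsD(3)[OF m]
    by (subst b(1)) (rule integral_bind_kernel[OF b(2) g _ fin], simp)
  moreover have "(\<integral>z. g z \<partial>distr (\<nu> x) borel (Pair x)) = (\<integral>v. g (x, v) \<partial>\<nu> x)" for x
    using g by (intro integral_distr) measurable
  ultimately show ?thesis by simp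
qed


section \<open>Equality almost everywhere on a time interval\<close>

text \<open>Lebesgue measure is complete, so g is measurable because it agrees almost everywhere
  with f. This makes the flux of V (\<mu> t) integrable in t although \<open>V\<close> has no
  regularity in its argument.\<close>

lemma integrable_lebesgue_on_AE_cong:
  fixes f g :: "real \<Rightarrow> real"
  assumes f: "integrable (lebesgue_on S) f" and S: "S \<in> sets lebesgue"
    and eq: "AE x in lebesgue_on S. g x = f x"
  shows "integrable (lebesgue_on S) g"
proof -
  obtain N where N: "N \<in> null_sets (lebesgue_on S)" "{x \<in> space (lebesgue_on S). g x \<noteq> f x} \<subseteq> N"
    using eq unfolding eventually_ae_filter by auto
  have neg: "negligible N"
    using N(1) S by (subst (asm) null_sets_restrict_space) (auto simp: negligible_iff_null_sets)
  have ai: "f absolutely_integrable_on S"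
    using f S by (simp add: set_integrable_def integrable_restrict_space)
  have "g x = f x" if "x \<in> S - N" for x using that N(2) by auto
  with ai neg have "g absolutely_integrable_on S"
    by (rule absolutely_integrable_spike)
  then show ?thesis using S by (rule absolutely_integrable_imp_integrable)
qed

text \<open>Links the Borel sets of times in \<open>ce_solution\<close> with the completed
  sigma-algebra used for integrals in time; extension by 0 reduces it to completion on the whole
  line.\<close>

lemma borel_measurable_lebesgue_onI:
  fixes f :: "real \<Rightarrow> real"
  assumes f: "f \<in> borel_measurable (restrict_space borel S)" and S: "S \<in> sets borel"
  shows "f \<in> borel_measurable (lebesgue_on S)"
proof -
  have "(\<lambda>x. f x * indicator S x) \<in> borel_measurable borel"
    using f S by (subst (asm) borel_measurable_restrict_space_iff) (auto simp: mult.commute)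
  then have "(\<lambda>x. f x * indicator S x) \<in> borel_measurable lborel" by simp
  then have "(\<lambda>x. f x * indicator S x) \<in> borel_measurable lebesgue"
    by (rule measurable_completion)
  then show ?thesis using S by (subst borel_measurable_restrict_space_iff) (auto simp: mult.commute)
qed

lemma continuous_AE_eq_imp_eq:
  fixes f g :: "real \<Rightarrow> real"
  assumes "a < b" and f: "continuous_on {a..b} f" and g: "continuous_on {a..b} g"
    and eq: "AE t in lebesgue_on {a..b}. f t = g t" and t: "t \<in> {a..b}"
  shows "f t = g t"
proof -
  have c: "continuous_on {a..b} (\<lambda>t. \<bar>f t - g t\<bar>)" using f g by (intro continuous_intros)
  have "integral {a..b} (\<lambda>t. \<bar>f t - g t\<bar>) = integral\<^sup>L (lebesgue_on {a..b}) (\<lambda>t. \<bar>f t - g t\<bar>)"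
    using integrable_lebesgue_on_continuous[OF c] by (intro lebesgue_integral_eq_integral[symmetric]) auto
  also have "\<dots> = integral\<^sup>L (lebesgue_on {a..b}) (\<lambda>t. 0)"
    using integrable_lebesgue_on_continuous[OF c] eq by (intro integral_cong_AE) auto
  finally have "integral {a..b} (\<lambda>t. \<bar>f t - g t\<bar>) = 0" by simp
  then have "\<forall>t\<in>{a..b}. \<bar>f t - g t\<bar> = 0"
    by (subst (asm) integral_eq_0_iff) (use c \<open>a < b\<close> in auto)
  then show ?thesis using t by auto
qed

section \<open>The two notions of solution\<close>

text \<open>\<open>speed_measurable\<close> accompanies \<open>speed_finite\<close> because
  \<open>V\<close> is an arbitrary map: the extended integral of a nonmeasurable function is a lower
  integral, from which finite moments at almost every time could not be inferred.\<close>

locale mde_setting =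
  fixes T :: real
    and V :: "'a::euclidean_space measure \<Rightarrow> ('a \<times> 'a) measure"
    and \<mu> :: "real \<Rightarrow> 'a measure"
    and \<nu> :: "'a measure \<Rightarrow> 'a \<Rightarrow> 'a measure"
    and w :: "'a measure \<Rightarrow> 'a \<Rightarrow> 'a"
  assumes T_pos: "0 < T"
    and pvf: "probability_vector_field V"
    and \<mu>_prob: "\<forall>t\<in>{0..T}. \<mu> t \<in> borel_probs"
    and speed_measurable: "(\<lambda>t. \<integral>\<^sup>+(x, v). ennreal (norm v) \<partial>V (\<mu> t)) \<in> borel_measurable (lebesgue_on {0..T})"
    and speed_finite: "(\<integral>\<^sup>+t. (\<integral>\<^sup>+(x, v). ennreal (norm v) \<partial>V (\<mu> t)) \<partial>lebesgue_on {0..T}) < \<infinity>"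
    and disint: "\<forall>m\<in>borel_probs. disintegration (V m) m (\<nu> m)"
    and bary: "barycentric_field \<nu> w"
begin

section \<open>The barycentric field and the flux\<close>

abbreviation moment :: "'a measure \<Rightarrow> ennreal" where
  "moment m \<equiv> \<integral>\<^sup>+(x, v). ennreal (norm v) \<partial>V m"

lemma V_prob: "m \<in> borel_probs \<Longrightarrow> V m \<in> borel_probs"
  using pvf by (simp add: probability_vector_field_def)

lemma w_measurable: "(\<lambda>(x, m). w m x) \<in> borel_measurable (borel \<Otimes>\<^sub>M prob_algebra borel)"
  using bary by (simp add: barycentric_field_def)

lemma w_measurable1:
  assumes "m \<in> borel_probs" shows "w m \<in> borel_measurable borel"
proof -
  have "(\<lambda>x. (x, m)) \<in> borel \<rightarrow>\<^sub>M borel \<Otimes>\<^sub>M prob_algebra borel"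
    using assms by measurable
  from measurable_compose[OF this w_measurable] show ?thesis by simp
qed

text \<open>A finite moment of \<open>V m\<close> forces almost every fibre measure to have a finite
  first moment, so the barycentre exists there and the conditional clause of
  \<open>barycentric_field\<close> applies.\<close>

lemma AE_barycenter:
  assumes m: "m \<in> borel_probs" and fin: "moment m < \<infinity>"
  shows "AE x in m. integrable (\<nu> m x) (\<lambda>v. v) \<and> w m x = (\<integral>v. v \<partial>\<nu> m x)"
proof -
  note d = disint[rule_format, OF m] V_prob[OF m]
  note b = disintegration_eq_bind[OF d(2) m d(1)]
  have "(\<lambda>(x, v). ennreal (norm v)) \<in> borel_measurable (borel :: ('a \<times> 'a) measure)"
    by (simp add: borel_prod[symmetric])
  from disintegration_nn_integral[OF d(2) m d(1) this]
  have eq: "moment m = (\<integral>\<^sup>+x. (\<integral>\<^sup>+v. ennreal (norm v) \<partial>\<nu> m x) \<partial>m)" by simp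
  have \<nu>: "\<nu> m \<in> borel \<rightarrow>\<^sub>M prob_algebra borel" using d(1) by (simp add: disintegration_def)
  have "(\<lambda>x. \<integral>\<^sup>+v. ennreal (norm v) \<partial>\<nu> m x) \<in> borel_measurable borel"
    by (rule measurable_compose[OF measurable_prob_algebraD[OF \<nu>]]) (simp add: nn_integral_measurable_subprob_algebra)
  then have "(\<lambda>x. \<integral>\<^sup>+v. ennreal (norm v) \<partial>\<nu> m x) \<in> borel_measurable m"
    using borel_probsD(2)[OF m] by (simp cong: measurable_cong_sets)
  then have "AE x in m. (\<integral>\<^sup>+v. ennreal (norm v) \<partial>\<nu> m x) \<noteq> \<infinity>"
    using fin eq by (intro nn_integral_PInf_AE) auto
  moreover have "AE x in m. integrable (\<nu> m x) (\<lambda>v. v) \<longrightarrow> w m x = (\<integral>v. v \<partial>\<nu> m x)"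
    using bary m by (simp add: barycentric_field_def)
  ultimately show ?thesis
  proof eventually_elim
    case (elim x)
    have "(\<lambda>v. v) \<in> borel_measurable (\<nu> m x)"
      using b(3)[of x] by (simp cong: measurable_cong_sets)
    then have "integrable (\<nu> m x) (\<lambda>v. v)"
      using elim(1) by (intro integrableI_bounded) (auto simp: less_top)
    then show ?case using elim(2) by simp
  qed
qed

text \<open>Jensen's inequality on each fibre; for an infinite moment there is nothing to
  prove.\<close>

lemma nn_integral_norm_w_le:
  assumes m: "m \<in> borel_probs"
  shows "(\<integral>\<^sup>+x. ennreal (norm (w m x)) \<partial>m) \<le> moment m"
proof (cases "moment m < \<infinity>")
  case True
  note d = disint[rule_format, OF m] V_prob[OF m]
  have "(\<lambda>(x, v). ennreal (norm v)) \<in> borel_measurable (borel :: ('a \<times> 'a) measure)"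
    by (simp add: borel_prod[symmetric])
  from disintegration_nn_integral[OF d(2) m d(1) this]
  have eq: "moment m = (\<integral>\<^sup>+x. (\<integral>\<^sup>+v. ennreal (norm v) \<partial>\<nu> m x) \<partial>m)" by simp
  have "AE x in m. ennreal (norm (w m x)) \<le> (\<integral>\<^sup>+v. ennreal (norm v) \<partial>\<nu> m x)"
    using AE_barycenter[OF m True]
  proof eventually_elim
    case (elim x)
    have "norm (w m x) \<le> (\<integral>v. norm v \<partial>\<nu> m x)"
      using elim integral_norm_bound[of "\<nu> m x" "\<lambda>v. v"] by simp
    then have "ennreal (norm (w m x)) \<le> ennreal (\<integral>v. norm v \<partial>\<nu> m x)" by (rule ennreal_leI)
    also have "\<dots> = (\<integral>\<^sup>+v. ennreal (norm v) \<partial>\<nu> m x)"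
      using elim by (intro nn_integral_eq_integral[symmetric]) auto
    finally show ?case .
  qed
  then show ?thesis unfolding eq by (rule nn_integral_mono_AE)
qed (simp add: less_top[symmetric])

text \<open>The inner product of \<phi> x with v is dominated by B |v|, so the disintegration
  formula extends to it. In the fibre over x the constant vector \<phi> x leaves the integral, and
  the barycentre \<open>w m x\<close> remains.\<close>

lemma flux_eq:
  fixes \<phi> :: "'a \<Rightarrow> 'a"
  assumes m: "m \<in> borel_probs" and fin: "moment m < \<infinity>"
    and \<phi>: "\<phi> \<in> borel_measurable borel" "\<And>x. norm (\<phi> x) \<le> B"
  shows "integrable (V m) (\<lambda>(x, v). \<phi> x \<bullet> v)"
    and "(\<integral>(x, v). \<phi> x \<bullet> v \<partial>V m) = (\<integral>x. \<phi> x \<bullet> w m x \<partial>m)"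
    and "\<bar>\<integral>x. \<phi> x \<bullet> w m x \<partial>m\<bar> \<le> B * enn2real (moment m)"
proof -
  note d = disint[rule_format, OF m] V_prob[OF m]
  note [measurable] = \<phi>(1) w_measurable1[OF m]
  have B: "0 \<le> B" using \<phi>(2)[of 0] norm_ge_zero order_trans by blast
  have sV[measurable_cong]: "sets (V m) = sets borel" and sm[measurable_cong]: "sets m = sets borel"
    using borel_probsD d(2) m by auto
  have meas: "(\<lambda>(x, v). \<phi> x \<bullet> v) \<in> borel_measurable borel"
    by (simp add: borel_prod[symmetric] split_def)
  have bound: "\<bar>\<phi> x \<bullet> v\<bar> \<le> B * norm v" for x v
    using Cauchy_Schwarz_ineq2[of "\<phi> x" v] \<phi>(2)[of x] by (meson mult_right_mono norm_ge_zero order_trans)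
  have "integrable (V m) (\<lambda>(x, v). norm v)"
  proof (rule integrableI_bounded)
    have "(\<lambda>z :: 'a \<times> 'a. norm (snd z)) \<in> borel_measurable borel"
      by (intro borel_measurable_continuous_onI continuous_intros)
    then show "(\<lambda>(x, v). norm v) \<in> borel_measurable (V m)"
      by (simp add: split_def cong: measurable_cong_sets[OF sV refl])
    show "(\<integral>\<^sup>+z. ennreal (norm (case z of (x, v) \<Rightarrow> norm v)) \<partial>V m) < \<infinity>"
      using fin by (simp add: split_def)
  qed
  then have "integrable (V m) (\<lambda>z. B * (case z of (x, v) \<Rightarrow> norm v))"
    by (rule integrable_mult_right)
  then show int: "integrable (V m) (\<lambda>(x, v). \<phi> x \<bullet> v)"
  proof (rule Bochner_Integration.integrable_bound)
    show "(\<lambda>(x, v). \<phi> x \<bullet> v) \<in> borel_measurable (V m)"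
      using meas by (simp cong: measurable_cong_sets[OF sV refl])
    show "AE z in V m. norm (case z of (x, v) \<Rightarrow> \<phi> x \<bullet> v) \<le> norm (B * (case z of (x, v) \<Rightarrow> norm v))"
      using bound B by (intro AE_I2) (auto simp: split_def abs_mult)
  qed
  have nn: "(\<integral>\<^sup>+x. ennreal (norm (\<phi> x \<bullet> w m x)) \<partial>m) \<le> ennreal B * moment m"
  proof -
    have "(\<integral>\<^sup>+x. ennreal (norm (\<phi> x \<bullet> w m x)) \<partial>m) \<le> (\<integral>\<^sup>+x. ennreal B * ennreal (norm (w m x)) \<partial>m)"
      using bound B by (intro nn_integral_mono) (simp add: ennreal_mult[symmetric])
    also have "\<dots> = ennreal B * (\<integral>\<^sup>+x. ennreal (norm (w m x)) \<partial>m)"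
      by (rule nn_integral_cmult) measurable
    also have "\<dots> \<le> ennreal B * moment m"
      by (intro mult_left_mono nn_integral_norm_w_le m) simp
    finally show ?thesis .
  qed
  have fin': "ennreal B * moment m < \<infinity>"
    using fin by (simp add: ennreal_mult_less_top)
  have meas': "(\<lambda>x. \<phi> x \<bullet> w m x) \<in> borel_measurable m" by measurable
  have "\<bar>\<integral>x. \<phi> x \<bullet> w m x \<partial>m\<bar> \<le> (\<integral>x. norm (\<phi> x \<bullet> w m x) \<partial>m)"
    using integral_norm_bound[of m "\<lambda>x. \<phi> x \<bullet> w m x"] by simp
  also have "\<dots> = enn2real (\<integral>\<^sup>+x. ennreal (norm (\<phi> x \<bullet> w m x)) \<partial>m)"
    using meas' by (intro integral_eq_nn_integral) auto
  also have "\<dots> \<le> enn2real (ennreal B * moment m)"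
    using nn fin' by (intro enn2real_mono) auto
  also have "\<dots> = B * enn2real (moment m)"
    using B by (simp add: enn2real_mult)
  finally show "\<bar>\<integral>x. \<phi> x \<bullet> w m x \<partial>m\<bar> \<le> B * enn2real (moment m)" .
  have "(\<integral>(x, v). \<phi> x \<bullet> v \<partial>V m) = (\<integral>x. (\<integral>v. \<phi> x \<bullet> v \<partial>\<nu> m x) \<partial>m)"
    using disintegration_integral[OF d(2) m d(1) meas int] by simp
  also have "\<dots> = (\<integral>x. \<phi> x \<bullet> w m x \<partial>m)"
  proof (rule integral_cong_AE)
    have "\<nu> m \<in> borel \<rightarrow>\<^sub>M prob_algebra borel" using d(1) by (simp add: disintegration_def)
    then have K: "\<nu> m \<in> m \<rightarrow>\<^sub>M subprob_algebra borel"
      by (intro measurable_prob_algebraD) (simp cong: measurable_cong_sets)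
    have "(\<lambda>(x, v). \<phi> x \<bullet> v) \<in> borel_measurable (m \<Otimes>\<^sub>M borel)" by (simp add: split_def)
    from integral_kernel_measurable[OF K this]
    show "(\<lambda>x. \<integral>v. \<phi> x \<bullet> v \<partial>\<nu> m x) \<in> borel_measurable m" .
    show "(\<lambda>x. \<phi> x \<bullet> w m x) \<in> borel_measurable m" by (rule meas')
    have *: "(\<integral>v. \<phi> x \<bullet> v \<partial>\<nu> m x) = \<phi> x \<bullet> (\<integral>v. v \<partial>\<nu> m x)" if "integrable (\<nu> m x) (\<lambda>v. v)" for x
      using that by (rule integral_inner_right)
    show "AE x in m. (\<integral>v. \<phi> x \<bullet> v \<partial>\<nu> m x) = \<phi> x \<bullet> w m x"
      using AE_barycenter[OF m fin] by eventually_elim (simp add: *)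
  qed
  finally show "(\<integral>(x, v). \<phi> x \<bullet> v \<partial>V m) = (\<integral>x. \<phi> x \<bullet> w m x \<partial>m)" .
qed

definition speed :: "real \<Rightarrow> real" where
  "speed t = enn2real (moment (\<mu> t))"

text \<open>The common right-hand side of both equations, written through \<open>w\<close> rather
  than \<open>V\<close> so that its integrability in time can use the joint measurability of (t, x)
  -> w (\<mu> t) x.\<close>

definition flux :: "('a \<Rightarrow> real) \<Rightarrow> real \<Rightarrow> real" where
  "flux f t = (\<integral>x. gradient f x \<bullet> w (\<mu> t) x \<partial>\<mu> t)"

lemma AE_speed_finite:
  "AE t in lebesgue_on {0..T}. t \<in> {0..T} \<and> moment (\<mu> t) < \<infinity>"
proof -
  have "AE t in lebesgue_on {0..T}. moment (\<mu> t) \<noteq> \<infinity>"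
    using speed_finite by (intro nn_integral_PInf_AE speed_measurable) auto
  moreover have "AE t in lebesgue_on {0..T}. t \<in> {0..T}" by (rule AE_I2) simp
  ultimately show ?thesis by eventually_elim (auto simp: less_top)
qed

lemma speed_integrable: "integrable (lebesgue_on {0..T}) speed"
proof (rule integrableI_bounded)
  show "speed \<in> borel_measurable (lebesgue_on {0..T})"
    using speed_measurable unfolding speed_def[abs_def] by measurable
  have "(\<integral>\<^sup>+t. ennreal (norm (speed t)) \<partial>lebesgue_on {0..T}) \<le>
      (\<integral>\<^sup>+t. moment (\<mu> t) \<partial>lebesgue_on {0..T})"
    by (intro nn_integral_mono) (auto simp: speed_def ennreal_enn2real_if)
  then show "(\<integral>\<^sup>+t. ennreal (norm (speed t)) \<partial>lebesgue_on {0..T}) < \<infinity>"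
    using speed_finite by (rule le_less_trans)
qed

lemma speed_nonneg: "0 \<le> speed t"
  by (simp add: speed_def)

lemma gradient_borel_measurable: "f \<in> test_functions \<Longrightarrow> gradient f \<in> borel_measurable borel"
  by (simp add: borel_measurable_continuous_onI gradient_test_function_continuous)

text \<open>Every time with finite moment will do, so the exceptional set comes from the moment
  alone and is the same for all f.\<close>

lemma AE_flux:
  assumes f: "f \<in> test_functions" and B: "\<And>x. norm (gradient f x) \<le> B"
  shows "AE t in lebesgue_on {0..T}. integrable (V (\<mu> t)) (\<lambda>(x, v). gradient f x \<bullet> v) \<and>
    (\<integral>(x, v). gradient f x \<bullet> v \<partial>V (\<mu> t)) = flux f t \<and>
    \<bar>flux f t\<bar> \<le> B * speed t"
  using AE_speed_finite
proof eventually_elim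
  case (elim t)
  then have "\<mu> t \<in> borel_probs" using \<mu>_prob by simp
  from flux_eq[OF this _ gradient_borel_measurable[OF f] B] elim show ?case
    by (simp add: flux_def speed_def)
qed

section \<open>From the measure differential equation to the continuity equation\<close>

text \<open>The definition gives continuity in time of pairings with test functions. Since \<mu> t
  is itself a probability measure, no mass is lost as s tends to t, and the convergence is
  narrow.\<close>

lemma mde_solution_imp_narrowly_continuous:
  assumes "mde_solution T V \<mu>"
  shows "narrowly_continuous T \<mu>"
  unfolding narrowly_continuous_def
proof (intro allI impI)
  fix f :: "'a \<Rightarrow> real"
  assume f: "continuous_on UNIV f \<and> bounded (range f)"
  have "((\<lambda>s. \<integral>x. f x \<partial>\<mu> s) \<longlongrightarrow> (\<integral>x. f x \<partial>\<mu> t)) (at t within {0..T})"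
    if t: "t \<in> {0..T}" for t
  proof (rule test_convergence_imp_narrow[where N = \<mu> and M = "\<mu> t" and f = f])
    show "\<mu> t \<in> borel_probs" using \<mu>_prob t by blast
    show "\<forall>\<^sub>F s in at t within {0..T}. \<mu> s \<in> borel_probs"
      using \<mu>_prob by (auto simp: eventually_at_filter)
    show "((\<lambda>s. \<integral>x. g x \<partial>\<mu> s) \<longlongrightarrow> (\<integral>x. g x \<partial>\<mu> t)) (at t within {0..T})" if "g \<in> test_functions" for g
      using assms that t absolutely_continuous_imp_continuous
      unfolding mde_solution_def continuous_on_def by blast
  qed (use f in auto)
  then show "continuous_on {0..T} (\<lambda>t. \<integral>x. f x \<partial>\<mu> t)"
    by (simp add: continuous_on_def)
qed

text \<open>Measurability of \<mu> in time, a clause of \<open>ce_solution\<close>, comes from the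
  continuity of the pairings with test functions; composition with \<mu> then makes (t, x) -> w
  (\<mu> t) x measurable.\<close>

lemma mde_solution_imp_ce_solution:
  assumes mde: "mde_solution T V \<mu>"
  shows "nonlocal_ce_solution T w \<mu>"
  unfolding nonlocal_ce_solution_def ce_solution_def
proof (intro conjI ballI)
  have AC: "absolutely_continuous_fun T (\<lambda>t. \<integral>x. f x \<partial>\<mu> t)" if "f \<in> test_functions" for f
    using mde that by (simp add: mde_solution_def)
  show \<mu>: "\<mu> \<in> restrict_space borel {0..T} \<rightarrow>\<^sub>M prob_algebra borel"
  proof (rule measurable_of_test_functions)
    show "\<mu> t \<in> borel_probs" if "t \<in> space (restrict_space borel {0..T})" for t
      using that \<mu>_prob by (simp add: space_restrict_space)
    show "(\<lambda>t. \<integral>x. f x \<partial>\<mu> t) \<in> borel_measurable (restrict_space borel {0..T})" if "f \<in> test_functions" for f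
      by (intro borel_measurable_continuous_on_restrict absolutely_continuous_imp_continuous AC that)
  qed
  have "(\<lambda>(t, x). (x, \<mu> t)) \<in> restrict_space borel {0..T} \<Otimes>\<^sub>M borel \<rightarrow>\<^sub>M borel \<Otimes>\<^sub>M prob_algebra borel"
    using \<mu> by measurable
  from measurable_compose[OF this w_measurable]
  show "(\<lambda>(t, x). w (\<mu> t) x) \<in> borel_measurable (restrict_space borel {0..T} \<Otimes>\<^sub>M borel)"
    by (simp add: split_def)
  have "(\<integral>\<^sup>+t. (\<integral>\<^sup>+x. ennreal (norm (w (\<mu> t) x)) \<partial>\<mu> t) \<partial>lebesgue_on {0..T}) \<le>
      (\<integral>\<^sup>+t. moment (\<mu> t) \<partial>lebesgue_on {0..T})"
    using \<mu>_prob by (intro nn_integral_mono nn_integral_norm_w_le) auto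
  then show "(\<integral>\<^sup>+t. (\<integral>\<^sup>+x. ennreal (norm (w (\<mu> t) x)) \<partial>\<mu> t) \<partial>lebesgue_on {0..T}) < \<infinity>"
    using speed_finite by (rule le_less_trans)
  fix f :: "'a \<Rightarrow> real" assume f: "f \<in> test_functions"
  obtain B where B: "\<And>x. norm (gradient f x) \<le> B" using gradient_test_function_bounded[OF f] by blast
  note AE_flux[OF f B]
  then have eq: "AE t in lebesgue_on {0..T}. flux f t = (\<integral>(x, v). gradient f x \<bullet> v \<partial>V (\<mu> t))"
    by eventually_elim simp
  \<comment> \<open>\<open>mde_solution\<close> provides integrability of the integrals against
    \<open>V\<close>; it passes to the flux because the two agree almost everywhere.\<close>
  have int: "integrable (lebesgue_on {0..T}) (flux f)"
    using mde f by (intro integrable_lebesgue_on_AE_cong[OF _ _ eq]) (auto simp: mde_solution_def)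
  have "AE t in lebesgue_on {0..T}. ((\<lambda>s. \<integral>x. f x \<partial>\<mu> s) has_real_derivative
      (\<integral>(x, v). gradient f x \<bullet> v \<partial>V (\<mu> t))) (at t within {0..T})"
    using mde f by (simp add: mde_solution_def)
  with eq have deriv: "AE t in lebesgue_on {0..T}. ((\<lambda>s. \<integral>x. f x \<partial>\<mu> s) has_real_derivative flux f t) (at t within {0..T})"
    by eventually_elim simp
  have u: "integrable (lebesgue_on {0..T}) (\<lambda>t. \<integral>x. f x \<partial>\<mu> t)"
    by (intro integrable_lebesgue_on_continuous absolutely_continuous_imp_continuous AC f)
  have "distributional_derivative T (\<lambda>t. \<integral>x. f x \<partial>\<mu> t) (flux f)"
    unfolding distributional_derivative_def
  proof (intro conjI allI impI ballI)
    fix a b :: real assume "0 < a \<and> b < T"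
    then show "integrable (lebesgue_on {a..b}) (\<lambda>t. \<integral>x. f x \<partial>\<mu> t)" "integrable (lebesgue_on {a..b}) (flux f)"
      using u int by (auto intro: integrable_lebesgue_on_subset[of "{0..T}"])
  next
    fix \<phi> :: "real \<Rightarrow> real" assume \<phi>: "\<phi> \<in> test_functions" "fun_support \<phi> \<subseteq> {0<..<T}"
    have "0 \<notin> fun_support \<phi>" "T \<notin> fun_support \<phi>" using \<phi>(2) by force+
    then have "\<phi> 0 = 0" "\<phi> T = 0" by (auto intro: eq_0_outside_fun_support)
    then show "(\<integral>t. deriv \<phi> t * (\<integral>x. f x \<partial>\<mu> t) \<partial>lebesgue_on {0<..<T}) = - (\<integral>t. \<phi> t * flux f t \<partial>lebesgue_on {0<..<T})"
      by (intro absolutely_continuous_integration_by_parts[OF T_pos AC[OF f] int deriv \<phi>(1)])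
  qed
  then show "distributional_derivative T (\<lambda>t. \<integral>x. f x \<partial>\<mu> t) (\<lambda>t. \<integral>x. gradient f x \<bullet> w (\<mu> t) x \<partial>\<mu> t)"
    by (simp add: flux_def[abs_def])
qed

section \<open>From the continuity equation to the measure differential equation\<close>

lemma ce_solution_measurable:
  "nonlocal_ce_solution T w \<mu> \<Longrightarrow> \<mu> \<in> restrict_space borel {0..T} \<rightarrow>\<^sub>M prob_algebra borel"
  by (simp add: nonlocal_ce_solution_def ce_solution_def)

text \<open>Domination by B * speed, where measurability in time is drawn from the joint
  measurability of the field in \<open>ce_solution\<close>.\<close>

lemma flux_integrable:
  assumes ce: "nonlocal_ce_solution T w \<mu>" and f: "f \<in> test_functions"
  shows "integrable (lebesgue_on {0..T}) (flux f)"
proof -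
  obtain B where B: "\<And>x. norm (gradient f x) \<le> B" using gradient_test_function_bounded[OF f] by blast
  have K: "\<mu> \<in> restrict_space borel {0..T} \<rightarrow>\<^sub>M subprob_algebra borel"
    by (rule measurable_prob_algebraD[OF ce_solution_measurable[OF ce]])
  have "(\<lambda>(t, x). w (\<mu> t) x) \<in> borel_measurable (restrict_space borel {0..T} \<Otimes>\<^sub>M borel)"
    using ce by (simp add: nonlocal_ce_solution_def ce_solution_def)
  moreover note gradient_borel_measurable[OF f, measurable]
  ultimately have "(\<lambda>(t, x). gradient f x \<bullet> w (\<mu> t) x) \<in> borel_measurable (restrict_space borel {0..T} \<Otimes>\<^sub>M borel)"
    unfolding split_def by measurable
  from integral_kernel_measurable[OF K this] have "flux f \<in> borel_measurable (lebesgue_on {0..T})"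
    unfolding flux_def[abs_def] by (rule borel_measurable_lebesgue_onI) simp
  moreover have "AE t in lebesgue_on {0..T}. norm (flux f t) \<le> norm (B * speed t)"
    using AE_flux[OF f B] by eventually_elim force
  moreover have "integrable (lebesgue_on {0..T}) (\<lambda>t. B * speed t)"
    using speed_integrable by simp
  ultimately show ?thesis
    using Bochner_Integration.integrable_bound by blast
qed

lemma ce_solution_representation:
  assumes ce: "nonlocal_ce_solution T w \<mu>" and f: "f \<in> test_functions"
  shows "\<exists>c. AE t in lebesgue_on {0..T}. (\<integral>x. f x \<partial>\<mu> t) = c + integral {0..t} (flux f)"
proof (rule distributional_derivative_imp_indefinite_integral[OF T_pos _ flux_integrable[OF ce f]])
  show "distributional_derivative T (\<lambda>t. \<integral>x. f x \<partial>\<mu> t) (flux f)"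
    using ce f by (simp add: nonlocal_ce_solution_def ce_solution_def flux_def[abs_def])
  have K: "\<mu> \<in> restrict_space borel {0..T} \<rightarrow>\<^sub>M subprob_algebra borel"
    by (rule measurable_prob_algebraD[OF ce_solution_measurable[OF ce]])
  note test_function_borel_measurable[OF f, measurable]
  have "(\<lambda>(t, x). f x) \<in> borel_measurable (restrict_space borel {0..T} \<Otimes>\<^sub>M borel)"
    by (simp add: split_def)
  from integral_kernel_measurable[OF K this]
  have meas: "(\<lambda>t. \<integral>x. f x \<partial>\<mu> t) \<in> borel_measurable (lebesgue_on {0..T})"
    by (rule borel_measurable_lebesgue_onI) simp
  obtain B where B: "\<And>x. \<bar>f x\<bar> \<le> B" using test_function_bounded[OF f] by blast
  show "integrable (lebesgue_on {0..T}) (\<lambda>t. \<integral>x. f x \<partial>\<mu> t)"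
  proof (rule Bochner_Integration.integrable_bound[OF integrable_lebesgue_on_continuous[of 0 T "\<lambda>_. B"] meas])
    show "AE t in lebesgue_on {0..T}. norm (\<integral>x. f x \<partial>\<mu> t) \<le> norm B"
      using abs_integral_le_bound[OF _ f B] \<mu>_prob by (auto intro!: AE_I2 intro: order_trans[OF _ abs_ge_self])
  qed simp
qed

text \<open>Formulated for a curve \<mu>' equal to \<mu> at almost every time, so that it serves
  both \<mu> itself and the representative built later. The conditions on \<open>V\<close> concern
  almost every t, where V (\<mu>' t) = V (\<mu> t); absolute continuity needs the representation at
  every t.\<close>

lemma mde_solution_of_representation:
  assumes \<mu>': "\<And>t. t \<in> {0..T} \<Longrightarrow> \<mu>' t \<in> borel_probs" and eq: "AE t in lebesgue_on {0..T}. \<mu>' t = \<mu> t"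
    and int: "\<And>f. f \<in> test_functions \<Longrightarrow> integrable (lebesgue_on {0..T}) (flux f)"
    and rep: "\<And>f. f \<in> test_functions \<Longrightarrow> \<exists>c. \<forall>t\<in>{0..T}. (\<integral>x. f x \<partial>\<mu>' t) = c + integral {0..t} (flux f)"
  shows "mde_solution T V \<mu>'"
  unfolding mde_solution_def
proof (intro conjI ballI)
  fix f :: "'a \<Rightarrow> real" assume f: "f \<in> test_functions"
  obtain B where B: "\<And>x. norm (gradient f x) \<le> B" using gradient_test_function_bounded[OF f] by blast
  obtain c where c: "\<And>t. t \<in> {0..T} \<Longrightarrow> (\<integral>x. f x \<partial>\<mu>' t) = c + integral {0..t} (flux f)"
    using rep[OF f] by blast
  show "AE t in lebesgue_on {0..T}. integrable (V (\<mu>' t)) (\<lambda>(x, v). gradient f x \<bullet> v)"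
    using AE_flux[OF f B] eq by eventually_elim simp
  have fl: "AE t in lebesgue_on {0..T}. (\<integral>(x, v). gradient f x \<bullet> v \<partial>V (\<mu>' t)) = flux f t"
    using AE_flux[OF f B] eq by eventually_elim simp
  show "integrable (lebesgue_on {0..T}) (\<lambda>t. \<integral>(x, v). gradient f x \<bullet> v \<partial>V (\<mu>' t))"
    by (rule integrable_lebesgue_on_AE_cong[OF int[OF f] _ fl]) simp
  show "absolutely_continuous_fun T (\<lambda>t. \<integral>x. f x \<partial>\<mu>' t)"
    by (rule absolutely_continuous_fun_cong[OF absolutely_continuous_indefinite_integral[OF int[OF f], of c]])
      (simp add: c)
  show "AE t in lebesgue_on {0..T}. ((\<lambda>s. \<integral>x. f x \<partial>\<mu>' s) has_real_derivative
      (\<integral>(x, v). gradient f x \<bullet> v \<partial>V (\<mu>' t))) (at t within {0..T})"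
    using lebesgue_differentiation[OF int[OF f]] fl AE_speed_finite
  proof eventually_elim
    case (elim t)
    have "((\<lambda>s. c + integral {0..s} (flux f)) has_real_derivative flux f t) (at t within {0..T})"
      using elim(1) by (auto intro!: derivative_eq_intros)
    then have "((\<lambda>s. \<integral>x. f x \<partial>\<mu>' s) has_real_derivative flux f t) (at t within {0..T})"
      by (rule has_field_derivative_transform_within[where d = 1]) (use c elim(3) in auto)
    then show ?case using elim(2) by simp
  qed
qed (rule \<mu>')

lemma narrow_ce_solution_imp_mde_solution:
  assumes narrow: "narrowly_continuous T \<mu>" and ce: "nonlocal_ce_solution T w \<mu>"
  shows "mde_solution T V \<mu>"
proof (rule mde_solution_of_representation)
  fix f :: "'a \<Rightarrow> real" assume f: "f \<in> test_functions"
  obtain c where c: "AE t in lebesgue_on {0..T}. (\<integral>x. f x \<partial>\<mu> t) = c + integral {0..t} (flux f)"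
    using ce_solution_representation[OF ce f] by blast
  have "bounded (range f)"
    using test_function_bounded[OF f] by (auto simp: bounded_iff)
  then have "continuous_on {0..T} (\<lambda>t. \<integral>x. f x \<partial>\<mu> t)"
    using narrow test_function_continuous[OF f] by (simp add: narrowly_continuous_def)
  moreover have "continuous_on {0..T} (\<lambda>t. c + integral {0..t} (flux f))"
    by (intro absolutely_continuous_imp_continuous absolutely_continuous_indefinite_integral flux_integrable ce f)
  ultimately show "\<exists>c. \<forall>t\<in>{0..T}. (\<integral>x. f x \<partial>\<mu> t) = c + integral {0..t} (flux f)"
    using continuous_AE_eq_imp_eq[OF T_pos _ _ c] by blast
qed (use \<mu>_prob flux_integrable[OF ce] in auto)

end


context mde_setting
begin

section \<open>A probability measure at every time\<close>

text \<open>The bound is linear in the gradient bound, with a constant independent of s, t and f;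
  along ever wider dilations of one cutoff it therefore tends to 0.\<close>

lemma flux_integral_bound:
  assumes f: "f \<in> test_functions" and int: "integrable (lebesgue_on {0..T}) (flux f)"
    and B: "\<And>x. norm (gradient f x) \<le> B" and st: "0 \<le> s" "s \<le> t" "t \<le> T"
  shows "\<bar>integral {0..t} (flux f) - integral {0..s} (flux f)\<bar> \<le> B * integral\<^sup>L (lebesgue_on {0..T}) speed"
proof -
  have B0: "0 \<le> B" using B[of 0] norm_ge_zero order_trans by blast
  have fi: "flux f integrable_on {0..T}" using int by (rule integrable_on_lebesgue_on) simp
  have "integral {0..s} (flux f) + integral {s..t} (flux f) = integral {0..t} (flux f)"
    using st by (intro Henstock_Kurzweil_Integration.integral_combine integrable_on_subinterval[OF fi]) auto
  then have "\<bar>integral {0..t} (flux f) - integral {0..s} (flux f)\<bar> = \<bar>integral {s..t} (flux f)\<bar>"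
    by simp
  also have ist: "integrable (lebesgue_on {s..t}) (flux f)"
    using st by (intro integrable_lebesgue_on_subset[OF int]) auto
  then have "integral {s..t} (flux f) = integral\<^sup>L (lebesgue_on {s..t}) (flux f)"
    by (intro lebesgue_integral_eq_integral[symmetric]) auto
  also have "\<bar>\<dots>\<bar> \<le> (\<integral>\<tau>. \<bar>flux f \<tau>\<bar> \<partial>lebesgue_on {s..t})"
    by (rule integral_abs_bound)
  also have "\<dots> \<le> (\<integral>\<tau>. B * speed \<tau> \<partial>lebesgue_on {0..T})"
  proof (rule integral_mono_lebesgue_on_AE)
    have "AE \<tau> in lebesgue_on {0..T}. \<bar>flux f \<tau>\<bar> \<le> B * speed \<tau>"
      using AE_flux[OF f B] by eventually_elim simp
    then have "AE \<tau> in lebesgue. \<tau> \<in> {0..T} \<longrightarrow> \<bar>flux f \<tau>\<bar> \<le> B * speed \<tau>"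
      by (subst (asm) AE_restrict_space_iff) auto
    then have "AE \<tau> in lebesgue. \<tau> \<in> {s..t} \<longrightarrow> \<bar>flux f \<tau>\<bar> \<le> B * speed \<tau>"
      by eventually_elim (use st in auto)
    then show "AE \<tau> in lebesgue_on {s..t}. \<bar>flux f \<tau>\<bar> \<le> B * speed \<tau>"
      by (subst AE_restrict_space_iff) auto
  qed (use speed_integrable B0 speed_nonneg st in auto)
  also have "\<dots> = B * integral\<^sup>L (lebesgue_on {0..T}) speed" by simp
  finally show ?thesis .
qed

text \<open>The averages of the measures over shrinking time intervals around t see every continuous
  representative at the given time t, simultaneously for all test functions.\<close>

lemma time_averages:
  assumes \<mu>: "\<mu> \<in> restrict_space borel {0..T} \<rightarrow>\<^sub>M prob_algebra borel" and t: "t \<in> {0..T}"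
  shows "\<exists>A :: nat \<Rightarrow> 'a measure. (\<forall>n. A n \<in> borel_probs) \<and>
    (\<forall>f\<in>test_functions. \<forall>\<rho>. continuous_on {0..T} \<rho> \<longrightarrow>
       (AE s in lebesgue_on {0..T}. (\<integral>x. f x \<partial>\<mu> s) = \<rho> s) \<longrightarrow> (\<lambda>n. \<integral>x. f x \<partial>A n) \<longlonglongrightarrow> \<rho> t)"
proof -
  \<comment> \<open>Borel rather than completed Lebesgue measure on [0, T], since \<mu> is
    measurable for the Borel sets and serves as a kernel for \<open>bind\<close>.\<close>
  define L where "L = restrict_space lborel {0..T}"
  have sL: "sets L = sets (restrict_space borel {0..T})"
    unfolding L_def by (rule sets_restrict_space_cong) simp
  have spL: "space L = {0..T}" by (simp add: L_def space_restrict_space)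
  \<comment> \<open>Clipping to [0, T] gives one-sided intervals at the end points; the length stays
    positive because t lies in [0, T] and 0 < T.\<close>
  define J where "J n = {max 0 (t - 1 / (real n + 1))..min T (t + 1 / (real n + 1))}" for n
  have Jsub: "J n \<subseteq> {0..T}" for n by (auto simp: J_def)
  have J: "J n \<in> sets L" for n
    using Jsub by (auto simp: L_def sets_restrict_space_iff J_def)
  have Jpos: "emeasure L (J n) \<noteq> 0" "emeasure L (J n) < \<infinity>" for n
  proof -
    have "0 < 1 / (real n + 1)" by simp
    then have "t - 1 / (real n + 1) < T" "0 < t + 1 / (real n + 1)"
      "t - 1 / (real n + 1) < t + 1 / (real n + 1)"
      using t unfolding atLeastAtMost_iff by linarith+
    then have lt: "max 0 (t - 1 / (real n + 1)) < min T (t + 1 / (real n + 1))"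
      using T_pos by simp
    have "emeasure L (J n) = emeasure lborel (J n)"
      unfolding L_def using Jsub by (intro emeasure_restrict_space) auto
    also have "\<dots> = ennreal (min T (t + 1 / (real n + 1)) - max 0 (t - 1 / (real n + 1)))"
      unfolding J_def using lt by simp
    finally have "emeasure L (J n) = ennreal (min T (t + 1 / (real n + 1)) - max 0 (t - 1 / (real n + 1)))" .
    moreover have "ennreal x \<noteq> 0 \<and> ennreal x < \<infinity>" if "0 < x" for x using that by simp
    moreover have "0 < min T (t + 1 / (real n + 1)) - max 0 (t - 1 / (real n + 1))"
      using lt by (simp only: diff_gt_0_iff_gt)
    ultimately show "emeasure L (J n) \<noteq> 0" "emeasure L (J n) < \<infinity>" by presburger+
  qed
  define P where "P n = uniform_measure L (J n)" for n
  have P: "prob_space (P n)" for n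
    unfolding P_def using Jpos[of n] by (intro prob_space_uniform_measure) (auto simp: less_top)
  have sP: "sets (P n) = sets (restrict_space borel {0..T})" and spP: "space (P n) = {0..T}" for n
    using sL spL by (auto simp: P_def)
  have K: "\<mu> \<in> P n \<rightarrow>\<^sub>M subprob_algebra borel" for n
    using measurable_prob_algebraD[OF \<mu>] by (simp cong: measurable_cong_sets add: sP)
  have \<mu>_at: "prob_space (\<mu> s)" "sets (\<mu> s) = sets borel" if "s \<in> {0..T}" for s
    using \<mu>_prob that borel_probsD(1,2)[of "\<mu> s"] by auto
  define A where "A n = P n \<bind> \<mu>" for n
  have "A n \<in> borel_probs" for n
  proof (rule borel_probsI)
    interpret P: prob_space "P n" by (rule P)
    show "prob_space (A n)"
      unfolding A_def by (rule P.prob_space_bind[OF _ K]) (use \<mu>_at(1) spP in \<open>auto intro!: AE_I2\<close>)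
    show "sets (A n) = sets borel"
      unfolding A_def by (rule sets_bind) (use \<mu>_at(2) spP T_pos in auto)
  qed
  moreover have "(\<lambda>n. \<integral>x. f x \<partial>A n) \<longlonglongrightarrow> \<rho> t"
    if f: "f \<in> test_functions" and \<rho>: "continuous_on {0..T} \<rho>"
      and ae: "AE s in lebesgue_on {0..T}. (\<integral>x. f x \<partial>\<mu> s) = \<rho> s" for f \<rho>
  proof -
    note [measurable] = test_function_borel_measurable[OF f]
    obtain B where B: "\<And>x. \<bar>f x\<bar> \<le> B" using test_function_bounded[OF f] by blast
    have avg: "(\<integral>x. f x \<partial>A n) = (\<integral>s. (\<integral>x. f x \<partial>\<mu> s) \<partial>P n)" for n
      unfolding A_def
    proof (rule integral_bind_kernel[OF K])
      interpret P: prob_space "P n" by (rule P)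
      have "(\<integral>\<^sup>+s. (\<integral>\<^sup>+y. ennreal \<bar>f y\<bar> \<partial>\<mu> s) \<partial>P n) \<le> (\<integral>\<^sup>+s. ennreal B \<partial>P n)"
      proof (rule nn_integral_mono)
        fix s assume "s \<in> space (P n)"
        then interpret prob_space "\<mu> s" using \<mu>_at(1) spP by simp
        have "(\<integral>\<^sup>+y. ennreal \<bar>f y\<bar> \<partial>\<mu> s) \<le> (\<integral>\<^sup>+y. ennreal B \<partial>\<mu> s)"
          using B by (intro nn_integral_mono ennreal_leI)
        then show "(\<integral>\<^sup>+y. ennreal \<bar>f y\<bar> \<partial>\<mu> s) \<le> ennreal B" by (simp add: emeasure_space_1)
      qed
      also have "\<dots> < \<infinity>" by (simp add: P.emeasure_space_1)
      finally show "(\<integral>\<^sup>+s. (\<integral>\<^sup>+y. ennreal \<bar>f y\<bar> \<partial>\<mu> s) \<partial>P n) < \<infinity>" .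
    qed (use spP T_pos in auto)
    have "integrable (P n) (\<lambda>s. \<integral>x. f x \<partial>\<mu> s)" for n
    proof -
      interpret P: prob_space "P n" by (rule P)
      have "(\<lambda>(s, x). f x) \<in> borel_measurable (P n \<Otimes>\<^sub>M borel)" by (simp add: split_def)
      from integral_kernel_measurable[OF K this]
      have "(\<lambda>s. \<integral>x. f x \<partial>\<mu> s) \<in> borel_measurable (P n)" .
      moreover have "\<bar>\<integral>x. f x \<partial>\<mu> s\<bar> \<le> B" if "s \<in> {0..T}" for s
        using abs_integral_le_bound[OF _ f B] \<mu>_prob that by blast
      ultimately show ?thesis
        using spP by (intro P.integrable_const_bound[of _ B] AE_I2) auto
    qed
    note int_P = this
    \<comment> \<open>A statement that holds almost everywhere for the completed measure is brought
      back to the Borel measure over which the averages are taken.\<close>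
    have ae_L: "AE s in L. (\<integral>x. f x \<partial>\<mu> s) = \<rho> s"
    proof -
      have "AE s in lebesgue. s \<in> {0..T} \<longrightarrow> (\<integral>x. f x \<partial>\<mu> s) = \<rho> s"
        using ae by (subst (asm) AE_restrict_space_iff) auto
      then have "AE s in lborel. s \<in> {0..T} \<longrightarrow> (\<integral>x. f x \<partial>\<mu> s) = \<rho> s"
        by (simp add: AE_completion_iff)
      then show ?thesis unfolding L_def by (subst AE_restrict_space_iff) auto
    qed
    show ?thesis
    proof (rule LIMSEQ_I)
      fix e :: real assume "0 < e"
      then have "0 < e / 2" by simp
      with \<rho> t obtain d where d: "0 < d" "\<And>s. s \<in> {0..T} \<Longrightarrow> dist s t < d \<Longrightarrow> dist (\<rho> s) (\<rho> t) < e / 2"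
        unfolding continuous_on_iff by meson
      obtain N :: nat where N: "1 / (real N + 1) < d"
        using d(1) reals_Archimedean[of d] by (auto simp: inverse_eq_divide add.commute)
      have "norm ((\<integral>x. f x \<partial>A n) - \<rho> t) < e" if "N \<le> n" for n
      proof -
        interpret P: prob_space "P n" by (rule P)
        have "1 / (real n + 1) \<le> 1 / (real N + 1)" using that by (simp add: frac_le)
        then have close: "dist (\<rho> s) (\<rho> t) < e / 2" if "s \<in> J n" for s
          using that N Jsub by (intro d(2)) (auto simp: J_def dist_real_def)
        have "AE s in P n. s \<in> J n \<and> (\<integral>x. f x \<partial>\<mu> s) = \<rho> s"
          unfolding P_def using ae_L by (intro AE_uniform_measureI J) auto
        then have ae: "AE s in P n. \<bar>(\<integral>x. f x \<partial>\<mu> s) - \<rho> t\<bar> \<le> e / 2"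
          by eventually_elim (use close in \<open>force simp: dist_real_def\<close>)
        have "AE s in P n. \<rho> t - e / 2 \<le> (\<integral>x. f x \<partial>\<mu> s)"
          using ae by eventually_elim linarith
        moreover have "AE s in P n. (\<integral>x. f x \<partial>\<mu> s) \<le> \<rho> t + e / 2"
          using ae by eventually_elim linarith
        ultimately have "\<rho> t - e / 2 \<le> (\<integral>x. f x \<partial>A n)" "(\<integral>x. f x \<partial>A n) \<le> \<rho> t + e / 2"
          unfolding avg using int_P by (auto intro: P.integral_ge_const P.integral_le_const)
        then show ?thesis using \<open>0 < e\<close> by (auto simp: abs_le_iff)
      qed
      then show "\<exists>N. \<forall>n\<ge>N. norm ((\<integral>x. f x \<partial>A n) - \<rho> t) < e" by blast
    qed
  qed
  ultimately show ?thesis by blast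
qed

text \<open>The pairings of the averages converge to the prescribed values for every f, so the vague
  limit along whichever subsequence has the right pairings. \<open>c\<close> is a parameter so that
  the same constants serve all t.\<close>

lemma ce_solution_measure_at:
  assumes ce: "nonlocal_ce_solution T w \<mu>" and t: "t \<in> {0..T}"
    and c: "\<And>f. f \<in> test_functions \<Longrightarrow>
      AE s in lebesgue_on {0..T}. (\<integral>x. f x \<partial>\<mu> s) = c f + integral {0..s} (flux f)"
  shows "\<exists>\<sigma>\<in>borel_probs. \<forall>f\<in>test_functions. (\<integral>x. f x \<partial>\<sigma>) = c f + integral {0..t} (flux f)"
proof -
  define R where "R f s = c f + integral {0..s} (flux f)" for f s
  have Rc: "continuous_on {0..T} (R f)" if "f \<in> test_functions" for f
    unfolding R_def[abs_def] using that
    by (intro absolutely_continuous_imp_continuous absolutely_continuous_indefinite_integral flux_integrable ce)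
  obtain A :: "nat \<Rightarrow> 'a measure" where A: "\<And>n. A n \<in> borel_probs"
    "\<And>f \<rho>. f \<in> test_functions \<Longrightarrow> continuous_on {0..T} \<rho> \<Longrightarrow>
      AE s in lebesgue_on {0..T}. (\<integral>x. f x \<partial>\<mu> s) = \<rho> s \<Longrightarrow> (\<lambda>n. \<integral>x. f x \<partial>A n) \<longlonglongrightarrow> \<rho> t"
    using time_averages[OF ce_solution_measurable[OF ce] t] by blast
  obtain r \<sigma> where r: "strict_mono (r :: nat \<Rightarrow> nat)" and s\<sigma>: "sets \<sigma> = sets borel"
    and \<sigma>_le: "emeasure \<sigma> UNIV \<le> 1"
    and conv: "\<forall>f :: 'a \<Rightarrow> real. continuous_on UNIV f \<longrightarrow> compact (fun_support f) \<longrightarrow>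
       (\<lambda>n. \<integral>x. f x \<partial>A (r n)) \<longlonglongrightarrow> (\<integral>x. f x \<partial>\<sigma>)"
    using vague_compactness[of A, OF A(1)] by (elim exE conjE) (rule that)
  have \<sigma>R: "(\<integral>x. f x \<partial>\<sigma>) = R f t" if f: "f \<in> test_functions" for f
  proof -
    have "(\<lambda>n. \<integral>x. f x \<partial>A n) \<longlonglongrightarrow> R f t"
      using c[OF f] by (intro A(2) f Rc) (simp add: R_def)
    from LIMSEQ_subseq_LIMSEQ[OF this r] have "(\<lambda>n. \<integral>x. f x \<partial>A (r n)) \<longlonglongrightarrow> R f t" by (simp add: o_def)
    moreover have "(\<lambda>n. \<integral>x. f x \<partial>A (r n)) \<longlonglongrightarrow> (\<integral>x. f x \<partial>\<sigma>)"
      using f test_function_continuous[OF f] by (intro conv[rule_format]) (auto simp: test_functions_def)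
    ultimately show ?thesis using LIMSEQ_unique by blast
  qed
  have sp\<sigma>: "space \<sigma> = UNIV" using sets_eq_imp_space_eq[OF s\<sigma>] by simp
  have "finite_measure \<sigma>"
    by (rule finite_measureI) (use \<sigma>_le sp\<sigma> in \<open>auto simp: top_unique\<close>)
  then interpret \<sigma>: finite_measure \<sigma> .
  \<comment> \<open>The vague limit loses no mass: the pairings with wide cutoffs, whose gradients are small, hardly
    change between t and a time s at which the measure is known to be a probability measure.\<close>
  obtain h :: "'a \<Rightarrow> real" where h: "h \<in> test_functions" "h 0 = 1" "\<And>x. 0 \<le> h x"
    using exists_cutoff by blast
  define H where "H n x = h (inverse (real (Suc n)) *\<^sub>R x)" for n x
  have H: "H n \<in> test_functions" for n
    unfolding H_def[abs_def] by (rule test_function_scale[OF h(1)]) simp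
  obtain C where C: "\<And>x. \<bar>h x\<bar> \<le> C" using test_function_bounded[OF h(1)] by blast
  obtain B where B: "\<And>x. norm (gradient h x) \<le> B" using gradient_test_function_bounded[OF h(1)] by blast
  have gradH: "norm (gradient (H n) x) \<le> inverse (real (Suc n)) * B" for n x
    unfolding H_def[abs_def] gradient_scale[OF h(1)] using B by (auto intro!: mult_left_mono)
  have H_lim: "(\<lambda>n. H n x) \<longlonglongrightarrow> 1" for x
  proof -
    have "(\<lambda>n. inverse (real (Suc n)) *\<^sub>R x) \<longlonglongrightarrow> 0 *\<^sub>R x"
      by (intro tendsto_scaleR LIMSEQ_inverse_real_of_nat tendsto_const)
    then have "(\<lambda>n. h (inverse (real (Suc n)) *\<^sub>R x)) \<longlonglongrightarrow> h (0 *\<^sub>R x)"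
      using test_function_continuous[OF h(1)] by (intro isCont_tendsto_compose[of _ h]) (auto simp: continuous_on_eq_continuous_at)
    then show ?thesis using h(2) by (simp add: H_def)
  qed
  \<comment> \<open>Stated for finite measures because it is applied both to \<open>\<mu> s\<close>
    and to the limit \<sigma>, whose total mass is still unknown.\<close>
  have mass: "(\<lambda>n. \<integral>x. H n x \<partial>m) \<longlonglongrightarrow> measure m UNIV"
    if m: "finite_measure m" "sets m = sets borel" for m :: "'a measure"
  proof -
    interpret finite_measure m by fact
    have "space m = UNIV" using sets_eq_imp_space_eq[OF m(2)] by simp
    moreover have "(\<lambda>n. \<integral>x. H n x \<partial>m) \<longlonglongrightarrow> (\<integral>x. 1 \<partial>m)"
    proof (rule integral_dominated_convergence[where w = "\<lambda>_. C"])
      show "H n \<in> borel_measurable m" for n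
        using test_function_borel_measurable[OF H] m(2) by (simp cong: measurable_cong_sets)
    qed (use H_lim C in \<open>auto simp: H_def\<close>)
    ultimately show ?thesis by simp
  qed
  \<comment> \<open>One time s is good for all cutoffs at once, since they are countably many and
    [0, T] has positive length.\<close>
  have "AE s in lebesgue_on {0..T}. \<forall>n. (\<integral>x. H n x \<partial>\<mu> s) = R (H n) s"
    unfolding AE_all_countable R_def using c[OF H] by blast
  moreover have "AE s in lebesgue_on {0..T}. s \<in> {0..T}" by (rule AE_I2) simp
  ultimately have "AE s in lebesgue_on {0..T}. s \<in> {0..T} \<and> (\<forall>n. (\<integral>x. H n x \<partial>\<mu> s) = R (H n) s)"
    by eventually_elim simp
  moreover have "ae_filter (lebesgue_on {0..T}) \<noteq> bot"
    using T_pos by (simp add: ae_filter_eq_bot_iff emeasure_restrict_space)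
  ultimately obtain s where s: "s \<in> {0..T}" "\<And>n. (\<integral>x. H n x \<partial>\<mu> s) = R (H n) s"
    using eventually_happens' by blast
  interpret \<mu>s: prob_space "\<mu> s" using \<mu>_prob s(1) borel_probsD by blast
  have "(\<lambda>n. R (H n) s) \<longlonglongrightarrow> 1"
  proof -
    have "space (\<mu> s) = UNIV" "sets (\<mu> s) = sets borel" using \<mu>_prob s(1) borel_probsD by blast+
    then show ?thesis
      using mass[of "\<mu> s"] \<mu>s.finite_measure_axioms \<mu>s.prob_space by (simp add: s(2))
  qed
  moreover have "(\<lambda>n. R (H n) t - R (H n) s) \<longlonglongrightarrow> 0"
  proof (rule Lim_null_comparison)
    define W where "W = integral\<^sup>L (lebesgue_on {0..T}) speed"
    have "\<bar>R (H n) t - R (H n) s\<bar> \<le> (inverse (real (Suc n)) * B) * W" for n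
    proof (cases "s \<le> t")
      case True
      then show ?thesis
        using flux_integral_bound[OF H flux_integrable[OF ce H] gradH, of s t] s(1) t by (simp add: R_def W_def)
    next
      case False
      then show ?thesis
        using flux_integral_bound[OF H flux_integrable[OF ce H] gradH, of t s] s(1) t
        by (simp add: R_def W_def abs_minus_commute)
    qed
    then show "\<forall>\<^sub>F n in sequentially. norm (R (H n) t - R (H n) s) \<le> inverse (real (Suc n)) * (B * W)"
      by (intro always_eventually allI) (simp add: mult.assoc)
    show "(\<lambda>n. inverse (real (Suc n)) * (B * W)) \<longlonglongrightarrow> 0"
      using tendsto_mult_right[OF LIMSEQ_inverse_real_of_nat, of "B * W"] by simp
  qed
  ultimately have "(\<lambda>n. R (H n) s + (R (H n) t - R (H n) s)) \<longlonglongrightarrow> 1 + 0"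
    by (rule tendsto_add)
  then have "(\<lambda>n. \<integral>x. H n x \<partial>\<sigma>) \<longlonglongrightarrow> 1" using \<sigma>R[OF H] by simp
  with mass[OF \<open>finite_measure \<sigma>\<close> s\<sigma>] have "measure \<sigma> UNIV = 1" using LIMSEQ_unique by blast
  then have "prob_space \<sigma>"
    using sp\<sigma> by (intro prob_spaceI) (simp add: \<sigma>.emeasure_eq_measure)
  then have "\<sigma> \<in> borel_probs" using s\<sigma> by (rule borel_probsI)
  then show ?thesis using \<sigma>R unfolding R_def by blast
qed

text \<open>The constants \<open>c f\<close> are chosen before t. If they could vary with t, the
  representation would give no control over the pairings with \<mu>' t as functions of time.\<close>

lemma ce_solution_imp_mde_representative:
  assumes ce: "nonlocal_ce_solution T w \<mu>"
  shows "\<exists>\<mu>'. (AE t in lebesgue_on {0..T}. \<mu>' t = \<mu> t) \<and> mde_solution T V \<mu>'"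
proof -
  have "\<forall>f\<in>test_functions. \<exists>c. AE t in lebesgue_on {0..T}. (\<integral>x. f x \<partial>\<mu> t) = c + integral {0..t} (flux f)"
    using ce_solution_representation[OF ce] by blast
  from bchoice[OF this] obtain c where c: "\<And>f. f \<in> test_functions \<Longrightarrow>
      AE s in lebesgue_on {0..T}. (\<integral>x. f x \<partial>\<mu> s) = c f + integral {0..s} (flux f)" by blast
  have "\<forall>t\<in>{0..T}. \<exists>\<sigma>. \<sigma> \<in> borel_probs \<and>
      (\<forall>f\<in>test_functions. (\<integral>x. f x \<partial>\<sigma>) = c f + integral {0..t} (flux f))"
    using ce_solution_measure_at[OF ce _ c] by blast
  from bchoice[OF this] obtain \<mu>' where \<mu>': "\<And>t. t \<in> {0..T} \<Longrightarrow> \<mu>' t \<in> borel_probs"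
    "\<And>t f. t \<in> {0..T} \<Longrightarrow> f \<in> test_functions \<Longrightarrow> (\<integral>x. f x \<partial>\<mu>' t) = c f + integral {0..t} (flux f)"
    by blast
  obtain C :: "('a \<Rightarrow> real) set" where C: "C \<subseteq> test_functions" "countable C"
    "\<And>M N. M \<in> borel_probs \<Longrightarrow> N \<in> borel_probs \<Longrightarrow> (\<And>f. f \<in> C \<Longrightarrow> (\<integral>x. f x \<partial>M) = (\<integral>x. f x \<partial>N)) \<Longrightarrow> M = N"
    using countable_determining_test_functions by metis
  have "AE t in lebesgue_on {0..T}. \<forall>f\<in>C. (\<integral>x. f x \<partial>\<mu> t) = c f + integral {0..t} (flux f)"
    using C(1,2) c by (intro AE_ball_countable') auto
  moreover have "AE t in lebesgue_on {0..T}. t \<in> {0..T}" by (rule AE_I2) simp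
  ultimately have eq: "AE t in lebesgue_on {0..T}. \<mu>' t = \<mu> t"
  proof eventually_elim
    case (elim t)
    then show ?case using \<mu>' \<mu>_prob C(1) by (intro C(3)) auto
  qed
  moreover have "mde_solution T V \<mu>'"
    using \<mu>' by (intro mde_solution_of_representation[OF _ eq flux_integrable[OF ce]]) auto
  ultimately show ?thesis by blast
qed

end

text \<open>A solution of the continuity equation stays one after a change on a null Borel set of
  times, but may then fail to be continuous in time, as every solution of the measure differential
  equation is. Hence the equivalence includes narrow continuity, and the second conjunct passes to a
  representative.\<close>

theorem proposition3p1:
  fixes T :: real
    and V :: "'a::euclidean_space measure \<Rightarrow> ('a \<times> 'a) measure"
    and \<mu> :: "real \<Rightarrow> 'a measure"
    and \<nu> :: "'a measure \<Rightarrow> 'a \<Rightarrow> 'a measure"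
    and w :: "'a measure \<Rightarrow> 'a \<Rightarrow> 'a"
  assumes "0 < T"
    and "probability_vector_field V"
    and "\<forall>t\<in>{0..T}. \<mu> t \<in> borel_probs"
    and "(\<lambda>t. \<integral>\<^sup>+(x, v). ennreal (norm v) \<partial>V (\<mu> t)) \<in> borel_measurable (lebesgue_on {0..T})"
    and "(\<integral>\<^sup>+t. (\<integral>\<^sup>+(x, v). ennreal (norm v) \<partial>V (\<mu> t)) \<partial>lebesgue_on {0..T}) < \<infinity>"
    and "\<forall>m\<in>borel_probs. disintegration (V m) m (\<nu> m)"
    and "barycentric_field \<nu> w"
  shows "(mde_solution T V \<mu> \<longleftrightarrow> narrowly_continuous T \<mu> \<and> nonlocal_ce_solution T w \<mu>)
    \<and> (nonlocal_ce_solution T w \<mu> \<longrightarrow>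
         (\<exists>\<mu>'. (AE t in lebesgue_on {0..T}. \<mu>' t = \<mu> t) \<and> mde_solution T V \<mu>'))"
proof -
  interpret mde_setting T V \<mu> \<nu> w
    by unfold_locales (fact assms)+
  show ?thesis
    using mde_solution_imp_narrowly_continuous mde_solution_imp_ce_solution
      narrow_ce_solution_imp_mde_solution ce_solution_imp_mde_representative by blast
qed

end
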